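(* Let $N\geq 1$ and let $\Omega\subset\mathbb{R}^N$ be an open, bounded and connected set with a continuous and piecewise $C^\infty$ boundary. Let $(S_n)_{n\in\mathbb{N}}\subset H^1_0(\Omega)$ be an $L^2(\Omega)$-orthonormal basis of eigenfunctions of the Dirichlet Laplacian, with $\Delta S_n=-\lambda_n^2 S_n$ in $\Omega$ and $\lambda_n>0$ (eigenvalues $\lambda_n^2$ listed in nondecreasing order and repeated according to multiplicity). Let $(a_n)_{n\in\mathbb{N}}\subset\mathbb{C}$ be a slowly growing sequence and let $$u(t,x)=\sum_{n=0}^{+\infty} a_n S_n(x)\, e^{i\lambda_n t}.$$ Let $\omega\subset\Omega$ be any non-empty open set. If $T>T_{max}(\Omega,\omega)$ and $u$ vanishes for $x\in\omega$ and $t\in\,]-T,T[$, then $u\equiv 0$.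
   Context: Indices: $\mathbb{N}=\{0,1,2,\dots\}$. A complex sequence $(a_n)_{n\in\mathbb{N}}$ is slowly growing (belongs to $s'$) if there is $q\in\mathbb{N}$ such that $((1+n)^{-q}a_n)_{n\in\mathbb{N}}\in\ell^1$. Meaning of $u$: for each $t\in\mathbb{R}$, $u(t,\cdot)$ is the distribution on $\Omega$ given by $\langle u(t,\cdot),\varphi\rangle=\sum_{n=0}^{+\infty}a_n\langle S_n,\varphi\rangle e^{i\lambda_n t}$ for $\varphi\in C_c^\infty(\Omega)$, where $\langle S_n,\varphi\rangle=\int_\Omega S_n\varphi\,dx$ (the series converges absolutely). That $u$ vanishes for $x\in\omega$, $t\in\,]-T,T[$ (written $u|_{\omega\times]-T,T[}=0$) means $\langle u(t,\cdot),\varphi\rangle=0$ for all $t\in\,]-T,T[$ and all $\varphi\in C_c^\infty(\omega)$. That $u\equiv0$ means $\langle u(t,\cdot),\varphi\rangle=0$ for all $t\in\mathbb{R}$ and all $\varphi\in C_c^\infty(\Omega)$. Geodesic distance: for $P_1,P_2\in\Omega$, $gd(P_1,P_2)$ is the infimum of the Euclidean lengths of paths from $P_1$ to $P_2$ contained in $\Omega$. For $P\in\Omega$ and non-empty $\Omega_0\subset\Omega$, $gd(P,\Omega_0)=\inf\{gd(P,Q):Q\in\Omega_0\}$, and $T_{max}(\Omega,\Omega_0)=\sup\{gd(P,\Omega_0):P\in\Omega\}$. *)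

theory Defs
  imports "HOL-Analysis.Analysis"
begin

section \<open>Smooth functions and test functions\<close>

definition partial_deriv ::
  "'a::euclidean_space \<Rightarrow> ('a \<Rightarrow> 'b::real_normed_vector) \<Rightarrow> 'a \<Rightarrow> 'b" where
  "partial_deriv b f x = frechet_derivative f (at x) b"

text \<open>Meant for open sets \<open>U\<close> only: derivatives are taken in the full space.\<close>

primrec Ck_on :: "nat \<Rightarrow> 'a::euclidean_space set \<Rightarrow> ('a \<Rightarrow> 'b::real_normed_vector) \<Rightarrow> bool" where
  "Ck_on 0 U f \<longleftrightarrow> continuous_on U f"
| "Ck_on (Suc k) U f \<longleftrightarrow>
     (\<forall>x\<in>U. f differentiable (at x)) \<and> (\<forall>b\<in>Basis. Ck_on k U (partial_deriv b f))"

definition smooth_on :: "'a::euclidean_space set \<Rightarrow> ('a \<Rightarrow> 'b::real_normed_vector) \<Rightarrow> bool" where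
  "smooth_on U f \<longleftrightarrow> (\<forall>k. Ck_on k U f)"

text \<open>\<open>C\<^sub>c\<^sup>\<infinity>(\<Omega>)\<close>, each test function being extended by zero to the whole space.\<close>

definition test_functions :: "'a::euclidean_space set \<Rightarrow> ('a \<Rightarrow> complex) set" where
  "test_functions \<Omega> =
     {\<phi>. smooth_on UNIV \<phi> \<and> compact (closure {x. \<phi> x \<noteq> 0}) \<and> closure {x. \<phi> x \<noteq> 0} \<subseteq> \<Omega>}"

definition laplacian :: "('a::euclidean_space \<Rightarrow> complex) \<Rightarrow> 'a \<Rightarrow> complex" where
  "laplacian \<phi> x = (\<Sum>b\<in>Basis. partial_deriv b (partial_deriv b \<phi>) x)"


section \<open>The spaces \<open>L\<^sup>2(\<Omega>)\<close> and \<open>H\<^sup>1\<^sub>0(\<Omega>)\<close>\<close>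

text \<open>Elements are represented by functions, not by classes modulo null sets; values outside
  \<open>\<Omega>\<close> are irrelevant.\<close>

definition L2_space :: "'a::euclidean_space set \<Rightarrow> ('a \<Rightarrow> complex) set" where
  "L2_space \<Omega> = {f. f \<in> borel_measurable (lebesgue_on \<Omega>) \<and>
                     integrable (lebesgue_on \<Omega>) (\<lambda>x. (cmod (f x))\<^sup>2)}"

definition L2_inner ::
  "'a::euclidean_space set \<Rightarrow> ('a \<Rightarrow> complex) \<Rightarrow> ('a \<Rightarrow> complex) \<Rightarrow> complex" where
  "L2_inner \<Omega> f g = (LINT x|lebesgue_on \<Omega>. f x * cnj (g x))"

definition L2_norm :: "'a::euclidean_space set \<Rightarrow> ('a \<Rightarrow> complex) \<Rightarrow> real" where
  "L2_norm \<Omega> f = sqrt (LINT x|lebesgue_on \<Omega>. (cmod (f x))\<^sup>2)"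

definition L2_orthonormal_basis ::
  "'a::euclidean_space set \<Rightarrow> (nat \<Rightarrow> 'a \<Rightarrow> complex) \<Rightarrow> bool" where
  "L2_orthonormal_basis \<Omega> S \<longleftrightarrow>
     (\<forall>n. S n \<in> L2_space \<Omega>) \<and>
     (\<forall>m n. L2_inner \<Omega> (S m) (S n) = (if m = n then 1 else 0)) \<and>
     (\<forall>f\<in>L2_space \<Omega>.
        (\<lambda>k. L2_norm \<Omega> (\<lambda>x. f x - (\<Sum>n<k. L2_inner \<Omega> f (S n) * S n x))) \<longlonglongrightarrow> 0)"

text \<open>The bilinear duality pairing (no complex conjugation) of a function on \<open>\<Omega>\<close>, viewed as
  a distribution, with a test function.\<close>

definition pairing ::
  "'a::euclidean_space set \<Rightarrow> ('a \<Rightarrow> complex) \<Rightarrow> ('a \<Rightarrow> complex) \<Rightarrow> complex" where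
  "pairing \<Omega> f \<phi> = (LINT x|lebesgue_on \<Omega>. f x * \<phi> x)"

definition has_weak_partial_deriv ::
  "'a::euclidean_space set \<Rightarrow> 'a \<Rightarrow> ('a \<Rightarrow> complex) \<Rightarrow> ('a \<Rightarrow> complex) \<Rightarrow> bool" where
  "has_weak_partial_deriv \<Omega> b f g \<longleftrightarrow>
     (\<forall>\<phi>\<in>test_functions \<Omega>. pairing \<Omega> f (partial_deriv b \<phi>) = - pairing \<Omega> g \<phi>)"

text \<open>The closure of \<open>C\<^sub>c\<^sup>\<infinity>(\<Omega>)\<close> in \<open>H\<^sup>1(\<Omega>)\<close>; \<open>D b\<close> is the weak partial derivative of \<open>f\<close> in the
  direction \<open>b\<close>.\<close>

definition H1_0 :: "'a::euclidean_space set \<Rightarrow> ('a \<Rightarrow> complex) set" where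
  "H1_0 \<Omega> = {f. f \<in> L2_space \<Omega> \<and>
     (\<exists>D. (\<forall>b\<in>Basis. D b \<in> L2_space \<Omega> \<and> has_weak_partial_deriv \<Omega> b f (D b)) \<and>
       (\<exists>\<phi>. (\<forall>k::nat. \<phi> k \<in> test_functions \<Omega>) \<and>
            (\<lambda>k. L2_norm \<Omega> (\<lambda>x. \<phi> k x - f x)) \<longlonglongrightarrow> 0 \<and>
            (\<forall>b\<in>Basis. (\<lambda>k. L2_norm \<Omega> (\<lambda>x. partial_deriv b (\<phi> k) x - D b x)) \<longlonglongrightarrow> 0)))}"

text \<open>\<open>\<Delta>f = \<mu>f\<close> in \<open>\<Omega>\<close>, in the sense of distributions. Together with \<open>f \<in> H1_0 \<Omega>\<close> this is the
  eigenvalue equation of the Dirichlet Laplacian.\<close>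

definition laplacian_eigen_eq ::
  "'a::euclidean_space set \<Rightarrow> ('a \<Rightarrow> complex) \<Rightarrow> real \<Rightarrow> bool" where
  "laplacian_eigen_eq \<Omega> f \<mu> \<longleftrightarrow>
     (\<forall>\<phi>\<in>test_functions \<Omega>. pairing \<Omega> f (laplacian \<phi>) = of_real \<mu> * pairing \<Omega> f \<phi>)"


section \<open>Regularity of the boundary\<close>

text \<open>Near each boundary point, \<open>\<Omega>\<close> is the part of the space lying strictly on one side of the
  graph of a continuous function \<open>g\<close> defined on the hyperplane orthogonal to a unit vector \<open>\<nu>\<close>.\<close>

definition continuous_boundary :: "'a::euclidean_space set \<Rightarrow> bool" where
  "continuous_boundary \<Omega> \<longleftrightarrow>
     (\<forall>p\<in>frontier \<Omega>. \<exists>U \<nu> g. open U \<and> p \<in> U \<and> norm \<nu> = 1 \<and>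
        continuous_on {y. y \<bullet> \<nu> = 0} g \<and>
        \<Omega> \<inter> U = {x\<in>U. x \<bullet> \<nu> < g (x - (x \<bullet> \<nu>) *\<^sub>R \<nu>)})"

text \<open>An embedded \<open>C\<^sup>\<infinity>\<close> submanifold of codimension one, given by local defining functions with
  nonvanishing gradient.\<close>

definition smooth_hypersurface :: "'a::euclidean_space set \<Rightarrow> bool" where
  "smooth_hypersurface \<Gamma> \<longleftrightarrow>
     (\<forall>p\<in>\<Gamma>. \<exists>U (F :: 'a \<Rightarrow> real). open U \<and> p \<in> U \<and> smooth_on U F \<and>
        (\<forall>x\<in>U. \<exists>b\<in>Basis. partial_deriv b F x \<noteq> 0) \<and> \<Gamma> \<inter> U = {x\<in>U. F x = 0})"

text \<open>The boundary consists of the closures of finitely many disjoint connected smooth pieces. No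
  regularity is imposed where these closures meet, so edges, corners, conical points and cusps
  are all allowed.\<close>

definition piecewise_smooth_boundary :: "'a::euclidean_space set \<Rightarrow> bool" where
  "piecewise_smooth_boundary \<Omega> \<longleftrightarrow>
     (\<exists>\<P>. finite \<P> \<and> pairwise disjnt \<P> \<and>
        (\<forall>\<Gamma>\<in>\<P>. openin (top_of_set (frontier \<Omega>)) \<Gamma> \<and> connected \<Gamma> \<and> smooth_hypersurface \<Gamma>) \<and>
        frontier \<Omega> = (\<Union>\<Gamma>\<in>\<P>. closure \<Gamma>))"


section \<open>Geodesic distance\<close>

text \<open>The length is the total variation, and is infinite for non-rectifiable paths.\<close>

definition path_length :: "(real \<Rightarrow> 'a::euclidean_space) \<Rightarrow> ereal" where
  "path_length \<gamma> =
     (SUP ts\<in>{ts. sorted ts \<and> set ts \<subseteq> {0..1}}.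
        ereal (\<Sum>i<length ts - 1. dist (\<gamma> (ts ! i)) (\<gamma> (ts ! Suc i))))"

definition geodesic_dist :: "'a::euclidean_space set \<Rightarrow> 'a \<Rightarrow> 'a \<Rightarrow> ereal" where
  "geodesic_dist \<Omega> P Q =
     (INF \<gamma>\<in>{\<gamma>. path \<gamma> \<and> path_image \<gamma> \<subseteq> \<Omega> \<and> pathstart \<gamma> = P \<and> pathfinish \<gamma> = Q}. path_length \<gamma>)"

definition geodesic_setdist :: "'a::euclidean_space set \<Rightarrow> 'a \<Rightarrow> 'a set \<Rightarrow> ereal" where
  "geodesic_setdist \<Omega> P \<Omega>\<^sub>0 = (INF Q\<in>\<Omega>\<^sub>0. geodesic_dist \<Omega> P Q)"

definition T_max :: "'a::euclidean_space set \<Rightarrow> 'a set \<Rightarrow> ereal" where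
  "T_max \<Omega> \<Omega>\<^sub>0 = (SUP P\<in>\<Omega>. geodesic_setdist \<Omega> P \<Omega>\<^sub>0)"


section \<open>The series\<close>

definition slowly_growing :: "(nat \<Rightarrow> complex) \<Rightarrow> bool" where
  "slowly_growing a \<longleftrightarrow> (\<exists>q::nat. summable (\<lambda>n. cmod (a n / (1 + of_nat n) ^ q)))"

text \<open>\<open>\<langle>u(t,\<cdot>), \<phi>\<rangle>\<close> for \<open>u(t,x) = \<Sum>n. a\<^sub>n S\<^sub>n(x) exp(i\<lambda>\<^sub>nt)\<close>. For a slowly growing \<open>a\<close> and a
  Dirichlet eigenbasis \<open>S\<close> the series converges absolutely.\<close>

definition u_pairing ::
  "'a::euclidean_space set \<Rightarrow> (nat \<Rightarrow> 'a \<Rightarrow> complex) \<Rightarrow> (nat \<Rightarrow> real) \<Rightarrow> (nat \<Rightarrow> complex) \<Rightarrow>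
     real \<Rightarrow> ('a \<Rightarrow> complex) \<Rightarrow> complex" where
  "u_pairing \<Omega> S lam a t \<phi> =
     (\<Sum>n. a n * pairing \<Omega> (S n) \<phi> * exp (\<i> * of_real (lam n * t)))"

end

theory Submission
  imports Defs "HOL-Complex_Analysis.Complex_Analysis"
begin

text \<open>For a test function \<open>\<phi>\<close> supported in \<open>\<omega>\<close>, all frequencies of \<open>t \<mapsto> \<langle>u(t), \<phi>\<rangle>\<close> are positive, so this
  function is the boundary value of a holomorphic function on the upper half-plane. It vanishes on
  an interval, hence identically, and letting \<open>t = iy\<close> with \<open>y \<rightarrow> \<infinity>\<close> shows that the part of \<open>u\<close>
  belonging to each single frequency vanishes on \<open>\<omega>\<close>. Such a part is an eigenfunction of the
  Laplacian, so it vanishes on \<open>\<Omega>\<close> by unique continuation, which is obtained from real analyticity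
  via Bernstein's gradient estimate. The series converges absolutely because \<open>\<lambda>\<^sub>n\<close> grows at least
  like a power of \<open>n\<close>.\<close>

section \<open>Calculus of test functions\<close>

text \<open>An eigenfunction is at first only an L^2 function that satisfies its equation against
  test functions. Unique continuation is therefore run on the functions h |->
  \<open>pairing \<Omega> f (\<lambda>x. \<phi> (x - h))\<close>. They are smooth in h and solve the
  Helmholtz equation classically as long as the translated support stays in \<Omega>. Their
  analyticity gives a propagation step whose length depends on the room inside \<Omega>, the
  dimension and the eigenvalue, but neither on \<phi> nor on the size of the set where vanishing is
  already known. Letting y grow isolates only the lowest frequency still present, so the frequencies
  are removed in increasing order, a whole group of equal ones at a time. Slow growth of
  \<open>a\<close> becomes absolute convergence as follows: powers of the Laplacian moved onto
  \<phi> give decay in powers of \<open>lam n\<close>, and the growth of \<open>lam n\<close> turns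
  this into decay in n. The growth itself is a count: ball averages of orthonormal functions with
  bounded Dirichlet energy keep a fixed share of their mass, while Bessel's inequality limits the
  total mass available.\<close>

lemma has_derivative_partial_deriv:
  assumes "f differentiable (at x)"
  shows "(f has_derivative (\<lambda>v. partial_deriv v f x)) (at x)"
  using assms by (simp add: partial_deriv_def frechet_derivative_works eta_contract_eq)

lemma partial_deriv_eqI:
  assumes "(f has_derivative f') (at x)"
  shows "partial_deriv b f x = f' b"
  using frechet_derivative_at[OF assms] by (simp add: partial_deriv_def)

lemma partial_deriv_cong_open:
  assumes "open U" "x \<in> U" "f differentiable (at x)" "\<And>y. y \<in> U \<Longrightarrow> f y = g y"
  shows "partial_deriv b g x = partial_deriv b f x"
  using has_derivative_transform_within_open[OF has_derivative_partial_deriv[OF assms(3)] assms(1,2)] assms(4)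
  by (intro partial_deriv_eqI) auto

lemma Ck_on_cong:
  assumes "open U" "\<And>x. x \<in> U \<Longrightarrow> f x = g x" "Ck_on k U f"
  shows "Ck_on k U g"
  using assms(2,3)
proof (induction k arbitrary: f g)
  case 0
  then show ?case by (simp cong: continuous_on_cong)
next
  case (Suc k)
  have d: "f differentiable (at x)" if "x \<in> U" for x using Suc.prems that by auto
  have "g differentiable (at x)" if "x \<in> U" for x
    using has_derivative_transform_within_open[OF has_derivative_partial_deriv[OF d[OF that]] assms(1) that] Suc.prems(1)
    by (auto simp: differentiable_def)
  moreover have "Ck_on k U (partial_deriv b g)" if "b \<in> Basis" for b
  proof (rule Suc.IH)
    show "Ck_on k U (partial_deriv b f)" using Suc.prems that by auto
    show "partial_deriv b f x = partial_deriv b g x" if "x \<in> U" for x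
      using partial_deriv_cong_open[OF assms(1) that d[OF that]] Suc.prems(1) by metis
  qed
  ultimately show ?case by simp
qed

lemma Ck_on_subset: "Ck_on k U f \<Longrightarrow> V \<subseteq> U \<Longrightarrow> Ck_on k V f"
  by (induction k arbitrary: f) (auto intro: continuous_on_subset)

lemma Ck_on_Suc_imp: "Ck_on (Suc k) U f \<Longrightarrow> Ck_on k U f"
proof (induction k arbitrary: f)
  case 0
  then show ?case
    by (auto intro!: differentiable_imp_continuous_on simp: differentiable_on_def
          intro: differentiable_at_imp_differentiable_on differentiable_at_withinI)
next
  case (Suc k)
  then have "Ck_on k U (partial_deriv b f)" if "b \<in> Basis" for b
    using that Suc.IH[of "partial_deriv b f"] by simp
  with Suc.prems show ?case by simp
qed

lemma Ck_on_const [simp]: "Ck_on k U (\<lambda>x. c)"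
proof (induction k arbitrary: c)
  case (Suc k)
  have "partial_deriv b (\<lambda>x. c) = (\<lambda>x. 0)" for b :: 'a
    by (rule ext, rule partial_deriv_eqI[where f' = "\<lambda>_. 0"]) simp
  with Suc show ?case by simp
qed simp

lemma Ck_on_add:
  assumes "open U" "Ck_on k U f" "Ck_on k U g"
  shows "Ck_on k U (\<lambda>x. f x + g x)"
  using assms(2,3)
proof (induction k arbitrary: f g)
  case 0
  then show ?case by (simp add: continuous_on_add)
next
  case (Suc k)
  have "Ck_on k U (partial_deriv b (\<lambda>x. f x + g x))" if b: "b \<in> Basis" for b
  proof (rule Ck_on_cong[OF assms(1)])
    show "Ck_on k U (\<lambda>x. partial_deriv b f x + partial_deriv b g x)" using Suc b by simp
    show "partial_deriv b f x + partial_deriv b g x = partial_deriv b (\<lambda>x. f x + g x) x" if "x \<in> U" for x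
      using Suc.prems that
      by (intro partial_deriv_eqI[symmetric] has_derivative_add has_derivative_partial_deriv) auto
  qed
  then show ?case using Suc.prems by auto
qed

lemma (in bounded_bilinear) Ck_on_prod:
  assumes "open U" "Ck_on k U f" "Ck_on k U g"
  shows "Ck_on k U (\<lambda>x. prod (f x) (g x))"
  using assms(2,3)
proof (induction k arbitrary: f g)
  case 0
  then show ?case by (simp add: continuous_on)
next
  case (Suc k)
  have d: "((\<lambda>x. prod (f x) (g x)) has_derivative
      (\<lambda>b. prod (f x) (partial_deriv b g x) + prod (partial_deriv b f x) (g x))) (at x)" if "x \<in> U" for x
    using Suc.prems that by (intro FDERIV has_derivative_partial_deriv) auto
  have "Ck_on k U (partial_deriv b (\<lambda>x. prod (f x) (g x)))" if b: "b \<in> Basis" for b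
  proof (rule Ck_on_cong[OF assms(1)])
    show "Ck_on k U (\<lambda>x. prod (f x) (partial_deriv b g x) + prod (partial_deriv b f x) (g x))"
      using Suc.prems b by (intro Ck_on_add Suc.IH assms Ck_on_Suc_imp[of k U f] Ck_on_Suc_imp[of k U g]) auto
    show "prod (f x) (partial_deriv b g x) + prod (partial_deriv b f x) (g x) =
        partial_deriv b (\<lambda>x. prod (f x) (g x)) x" if "x \<in> U" for x
      by (rule partial_deriv_eqI[OF d[OF that], symmetric])
  qed
  then show ?case using d by (auto simp: differentiable_def)
qed

lemmas Ck_on_mult = bounded_bilinear.Ck_on_prod[OF bounded_bilinear_mult]
lemmas Ck_on_scaleR = bounded_bilinear.Ck_on_prod[OF bounded_bilinear_scaleR]

lemma Ck_on_bounded_linear_comp: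
  assumes "open U" "bounded_linear L" "Ck_on k U f"
  shows "Ck_on k U (\<lambda>x. L (f x))"
  using assms(3)
proof (induction k arbitrary: f)
  case 0
  then show ?case by (simp add: linear_continuous_on_compose[OF _ bounded_linear.linear] assms(2) bounded_linear.continuous_on)
next
  case (Suc k)
  have d: "((\<lambda>x. L (f x)) has_derivative (\<lambda>b. L (partial_deriv b f x))) (at x)" if "x \<in> U" for x
    using Suc.prems that
    by (intro bounded_linear.has_derivative[OF assms(2)] has_derivative_partial_deriv) auto
  have "Ck_on k U (partial_deriv b (\<lambda>x. L (f x)))" if b: "b \<in> Basis" for b
    by (rule Ck_on_cong[OF assms(1) _ Suc.IH[of "partial_deriv b f"]])
      (use Suc.prems b in \<open>auto simp: partial_deriv_eqI[OF d]\<close>)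
  then show ?case using d by (auto simp: differentiable_def)
qed

lemma Ck_on_bounded_linear: "bounded_linear L \<Longrightarrow> Ck_on k U L"
proof (cases k)
  case 0
  assume "bounded_linear L"
  then show ?thesis using 0 by (simp add: linear_continuous_on)
next
  case (Suc m)
  assume L: "bounded_linear L"
  have "partial_deriv b L = (\<lambda>x. L b)" for b
    by (rule ext, rule partial_deriv_eqI, rule bounded_linear_imp_has_derivative[OF L])
  then show ?thesis using Suc bounded_linear_imp_differentiable[OF L] by simp
qed

lemma Ck_on_sum:
  assumes "open U" "\<And>i. i \<in> I \<Longrightarrow> Ck_on k U (f i)"
  shows "Ck_on k U (\<lambda>x. \<Sum>i\<in>I. f i x)"
  using assms(2) by (induction I rule: infinite_finite_induct) (auto intro!: Ck_on_add assms(1))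

text \<open>For gluing over an open cover: a quotient is smooth across the zeros of its denominator
  if its numerator vanishes identically near them.\<close>

lemma Ck_on_Un:
  assumes "open U" "open V" "Ck_on k U f" "Ck_on k V f"
  shows "Ck_on k (U \<union> V) f"
  using assms(3,4)
  by (induction k arbitrary: f) (auto intro!: continuous_on_open_Un assms(1,2))

lemma Ck_on_inverse:
  fixes f :: "'a::euclidean_space \<Rightarrow> real"
  assumes "open U" "\<And>x. x \<in> U \<Longrightarrow> f x \<noteq> 0" "Ck_on k U f"
  shows "Ck_on k U (\<lambda>x. inverse (f x))"
  using assms(3)
proof (induction k)
  case 0
  then show ?case using assms by (auto intro!: continuous_intros)
next
  case (Suc k)
  have d: "((\<lambda>x. inverse (f x)) has_derivative
      (\<lambda>b. - (inverse (f x) * partial_deriv b f x * inverse (f x)))) (at x)" if "x \<in> U" for x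
    using Suc.prems that assms(2)
    by (intro Deriv.has_derivative_inverse has_derivative_partial_deriv) auto
  have i: "Ck_on k U (\<lambda>x. inverse (f x))" by (rule Suc.IH[OF Ck_on_Suc_imp[OF Suc.prems]])
  have "Ck_on k U (partial_deriv b (\<lambda>x. inverse (f x)))" if b: "b \<in> Basis" for b
  proof (rule Ck_on_cong[OF assms(1)])
    show "Ck_on k U (\<lambda>x. (-1) * (inverse (f x) * partial_deriv b f x * inverse (f x)))"
      using Suc.prems b by (intro Ck_on_mult assms i Ck_on_const) auto
  qed (simp add: partial_deriv_eqI[OF d])
  then show ?case using d by (auto simp: differentiable_def)
qed

lemma partial_deriv_translate:
  assumes "f differentiable (at (x - h))"
  shows "((\<lambda>x. f (x - h)) has_derivative (\<lambda>b. partial_deriv b f (x - h))) (at x)"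
proof -
  have "(f \<circ> (\<lambda>x. x - h) has_derivative (\<lambda>b. partial_deriv b f (x - h)) \<circ> (\<lambda>v. v)) (at x)"
    by (rule diff_chain_at) (auto intro!: derivative_eq_intros has_derivative_partial_deriv assms)
  then show ?thesis by (simp add: o_def)
qed

lemma Ck_on_translate: "Ck_on k UNIV f \<Longrightarrow> Ck_on k UNIV (\<lambda>x. f (x - h))"
proof (induction k arbitrary: f)
  case 0
  then show ?case by (auto intro!: continuous_on_compose2[of UNIV f] continuous_intros)
next
  case (Suc k)
  have d: "((\<lambda>x. f (x - h)) has_derivative (\<lambda>b. partial_deriv b f (x - h))) (at x)" for x
    using Suc.prems by (intro partial_deriv_translate) auto
  have "partial_deriv b (\<lambda>x. f (x - h)) = (\<lambda>x. partial_deriv b f (x - h))" for b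
    by (rule ext, rule partial_deriv_eqI[OF d])
  then show ?case using d Suc by (auto simp: differentiable_def)
qed

lemma smooth_on_differentiable: "smooth_on U f \<Longrightarrow> x \<in> U \<Longrightarrow> f differentiable (at x)"
  unfolding smooth_on_def by (drule spec[of _ "Suc 0"]) simp

lemma smooth_on_continuous: "smooth_on U f \<Longrightarrow> continuous_on U f"
  unfolding smooth_on_def by (drule spec[of _ 0]) simp

lemma partial_deriv_sum_Basis:
  assumes "f differentiable (at x)"
  shows "partial_deriv e f x = (\<Sum>b\<in>Basis. (e \<bullet> b) *\<^sub>R partial_deriv b f x)"
proof -
  have l: "linear (\<lambda>v. partial_deriv v f x)"
    using has_derivative_partial_deriv[OF assms] has_derivative_linear by blast
  have "partial_deriv e f x = partial_deriv (\<Sum>b\<in>Basis. (e \<bullet> b) *\<^sub>R b) f x"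
    by (simp add: euclidean_representation)
  also have "\<dots> = (\<Sum>b\<in>Basis. (e \<bullet> b) *\<^sub>R partial_deriv b f x)"
    by (simp add: linear_sum[OF l] linear_scale[OF l])
  finally show ?thesis .
qed

text \<open>\<open>Ck_on\<close> differentiates along basis vectors only, while the propagation
  argument iterates the derivative along an arbitrary direction. Such a derivative is a combination
  of coordinate derivatives with constant coefficients.\<close>

lemma smooth_on_partial_deriv:
  assumes "open U" "smooth_on U f"
  shows "smooth_on U (partial_deriv e f)"
  unfolding smooth_on_def
proof
  fix k
  have "Ck_on (Suc k) U f" using assms by (simp add: smooth_on_def)
  then have "Ck_on k U (\<lambda>x. \<Sum>b\<in>Basis. (e \<bullet> b) *\<^sub>R partial_deriv b f x)"
    by (intro Ck_on_sum Ck_on_scaleR assms) auto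
  then show "Ck_on k U (partial_deriv e f)"
    by (rule Ck_on_cong[OF assms(1), rotated])
      (simp add: partial_deriv_sum_Basis[OF smooth_on_differentiable[OF assms(2)]])
qed

section \<open>Test functions: supports, closure properties, uniform bounds\<close>

lemma test_functionsI:
  assumes "smooth_on UNIV \<phi>" "compact K" "K \<subseteq> \<Omega>" "\<And>x. x \<notin> K \<Longrightarrow> \<phi> x = 0"
  shows "\<phi> \<in> test_functions \<Omega>"
proof -
  have "closure {x. \<phi> x \<noteq> 0} \<subseteq> K"
    using assms by (intro closure_minimal compact_imp_closed) auto
  then show ?thesis
    using assms compact_Int_closed[OF assms(2) closed_closure, of "{x. \<phi> x \<noteq> 0}"]
    by (auto simp: test_functions_def Int_absorb1)
qed

lemma test_functionsE:
  assumes "\<phi> \<in> test_functions \<Omega>"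
  obtains K where "smooth_on UNIV \<phi>" "compact K" "K \<subseteq> \<Omega>" "\<And>x. x \<notin> K \<Longrightarrow> \<phi> x = 0"
proof (rule that[of "closure {x. \<phi> x \<noteq> 0}"])
  show "\<phi> x = 0" if "x \<notin> closure {x. \<phi> x \<noteq> 0}" for x
    using that closure_subset[of "{x. \<phi> x \<noteq> 0}"] by blast
qed (use assms in \<open>auto simp: test_functions_def\<close>)

lemma test_functions_mono: "U \<subseteq> V \<Longrightarrow> \<phi> \<in> test_functions U \<Longrightarrow> \<phi> \<in> test_functions V"
  by (auto simp: test_functions_def)

lemma test_differentiable: "\<phi> \<in> test_functions \<Omega> \<Longrightarrow> \<phi> differentiable (at x)"
  by (auto simp: test_functions_def intro: smooth_on_differentiable)

lemma test_continuous: "\<phi> \<in> test_functions \<Omega> \<Longrightarrow> continuous_on UNIV \<phi>"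
  by (auto simp: test_functions_def intro: smooth_on_continuous)

lemma test_partial_deriv:
  assumes "\<phi> \<in> test_functions \<Omega>"
  shows "partial_deriv e \<phi> \<in> test_functions \<Omega>"
proof -
  obtain K where K: "smooth_on UNIV \<phi>" "compact K" "K \<subseteq> \<Omega>" "\<And>x. x \<notin> K \<Longrightarrow> \<phi> x = 0"
    using test_functionsE[OF assms] by blast
  have "partial_deriv e \<phi> x = 0" if "x \<notin> K" for x
  proof -
    have "partial_deriv e \<phi> x = partial_deriv e (\<lambda>_. 0) x"
      by (rule partial_deriv_cong_open[of "- K"]) (use K that compact_imp_closed in auto)
    also have "\<dots> = 0" by (rule partial_deriv_eqI[where f' = "\<lambda>_. 0"]) simp
    finally show ?thesis .
  qed
  with K show ?thesis by (intro test_functionsI[of _ K] smooth_on_partial_deriv) auto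
qed

lemma test_sum:
  assumes "finite I" "\<And>i. i \<in> I \<Longrightarrow> \<phi> i \<in> test_functions \<Omega>"
  shows "(\<lambda>x. \<Sum>i\<in>I. \<phi> i x) \<in> test_functions \<Omega>"
proof -
  define K where "K i = closure {x. \<phi> i x \<noteq> 0}" for i
  have sm: "smooth_on UNIV (\<phi> i)" and K: "compact (K i)" "K i \<subseteq> \<Omega>" if "i \<in> I" for i
    using assms(2)[OF that] by (auto simp: test_functions_def K_def)
  have z: "\<phi> i x = 0" if "x \<notin> K i" for i x
    using that closure_subset[of "{x. \<phi> i x \<noteq> 0}"] unfolding K_def by blast
  show ?thesis
  proof (rule test_functionsI)
    show "smooth_on UNIV (\<lambda>x. \<Sum>i\<in>I. \<phi> i x)"
      using sm by (auto simp: smooth_on_def intro!: Ck_on_sum)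
    show "compact (\<Union>i\<in>I. K i)" using K assms(1) by blast
    show "(\<Union>i\<in>I. K i) \<subseteq> \<Omega>" using K by blast
    show "(\<Sum>i\<in>I. \<phi> i x) = 0" if "x \<notin> (\<Union>i\<in>I. K i)" for x
      using that z by (intro sum.neutral ballI) blast
  qed
qed

lemma test_bounded_linear:
  assumes "bounded_linear L" "\<phi> \<in> test_functions \<Omega>"
  shows "(\<lambda>x. L (\<phi> x)) \<in> test_functions \<Omega>"
proof -
  obtain K where K: "smooth_on UNIV \<phi>" "compact K" "K \<subseteq> \<Omega>" "\<And>x. x \<notin> K \<Longrightarrow> \<phi> x = 0"
    using test_functionsE[OF assms(2)] by blast
  show ?thesis
  proof (rule test_functionsI[OF _ K(2,3)])
    show "smooth_on UNIV (\<lambda>x. L (\<phi> x))"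
      using K(1) Ck_on_bounded_linear_comp[OF open_UNIV assms(1)] unfolding smooth_on_def by blast
    show "L (\<phi> x) = 0" if "x \<notin> K" for x
      using linear_0[OF bounded_linear.linear[OF assms(1)]] K(4)[OF that] by simp
  qed
qed

lemma test_laplacian: "\<phi> \<in> test_functions \<Omega> \<Longrightarrow> laplacian \<phi> \<in> test_functions \<Omega>"
  unfolding laplacian_def[abs_def] by (intro test_sum test_partial_deriv) auto

lemma test_translate:
  assumes "\<phi> \<in> test_functions \<Omega>"
  shows "(\<lambda>x. \<phi> (x - h)) \<in> test_functions ((+) h ` \<Omega>)"
proof -
  obtain K where K: "smooth_on UNIV \<phi>" "compact K" "K \<subseteq> \<Omega>" "\<And>x. x \<notin> K \<Longrightarrow> \<phi> x = 0"
    using test_functionsE[OF assms] by blast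
  show ?thesis
  proof (rule test_functionsI)
    show "smooth_on UNIV (\<lambda>x. \<phi> (x - h))" using K(1) Ck_on_translate unfolding smooth_on_def by blast
    show "compact ((+) h ` K)" by (intro compact_translation K)
    show "(+) h ` K \<subseteq> (+) h ` \<Omega>" using K by auto
    show "\<phi> (x - h) = 0" if "x \<notin> (+) h ` K" for x
    proof (rule K(4))
      show "x - h \<notin> K" using that by (metis add.commute diff_add_cancel image_eqI)
    qed
  qed
qed

lemma partial_deriv_translate_eq:
  assumes "\<phi> \<in> test_functions \<Omega>"
  shows "partial_deriv b (\<lambda>x. \<phi> (x - h)) = (\<lambda>x. partial_deriv b \<phi> (x - h))"
  by (rule ext, rule partial_deriv_eqI, rule partial_deriv_translate) (rule test_differentiable[OF assms])

lemma laplacian_translate: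
  assumes "\<phi> \<in> test_functions \<Omega>"
  shows "laplacian (\<lambda>x. \<phi> (x - h)) x = laplacian \<phi> (x - h)"
  unfolding laplacian_def
  by (simp add: partial_deriv_translate_eq[OF assms] partial_deriv_translate_eq[OF test_partial_deriv[OF assms]])

lemma test_bounded:
  assumes "\<phi> \<in> test_functions \<Omega>"
  obtains C where "C > 0" "\<And>x. cmod (\<phi> x) \<le> C"
proof -
  obtain K where K: "smooth_on UNIV \<phi>" "compact K" "K \<subseteq> \<Omega>" "\<And>x. x \<notin> K \<Longrightarrow> \<phi> x = 0"
    using test_functionsE[OF assms] by blast
  have "bounded (\<phi> ` K)"
    by (intro compact_imp_bounded compact_continuous_image K continuous_on_subset[OF test_continuous[OF assms]]) auto
  then obtain C where "C > 0" "\<forall>y\<in>\<phi> ` K. cmod y \<le> C" using bounded_pos by blast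
  then have "cmod (\<phi> x) \<le> C" for x using K(4)[of x] by (cases "x \<in> K") auto
  then show thesis using that \<open>C > 0\<close> by blast
qed

lemma has_vector_derivative_along:
  assumes "\<phi> \<in> test_functions \<Omega>"
  shows "((\<lambda>t. \<phi> (x + t *\<^sub>R e)) has_vector_derivative partial_deriv e \<phi> (x + t *\<^sub>R e)) (at t within A)"
proof -
  have l: "linear (\<lambda>v. partial_deriv v \<phi> y)" for y
    using has_derivative_partial_deriv[OF test_differentiable[OF assms]] has_derivative_linear by blast
  have "(\<phi> \<circ> (\<lambda>t. x + t *\<^sub>R e) has_derivative (\<lambda>v. partial_deriv v \<phi> (x + t *\<^sub>R e)) \<circ> (\<lambda>s. s *\<^sub>R e)) (at t)"
    by (rule diff_chain_at)
      (auto intro!: derivative_eq_intros has_derivative_partial_deriv test_differentiable[OF assms])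
  then show ?thesis
    by (auto simp: o_def has_vector_derivative_def linear_scale[OF l] intro: has_derivative_at_withinI)
qed


section \<open>Pairings with translated test functions\<close>

lemma vector_derivative_segment_bound:
  fixes g :: "real \<Rightarrow> 'b::real_normed_vector"
  assumes "\<And>\<tau>. \<tau> \<in> closed_segment a b \<Longrightarrow> (g has_vector_derivative g' \<tau>) (at \<tau>)"
    and "\<And>\<tau>. \<tau> \<in> closed_segment a b \<Longrightarrow> norm (g' \<tau>) \<le> B"
  shows "norm (g b - g a) \<le> B * \<bar>b - a\<bar>"
proof -
  have "norm (g b - g a) \<le> B * norm (b - a)"
  proof (rule differentiable_bound[of "closed_segment a b" g "\<lambda>\<tau> s. s *\<^sub>R g' \<tau>"])
    show "(g has_derivative (\<lambda>s. s *\<^sub>R g' \<tau>)) (at \<tau> within closed_segment a b)"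
      if "\<tau> \<in> closed_segment a b" for \<tau>
      using assms(1)[OF that] by (auto simp: has_vector_derivative_def intro: has_derivative_at_withinI)
    show "onorm (\<lambda>s. s *\<^sub>R g' \<tau>) \<le> B" if "\<tau> \<in> closed_segment a b" for \<tau>
      using assms(2)[OF that] order_trans[OF norm_ge_zero assms(2)[OF that]]
      by (intro onorm_bound) (auto simp: mult.commute[of B] mult_left_mono)
  qed auto
  then show ?thesis by simp
qed

lemma test_Lipschitz:
  fixes \<phi> :: "'a::euclidean_space \<Rightarrow> complex"
  assumes "\<phi> \<in> test_functions \<Omega>"
  obtains L where "L > 0" "\<And>x y. cmod (\<phi> x - \<phi> y) \<le> L * norm (x - y)"
proof -
  have "\<exists>C>0. \<forall>x. cmod (partial_deriv b \<phi> x) \<le> C" for b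
    using test_bounded[OF test_partial_deriv[OF assms]] by metis
  then obtain C where C: "\<And>b. C b > 0" "\<And>b x. cmod (partial_deriv b \<phi> x) \<le> C b" by metis
  have "cmod (\<phi> x - \<phi> y) \<le> (\<Sum>b\<in>Basis. C b) * norm (x - y)" for x y
  proof -
    define e where "e = x - y"
    have "cmod (partial_deriv e \<phi> z) \<le> (\<Sum>b\<in>Basis. C b) * norm e" for z
    proof -
      have "cmod (partial_deriv e \<phi> z) \<le> (\<Sum>b\<in>Basis. norm e * C b)"
        unfolding partial_deriv_sum_Basis[OF test_differentiable[OF assms], of e]
        using C by (intro sum_norm_le) (auto intro!: mult_mono Basis_le_norm)
      then show ?thesis by (simp add: sum_distrib_left[symmetric] mult.commute[of _ "norm e"])
    qed
    then have "cmod (\<phi> (y + 1 *\<^sub>R e) - \<phi> (y + 0 *\<^sub>R e)) \<le> ((\<Sum>b\<in>Basis. C b) * norm e) * \<bar>1 - 0\<bar>"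
      by (intro vector_derivative_segment_bound[OF has_vector_derivative_along[OF assms]]) auto
    then show ?thesis by (simp add: e_def)
  qed
  moreover have "(\<Sum>b\<in>(Basis::'a set). C b) > 0" using C by (intro sum_pos) auto
  ultimately show thesis using that by blast
qed

text \<open>The mean value inequality is applied twice, to the derivative along \<open>e\<close> and
  to \<phi> minus its linear part. The bound is uniform in \<open>x\<close>, so it survives
  integration against an L^1 function.\<close>

lemma test_quadratic_approx:
  assumes "\<phi> \<in> test_functions \<Omega>"
  obtains C where "C > 0" "\<And>x s. cmod (\<phi> (x + s *\<^sub>R e) - \<phi> x - s *\<^sub>R partial_deriv e \<phi> x) \<le> C * s\<^sup>2"
proof -
  obtain C where C: "C > 0" "\<And>x. cmod (partial_deriv e (partial_deriv e \<phi>) x) \<le> C"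
    using test_bounded[OF test_partial_deriv[OF test_partial_deriv[OF assms]]] by metis
  have 1: "cmod (partial_deriv e \<phi> (x + \<tau> *\<^sub>R e) - partial_deriv e \<phi> x) \<le> C * \<bar>\<tau>\<bar>" for x \<tau>
  proof -
    have "cmod (partial_deriv e \<phi> (x + \<tau> *\<^sub>R e) - partial_deriv e \<phi> (x + 0 *\<^sub>R e)) \<le> C * \<bar>\<tau> - 0\<bar>"
      by (rule vector_derivative_segment_bound[OF has_vector_derivative_along[OF test_partial_deriv[OF assms]]]) (rule C(2))
    then show ?thesis by simp
  qed
  have "cmod (\<phi> (x + s *\<^sub>R e) - \<phi> x - s *\<^sub>R partial_deriv e \<phi> x) \<le> C * s\<^sup>2" for x s
  proof -
    have "norm ((\<phi> (x + s *\<^sub>R e) - s *\<^sub>R partial_deriv e \<phi> x) - (\<phi> (x + 0 *\<^sub>R e) - 0 *\<^sub>R partial_deriv e \<phi> x))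
        \<le> (C * \<bar>s\<bar>) * \<bar>s - 0\<bar>"
    proof (rule vector_derivative_segment_bound)
      show "((\<lambda>s. \<phi> (x + s *\<^sub>R e) - s *\<^sub>R partial_deriv e \<phi> x) has_vector_derivative
           (partial_deriv e \<phi> (x + \<tau> *\<^sub>R e) - partial_deriv e \<phi> x)) (at \<tau>)" for \<tau>
        by (intro has_vector_derivative_diff has_vector_derivative_along[OF assms])
          (auto intro!: derivative_eq_intros simp: has_vector_derivative_def)
      show "cmod (partial_deriv e \<phi> (x + \<tau> *\<^sub>R e) - partial_deriv e \<phi> x) \<le> C * \<bar>s\<bar>"
        if "\<tau> \<in> closed_segment 0 s" for \<tau>
      proof -
        have "\<bar>\<tau>\<bar> \<le> \<bar>s\<bar>" using that by (auto simp: closed_segment_eq_real_ivl split: if_splits)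
        then show ?thesis using order_trans[OF 1] C(1) by (meson less_imp_le mult_left_mono)
      qed
    qed
    then show ?thesis by (simp add: power2_eq_square algebra_simps abs_mult_self_eq)
  qed
  with C(1) that show thesis by blast
qed

text \<open>Finite measure puts L^2 inside L^1, through y <= 1 + y^2.\<close>

lemma L2_space_integrable:
  assumes "f \<in> L2_space \<Omega>" "\<Omega> \<in> lmeasurable"
  shows "integrable (lebesgue_on \<Omega>) f"
proof (rule Bochner_Integration.integrable_bound)
  interpret finite_measure "lebesgue_on \<Omega>" using assms(2) by (rule finite_measure_lebesgue_on)
  show "integrable (lebesgue_on \<Omega>) (\<lambda>x. 1 + (cmod (f x))\<^sup>2)"
    using assms(1) by (intro Bochner_Integration.integrable_add integrable_const) (auto simp: L2_space_def)
  show "f \<in> borel_measurable (lebesgue_on \<Omega>)" using assms(1) by (auto simp: L2_space_def)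
  have "y \<le> 1 + y\<^sup>2" for y :: real
    using zero_le_power2[of "y - 1 / 2"] by (simp add: power2_eq_square algebra_simps)
  then show "AE x in lebesgue_on \<Omega>. norm (f x) \<le> norm (1 + (cmod (f x))\<^sup>2)" by simp
qed

lemma integrable_mult_bounded_continuous:
  fixes f \<phi> :: "'a::euclidean_space \<Rightarrow> complex"
  assumes "integrable (lebesgue_on \<Omega>) f" "\<Omega> \<in> sets lebesgue" "continuous_on UNIV \<phi>" "\<And>x. cmod (\<phi> x) \<le> C"
  shows "integrable (lebesgue_on \<Omega>) (\<lambda>x. f x * \<phi> x)"
    and "cmod (pairing \<Omega> f \<phi>) \<le> C * (LINT x|lebesgue_on \<Omega>. cmod (f x))"
proof -
  have m: "\<phi> \<in> borel_measurable (lebesgue_on \<Omega>)"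
    using assms by (intro continuous_imp_measurable_on_sets_lebesgue) (auto intro: continuous_on_subset)
  have i: "integrable (lebesgue_on \<Omega>) (\<lambda>x. C * cmod (f x))" using assms(1) by simp
  have b: "cmod (f x * \<phi> x) \<le> C * cmod (f x)" for x
    using assms(4)[of x] by (simp add: norm_mult mult.commute mult_right_mono)
  show *: "integrable (lebesgue_on \<Omega>) (\<lambda>x. f x * \<phi> x)"
    by (rule Bochner_Integration.integrable_bound[OF i])
      (use m assms(1) b in \<open>auto intro!: AE_I2 order_trans[OF b]\<close>)
  have "cmod (pairing \<Omega> f \<phi>) \<le> (LINT x|lebesgue_on \<Omega>. cmod (f x * \<phi> x))"
    unfolding pairing_def by (rule integral_norm_bound)
  also have "\<dots> \<le> (LINT x|lebesgue_on \<Omega>. C * cmod (f x))"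
    using * i b by (intro integral_mono) auto
  finally show "cmod (pairing \<Omega> f \<phi>) \<le> C * (LINT x|lebesgue_on \<Omega>. cmod (f x))" by simp
qed

lemma integrable_mult_test:
  assumes "integrable (lebesgue_on \<Omega>) f" "\<Omega> \<in> sets lebesgue" "\<phi> \<in> test_functions U"
  shows "integrable (lebesgue_on \<Omega>) (\<lambda>x. f x * \<phi> x)"
proof -
  obtain C where "\<And>x. cmod (\<phi> x) \<le> C" using test_bounded[OF assms(3)] by metis
  then show ?thesis
    using integrable_mult_bounded_continuous(1)[OF assms(1,2) test_continuous[OF assms(3)]] by blast
qed

lemma test_translate_UNIV: "\<phi> \<in> test_functions \<Omega> \<Longrightarrow> (\<lambda>x. \<phi> (x - h)) \<in> test_functions UNIV"
  using test_functions_mono[OF subset_UNIV test_translate] by blast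

lemma pairing_translate_Lipschitz:
  assumes f: "integrable (lebesgue_on \<Omega>) f" "\<Omega> \<in> sets lebesgue" and \<phi>: "\<phi> \<in> test_functions U"
  obtains L where "L \<ge> 0"
    "\<And>h k. cmod (pairing \<Omega> f (\<lambda>x. \<phi> (x - h)) - pairing \<Omega> f (\<lambda>x. \<phi> (x - k))) \<le> L * norm (h - k)"
proof -
  obtain L where L: "L > 0" "\<And>x y. cmod (\<phi> x - \<phi> y) \<le> L * norm (x - y)" using test_Lipschitz[OF \<phi>] by metis
  have "cmod (pairing \<Omega> f (\<lambda>x. \<phi> (x - h)) - pairing \<Omega> f (\<lambda>x. \<phi> (x - k)))
      \<le> (L * (LINT x|lebesgue_on \<Omega>. cmod (f x))) * norm (h - k)" for h k
  proof -
    have "pairing \<Omega> f (\<lambda>x. \<phi> (x - h)) - pairing \<Omega> f (\<lambda>x. \<phi> (x - k)) = pairing \<Omega> f (\<lambda>x. \<phi> (x - h) - \<phi> (x - k))"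
      unfolding pairing_def
      by (subst Bochner_Integration.integral_diff[symmetric])
        (auto intro!: integrable_mult_test[OF f] test_translate_UNIV \<phi> simp: algebra_simps)
    also have "cmod \<dots> \<le> (L * norm (h - k)) * (LINT x|lebesgue_on \<Omega>. cmod (f x))"
    proof (rule integrable_mult_bounded_continuous(2)[OF f])
      show "continuous_on UNIV (\<lambda>x. \<phi> (x - h) - \<phi> (x - k))"
        by (intro continuous_on_diff test_continuous[OF test_translate_UNIV[OF \<phi>]])
      show "cmod (\<phi> (x - h) - \<phi> (x - k)) \<le> L * norm (h - k)" for x
        using L(2)[of "x - h" "x - k"] by (simp add: norm_minus_commute)
    qed
    finally show ?thesis by (simp add: algebra_simps)
  qed
  moreover have "L * (LINT x|lebesgue_on \<Omega>. cmod (f x)) \<ge> 0" using L(1) by simp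
  ultimately show thesis using that by blast
qed

text \<open>Serves twice: for pairings with translates, and for the flat functions at the
  origin.\<close>

lemma has_vector_derivative_quadratic:
  fixes g :: "real \<Rightarrow> 'b::real_normed_vector"
  assumes "\<And>s. norm (g (t + s) - g t - s *\<^sub>R d) \<le> C * s\<^sup>2"
  shows "(g has_vector_derivative d) (at t)"
  unfolding has_vector_derivative_def has_derivative_at
proof (intro conjI bounded_linear_scaleR_left)
  show "(\<lambda>s. norm (g (t + s) - g t - s *\<^sub>R d) / norm s) \<midarrow>0\<rightarrow> 0"
  proof (rule Lim_null_comparison)
    show "\<forall>\<^sub>F s in at 0. norm (norm (g (t + s) - g t - s *\<^sub>R d) / norm s) \<le> C * \<bar>s\<bar>"
      using assms by (auto simp: eventually_at_filter field_simps power2_eq_square abs_mult_self_eq intro!: always_eventually)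
    show "((\<lambda>s. C * \<bar>s\<bar>) \<longlongrightarrow> 0) (at (0::real))"
      by (auto intro!: tendsto_eq_intros)
  qed
qed

text \<open>Differentiation under the integral sign, by the uniform Taylor remainder instead of
  dominated convergence. The derivative falls on \<phi>, so the pairing is smooth in the translation
  although \<open>f\<close> is merely integrable.\<close>

lemma pairing_translate_deriv:
  assumes f: "integrable (lebesgue_on \<Omega>) f" "\<Omega> \<in> sets lebesgue" and \<phi>: "\<phi> \<in> test_functions U"
  shows "((\<lambda>t. pairing \<Omega> f (\<lambda>x. \<phi> (x - (h + t *\<^sub>R e)))) has_vector_derivative
    - pairing \<Omega> f (\<lambda>x. partial_deriv e \<phi> (x - (h + t *\<^sub>R e)))) (at t)"
proof -
  obtain C where C: "C > 0" "\<And>x s. cmod (\<phi> (x + s *\<^sub>R e) - \<phi> x - s *\<^sub>R partial_deriv e \<phi> x) \<le> C * s\<^sup>2"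
    using test_quadratic_approx[OF \<phi>, of e] by metis
  define k where "k = h + t *\<^sub>R e"
  have t1: "(\<lambda>x. \<phi> (x - l)) \<in> test_functions UNIV" for l by (rule test_translate_UNIV[OF \<phi>])
  have t2: "(\<lambda>x. partial_deriv e \<phi> (x - l)) \<in> test_functions UNIV" for l
    by (rule test_translate_UNIV[OF test_partial_deriv[OF \<phi>]])
  show ?thesis
  proof (rule has_vector_derivative_quadratic[where C = "C * (LINT x|lebesgue_on \<Omega>. cmod (f x))"])
    fix s :: real
    have "h + (t + s) *\<^sub>R e = k + s *\<^sub>R e" by (simp add: k_def algebra_simps)
    moreover have "pairing \<Omega> f (\<lambda>x. \<phi> (x - (k + s *\<^sub>R e))) - pairing \<Omega> f (\<lambda>x. \<phi> (x - k))
          - s *\<^sub>R - pairing \<Omega> f (\<lambda>x. partial_deriv e \<phi> (x - k))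
        = pairing \<Omega> f (\<lambda>x. \<phi> (x - (k + s *\<^sub>R e)) - \<phi> (x - k) + of_real s * partial_deriv e \<phi> (x - k))" (is "?A = _")
    proof -
      have "?A = pairing \<Omega> f (\<lambda>x. \<phi> (x - (k + s *\<^sub>R e))) - pairing \<Omega> f (\<lambda>x. \<phi> (x - k))
          + of_real s * pairing \<Omega> f (\<lambda>x. partial_deriv e \<phi> (x - k))" by (simp add: scaleR_conv_of_real)
      also have "\<dots> = (LINT x|lebesgue_on \<Omega>. f x * \<phi> (x - (k + s *\<^sub>R e)) - f x * \<phi> (x - k)
          + of_real s * (f x * partial_deriv e \<phi> (x - k)))"
        unfolding pairing_def using integrable_mult_test[OF f t1] integrable_mult_test[OF f t2]
        by (subst Bochner_Integration.integral_add Bochner_Integration.integral_diff; force)+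
      finally show ?thesis by (simp add: pairing_def algebra_simps)
    qed
    moreover have "cmod (pairing \<Omega> f (\<lambda>x. \<phi> (x - (k + s *\<^sub>R e)) - \<phi> (x - k) + of_real s * partial_deriv e \<phi> (x - k)))
       \<le> (C * s\<^sup>2) * (LINT x|lebesgue_on \<Omega>. cmod (f x))"
    proof (rule integrable_mult_bounded_continuous(2)[OF f])
      show "continuous_on UNIV (\<lambda>x. \<phi> (x - (k + s *\<^sub>R e)) - \<phi> (x - k) + of_real s * partial_deriv e \<phi> (x - k))"
        by (intro continuous_intros test_continuous[OF t1] test_continuous[OF t2])
      \<comment> \<open>Moving the translate forward by \<open>s\<close> moves the argument of
        \<phi> backward, hence the increment \<open>- s\<close>; the same effect puts the minus sign
        into the derivative.\<close>
      show "cmod (\<phi> (x - (k + s *\<^sub>R e)) - \<phi> (x - k) + of_real s * partial_deriv e \<phi> (x - k)) \<le> C * s\<^sup>2" for x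
        using C(2)[of "x - k" "- s"] by (simp add: algebra_simps scaleR_conv_of_real)
    qed
    ultimately show "norm (pairing \<Omega> f (\<lambda>x. \<phi> (x - (h + (t + s) *\<^sub>R e))) - pairing \<Omega> f (\<lambda>x. \<phi> (x - (h + t *\<^sub>R e)))
       - s *\<^sub>R - pairing \<Omega> f (\<lambda>x. partial_deriv e \<phi> (x - (h + t *\<^sub>R e)))) \<le> C * (LINT x|lebesgue_on \<Omega>. cmod (f x)) * s\<^sup>2"
      by (simp add: k_def algebra_simps)
  qed
qed

lemma pairing_sum_right:
  assumes f: "integrable (lebesgue_on \<Omega>) f" "\<Omega> \<in> sets lebesgue"
    and "finite I" "\<And>i. i \<in> I \<Longrightarrow> \<phi> i \<in> test_functions U"
  shows "pairing \<Omega> f (\<lambda>x. \<Sum>i\<in>I. \<phi> i x) = (\<Sum>i\<in>I. pairing \<Omega> f (\<phi> i))"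
  unfolding pairing_def sum_distrib_left
  by (rule Bochner_Integration.integral_sum) (rule integrable_mult_test[OF f assms(4)])


section \<open>Derivative bounds for solutions of the Helmholtz equation\<close>

lemma no_local_max_if_second_deriv_pos:
  fixes g g' :: "real \<Rightarrow> real"
  assumes "\<delta> > 0" "\<And>t. \<bar>t\<bar> < \<delta> \<Longrightarrow> (g has_real_derivative g' t) (at t)"
    and "(g' has_real_derivative d) (at 0)" "d > 0"
  shows "\<exists>t. \<bar>t\<bar> < \<delta> \<and> g t > g 0"
proof (rule ccontr)
  assume "\<not> ?thesis"
  then have max: "g t \<le> g 0" if "\<bar>t\<bar> < \<delta>" for t using that by force
  have "g' 0 = 0"
    by (rule DERIV_local_max[of g _ 0 \<delta>]) (use assms max in auto)
  moreover obtain s where s: "s > 0" "\<And>h. 0 < h \<Longrightarrow> h < s \<Longrightarrow> g' 0 < g' (0 + h)"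
    using DERIV_pos_inc_right[OF assms(3,4)] by blast
  define t where "t = min s \<delta> / 2"
  have t: "0 < t" "t < s" "t < \<delta>" using s(1) assms(1) by (auto simp: t_def)
  obtain z where "0 < z" "z < t" "g t - g 0 = (t - 0) * g' z"
    using MVT2[of 0 t g g'] assms(2) t by auto
  moreover have "g' z > 0" using s(2)[of z] calculation t by auto
  ultimately have "g t - g 0 > 0" using t by simp
  then show False using max[of t] t by auto
qed

lemma has_real_derivative_slice:
  fixes v :: "'a::real_vector \<Rightarrow> real"
  assumes "((\<lambda>s. v ((y + t *\<^sub>R b) + s *\<^sub>R b)) has_real_derivative d) (at 0)"
  shows "((\<lambda>s. v (y + s *\<^sub>R b)) has_real_derivative d) (at t)"
proof -
  have "(\<lambda>s. v ((y + t *\<^sub>R b) + s *\<^sub>R b)) = (\<lambda>s. (\<lambda>s. v (y + s *\<^sub>R b)) (s + t))"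
    by (simp add: algebra_simps)
  then show ?thesis using assms DERIV_shift[of "\<lambda>s. v (y + s *\<^sub>R b)" d 0 t] by simp
qed

text \<open>A positive sum of second derivatives has a positive term, and along that coordinate an
  interior maximum is impossible. Derivatives enter as families of one-dimensional slices, which is
  the form in which translated pairings supply them.\<close>

lemma strict_subharmonic_max_on_sphere:
  fixes w :: "'a::euclidean_space \<Rightarrow> real"
  assumes "\<rho> > 0" and cont: "continuous_on (cball x \<rho>) w"
    and w1: "\<And>y b. y \<in> ball x \<rho> \<Longrightarrow> b \<in> Basis \<Longrightarrow> ((\<lambda>t. w (y + t *\<^sub>R b)) has_real_derivative w1 b y) (at 0)"
    and w2: "\<And>y b. y \<in> ball x \<rho> \<Longrightarrow> b \<in> Basis \<Longrightarrow> ((\<lambda>t. w1 b (y + t *\<^sub>R b)) has_real_derivative w2 b y) (at 0)"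
    and pos: "\<And>y. y \<in> ball x \<rho> \<Longrightarrow> (\<Sum>b\<in>Basis. w2 b y) > 0"
  obtains z where "norm (z - x) = \<rho>" "w x \<le> w z"
proof -
  have "cball x \<rho> \<noteq> {}" using assms(1) by auto
  then obtain z where z: "z \<in> cball x \<rho>" "\<And>y. y \<in> cball x \<rho> \<Longrightarrow> w y \<le> w z"
    using continuous_attains_sup[OF compact_cball _ cont] by blast
  have "z \<notin> ball x \<rho>"
  proof
    assume zb: "z \<in> ball x \<rho>"
    obtain b where b: "b \<in> Basis" "w2 b z > 0"
      using pos[OF zb] by (metis not_less sum_nonpos)
    obtain \<delta> where d: "\<delta> > 0" "ball z \<delta> \<subseteq> ball x \<rho>" using zb open_contains_ball open_ball by blast
    have zt: "z + t *\<^sub>R b \<in> ball x \<rho>" if "\<bar>t\<bar> < \<delta>" for t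
      using that b(1) d(2) by (force simp: dist_norm)
    obtain t where "\<bar>t\<bar> < \<delta>" "w (z + t *\<^sub>R b) > w (z + 0 *\<^sub>R b)"
      using no_local_max_if_second_deriv_pos[OF d(1), of "\<lambda>t. w (z + t *\<^sub>R b)" "\<lambda>t. w1 b (z + t *\<^sub>R b)" "w2 b z"]
        has_real_derivative_slice[OF w1[OF zt b(1)]] w2[OF zb b(1)] b(2) by blast
    then show False using z(2)[of "z + t *\<^sub>R b"] zt[of t] by auto
  qed
  with z that[of z] assms(1) show thesis by (auto simp: dist_norm norm_minus_commute)
qed

text \<open>Bernstein's method: the maximum principle for \<open>(\<rho>\<^sup>2 - |y - x|\<^sup>2)\<^sup>2 g\<^sup>2 + C\<^sub>1 v\<^sup>2 + C\<^sub>2 M\<^sup>2 |y - x|\<^sup>2\<close>,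
  where \<open>g\<close> is meant to be a directional derivative of \<open>v\<close>.\<close>

lemma Helmholtz_derivative_bound:
  fixes v g :: "'a::euclidean_space \<Rightarrow> real" and \<mu> M \<rho> :: real
  assumes \<rho>: "0 < \<rho>" "\<rho> \<le> 1" and \<mu>: "\<mu> \<ge> 0" and M: "M > 0"
    and cont: "continuous_on (cball x \<rho>) v" "continuous_on (cball x \<rho>) g"
    and v1: "\<And>y b. y \<in> ball x \<rho> \<Longrightarrow> b \<in> Basis \<Longrightarrow> ((\<lambda>t. v (y + t *\<^sub>R b)) has_real_derivative v1 b y) (at 0)"
    and v2: "\<And>y b. y \<in> ball x \<rho> \<Longrightarrow> b \<in> Basis \<Longrightarrow> ((\<lambda>t. v1 b (y + t *\<^sub>R b)) has_real_derivative v2 b y) (at 0)"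
    and g1: "\<And>y b. y \<in> ball x \<rho> \<Longrightarrow> b \<in> Basis \<Longrightarrow> ((\<lambda>t. g (y + t *\<^sub>R b)) has_real_derivative g1 b y) (at 0)"
    and g2: "\<And>y b. y \<in> ball x \<rho> \<Longrightarrow> b \<in> Basis \<Longrightarrow> ((\<lambda>t. g1 b (y + t *\<^sub>R b)) has_real_derivative g2 b y) (at 0)"
    and eqv: "\<And>y. y \<in> ball x \<rho> \<Longrightarrow> (\<Sum>b\<in>Basis. v2 b y) = - \<mu> * v y"
    and eqg: "\<And>y. y \<in> ball x \<rho> \<Longrightarrow> (\<Sum>b\<in>Basis. g2 b y) = - \<mu> * g y"
    and grad: "\<And>y. y \<in> ball x \<rho> \<Longrightarrow> (g y)\<^sup>2 \<le> (\<Sum>b\<in>Basis. (v1 b y)\<^sup>2)"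
    and bound: "\<And>y. y \<in> cball x \<rho> \<Longrightarrow> \<bar>v y\<bar> \<le> M"
  shows "(g x)\<^sup>2 \<le> ((12 + 2 * DIM('a) + \<mu>) * (1 + \<mu>) + 1) * M\<^sup>2 / \<rho>\<^sup>2"
proof -
  \<comment> \<open>With N the dimension, \<open>2 * C1\<close> becomes \<rho>^2 (24 + 4 N + 2
    \<mu>), which dominates the negative multiples of \<open>(g y)\<^sup>2\<close> in the Laplacian
    of \<open>w\<close>. \<open>C2\<close> compensates the term with
    \<open>C1 * \<mu> * (v y)\<^sup>2\<close>, and its surplus \<rho>^2 makes the sign
    strict.\<close>
  define c where "c = 12 + 2 * real DIM('a) + \<mu>"
  define C1 where "C1 = \<rho>\<^sup>2 * c"
  define C2 where "C2 = C1 * \<mu> + \<rho>\<^sup>2"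
  have c: "c > 0" using \<mu> by (simp add: c_def add_pos_nonneg)
  have C1: "C1 > 0" using \<rho> c by (simp add: C1_def)
  have C2: "C2 > 0" using \<rho> \<mu> C1 by (simp add: C2_def add_nonneg_pos)
  define \<eta> where "\<eta> y = \<rho>\<^sup>2 - (norm (y - x))\<^sup>2" for y
  define w where "w y = (\<eta> y)\<^sup>2 * (g y)\<^sup>2 + C1 * (v y)\<^sup>2 + C2 * M\<^sup>2 * (norm (y - x))\<^sup>2" for y
  define w1 where "w1 b y = - 4 * \<eta> y * ((y - x) \<bullet> b) * (g y)\<^sup>2 + 2 * (\<eta> y)\<^sup>2 * g y * g1 b y + 2 * C1 * v y * v1 b y
     + 2 * C2 * M\<^sup>2 * ((y - x) \<bullet> b)" for b y
  define w2 where "w2 b y = 8 * ((y - x) \<bullet> b)\<^sup>2 * (g y)\<^sup>2 - 4 * \<eta> y * (g y)\<^sup>2 - 16 * \<eta> y * ((y - x) \<bullet> b) * g y * g1 b y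
     + 2 * (\<eta> y)\<^sup>2 * ((g1 b y)\<^sup>2 + g y * g2 b y) + 2 * C1 * ((v1 b y)\<^sup>2 + v y * v2 b y) + 2 * C2 * M\<^sup>2" for b y
  have sq: "(norm (y + t *\<^sub>R b - x))\<^sup>2 = (norm (y - x))\<^sup>2 + 2 * t * ((y - x) \<bullet> b) + t\<^sup>2" if "b \<in> Basis" for y b t
  proof -
    have "y + t *\<^sub>R b - x = (y - x) + t *\<^sub>R b" by simp
    then show ?thesis
      unfolding power2_norm_eq_inner using that inner_commute[of b "y - x"]
      by (simp only: inner_add_left inner_add_right inner_scaleR_left inner_scaleR_right)
        (simp add: power2_eq_square distrib_left)
  qed
  have ip: "(y + t *\<^sub>R b - x) \<bullet> b = (y - x) \<bullet> b + t" if "b \<in> Basis" for y b t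
    using that by (simp add: inner_add_left inner_diff_left)
  obtain z where z: "norm (z - x) = \<rho>" "w x \<le> w z"
  proof (rule strict_subharmonic_max_on_sphere[OF \<rho>(1), of x w w1 w2])
    show "continuous_on (cball x \<rho>) w"
      unfolding w_def \<eta>_def by (intro continuous_intros cont)
  next
    fix y b assume y: "y \<in> ball x \<rho>" and b: "b \<in> (Basis :: 'a set)"
    note d = v1[OF y b] v2[OF y b] g1[OF y b] g2[OF y b]
    show "((\<lambda>t. w (y + t *\<^sub>R b)) has_real_derivative w1 b y) (at 0)"
      unfolding w_def \<eta>_def sq[OF b]
      by (rule derivative_eq_intros refl d)+ (simp add: w1_def \<eta>_def power2_eq_square algebra_simps)
    show "((\<lambda>t. w1 b (y + t *\<^sub>R b)) has_real_derivative w2 b y) (at 0)"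
      unfolding w1_def \<eta>_def sq[OF b] ip[OF b]
      by (rule derivative_eq_intros refl d)+ (simp add: w2_def \<eta>_def power2_eq_square algebra_simps)
  next
    fix y assume y: "y \<in> ball x \<rho>"
    have ny: "(norm (y - x))\<^sup>2 \<le> \<rho>\<^sup>2" using y by (intro power_mono) (auto simp: dist_norm norm_minus_commute)
    have eta: "0 \<le> \<eta> y" "\<eta> y \<le> \<rho>\<^sup>2" using ny by (auto simp: \<eta>_def)
    have eta2: "(\<eta> y)\<^sup>2 \<le> \<rho>\<^sup>2"
    proof -
      have "(\<eta> y)\<^sup>2 \<le> (\<rho>\<^sup>2)\<^sup>2" using eta by (intro power_mono) auto
      also have "\<dots> \<le> \<rho>\<^sup>2" using \<rho> by (simp add: power2_eq_square mult_le_one mult_left_le)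
      finally show ?thesis .
    qed
    \<comment> \<open>\<open>p b\<close> is \<open>w2 b y\<close> without the square 2 (\<eta> g1 -
      4 s g)^2, where s is the b-th coordinate of y - x. This removes the uncontrolled
      \<open>g1\<close>, and 8 - 32 = -24.\<close>
    define p where "p b = - 24 * ((y - x) \<bullet> b)\<^sup>2 * (g y)\<^sup>2 - 4 * \<eta> y * (g y)\<^sup>2 + 2 * (\<eta> y)\<^sup>2 * g y * g2 b y
        + 2 * C1 * (v1 b y)\<^sup>2 + 2 * C1 * v y * v2 b y + 2 * C2 * M\<^sup>2" for b
    have "p b \<le> w2 b y" for b
    proof -
      have "0 \<le> 2 * (\<eta> y * g1 b y - 4 * ((y - x) \<bullet> b) * g y)\<^sup>2" by simp
      then show ?thesis by (simp add: p_def w2_def power2_eq_square algebra_simps)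
    qed
    then have "(\<Sum>b\<in>Basis. p b) \<le> (\<Sum>b\<in>Basis. w2 b y)" by (intro sum_mono)
    moreover have "(\<Sum>b\<in>Basis. p b) = - 24 * (norm (y - x))\<^sup>2 * (g y)\<^sup>2 - 4 * DIM('a) * \<eta> y * (g y)\<^sup>2
        - 2 * \<mu> * (\<eta> y)\<^sup>2 * (g y)\<^sup>2 + 2 * C1 * (\<Sum>b\<in>Basis. (v1 b y)\<^sup>2) - 2 * C1 * \<mu> * (v y)\<^sup>2 + 2 * DIM('a) * C2 * M\<^sup>2"
    proof -
      have "(norm (y - x))\<^sup>2 = (\<Sum>b\<in>Basis. ((y - x) \<bullet> b)\<^sup>2)"
        unfolding power2_norm_eq_inner by (subst euclidean_inner) (simp add: power2_eq_square)
      moreover have "(\<Sum>b\<in>Basis. p b) = - 24 * (\<Sum>b\<in>Basis. ((y - x) \<bullet> b)\<^sup>2) * (g y)\<^sup>2 - 4 * DIM('a) * \<eta> y * (g y)\<^sup>2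
        + 2 * (\<eta> y)\<^sup>2 * g y * (\<Sum>b\<in>Basis. g2 b y) + 2 * C1 * (\<Sum>b\<in>Basis. (v1 b y)\<^sup>2) + 2 * C1 * v y * (\<Sum>b\<in>Basis. v2 b y) + 2 * DIM('a) * C2 * M\<^sup>2"
        unfolding p_def by (simp add: sum.distrib sum_subtractf sum_distrib_left sum_distrib_right sum_negf)
      ultimately show ?thesis by (simp add: eqv[OF y] eqg[OF y] power2_eq_square)
    qed
    moreover have "24 * (norm (y - x))\<^sup>2 * (g y)\<^sup>2 + 4 * DIM('a) * \<eta> y * (g y)\<^sup>2 + 2 * \<mu> * (\<eta> y)\<^sup>2 * (g y)\<^sup>2 \<le> 2 * C1 * (g y)\<^sup>2"
    proof -
      have "24 * (norm (y - x))\<^sup>2 + 4 * DIM('a) * \<eta> y + 2 * \<mu> * (\<eta> y)\<^sup>2 \<le> 24 * \<rho>\<^sup>2 + 4 * DIM('a) * \<rho>\<^sup>2 + 2 * \<mu> * \<rho>\<^sup>2"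
        using ny eta eta2 \<mu> by (intro add_mono mult_left_mono) auto
      also have "\<dots> = 2 * C1" by (simp add: C1_def c_def algebra_simps)
      finally have "(24 * (norm (y - x))\<^sup>2 + 4 * DIM('a) * \<eta> y + 2 * \<mu> * (\<eta> y)\<^sup>2) * (g y)\<^sup>2 \<le> 2 * C1 * (g y)\<^sup>2"
        by (rule mult_right_mono) simp
      then show ?thesis by (simp add: algebra_simps)
    qed
    moreover have "2 * C1 * (g y)\<^sup>2 \<le> 2 * C1 * (\<Sum>b\<in>Basis. (v1 b y)\<^sup>2)"
      using grad[OF y] C1 by (intro mult_left_mono) auto
    moreover have "2 * C1 * \<mu> * (v y)\<^sup>2 < 2 * DIM('a) * C2 * M\<^sup>2"
    proof -
      have "(v y)\<^sup>2 \<le> M\<^sup>2" using bound[of y] y M by (intro abs_le_square_iff[THEN iffD1]) auto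
      then have "2 * C1 * \<mu> * (v y)\<^sup>2 \<le> 2 * (C1 * \<mu>) * M\<^sup>2"
        using C1 \<mu> by (simp add: mult_left_mono)
      also have "\<dots> < 2 * C2 * M\<^sup>2" using \<rho> M by (simp add: C2_def)
      also have "\<dots> \<le> 2 * DIM('a) * C2 * M\<^sup>2"
      proof -
        have "1 \<le> real DIM('a)" using DIM_positive[where 'a = 'a] by linarith
        then show ?thesis using C2 by (intro mult_right_mono) auto
      qed
      finally show ?thesis .
    qed
    ultimately show "(\<Sum>b\<in>Basis. w2 b y) > 0" by linarith
  qed
  have "(v z)\<^sup>2 \<le> M\<^sup>2" using bound[of z] z(1) M by (intro abs_le_square_iff[THEN iffD1]) (auto simp: dist_norm norm_minus_commute)
  \<comment> \<open>On the sphere \<eta> vanishes, so the unknown \<open>g z\<close> drops out; at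
    the centre \<eta> is \<rho>^2, so \<open>w x\<close> controls \<rho>^4 (g x)^2.\<close>
  then have "w z \<le> C1 * M\<^sup>2 + C2 * M\<^sup>2 * \<rho>\<^sup>2"
    using C1 by (simp add: w_def \<eta>_def z(1))
  moreover have "(\<rho>\<^sup>2)\<^sup>2 * (g x)\<^sup>2 \<le> w x" using C1 by (simp add: w_def \<eta>_def)
  moreover have "C2 * M\<^sup>2 * \<rho>\<^sup>2 \<le> C2 * M\<^sup>2"
    using \<rho> C2 by (intro mult_right_le_one_le) (auto simp: power_le_one)
  ultimately have "(\<rho>\<^sup>2)\<^sup>2 * (g x)\<^sup>2 \<le> (C1 + C2) * M\<^sup>2" using z(2) by (simp add: algebra_simps)
  also have "(C1 + C2) * M\<^sup>2 = \<rho>\<^sup>2 * ((c * (1 + \<mu>) + 1) * M\<^sup>2)" by (simp add: C2_def C1_def algebra_simps)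
  finally have "\<rho>\<^sup>2 * (g x)\<^sup>2 \<le> (c * (1 + \<mu>) + 1) * M\<^sup>2"
    using \<rho>(1) by (simp add: power2_eq_square)
  then show ?thesis using \<rho>(1) by (simp add: c_def field_simps)
qed

text \<open>The radius \<open>r\<close> is cut into \<open>n\<close> layers of width r / n; each
  derivative spends one layer and costs a factor \<kappa> n / r, with \<kappa>^2 the constant of the
  gradient estimate. \<open>V k\<close> is meant to be the k-th derivative in one fixed unit
  direction, whence \<open>grad\<close>.\<close>

lemma Helmholtz_iterated_derivative_bound:
  fixes V :: "nat \<Rightarrow> 'a::euclidean_space \<Rightarrow> real" and \<mu> M \<kappa> r :: real
  assumes \<mu>: "\<mu> \<ge> 0" and M: "M > 0"
    and cont: "\<And>k. continuous_on U (V k)"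
    and V1: "\<And>k y b. y \<in> U \<Longrightarrow> b \<in> Basis \<Longrightarrow> ((\<lambda>t. V k (y + t *\<^sub>R b)) has_real_derivative V1 k b y) (at 0)"
    and V2: "\<And>k y b. y \<in> U \<Longrightarrow> b \<in> Basis \<Longrightarrow> ((\<lambda>t. V1 k b (y + t *\<^sub>R b)) has_real_derivative V2 k b y) (at 0)"
    and eqV: "\<And>k y. y \<in> U \<Longrightarrow> (\<Sum>b\<in>Basis. V2 k b y) = - \<mu> * V k y"
    and grad: "\<And>k y. y \<in> U \<Longrightarrow> (V (Suc k) y)\<^sup>2 \<le> (\<Sum>b\<in>Basis. (V1 k b y)\<^sup>2)"
    and bound: "\<And>y. y \<in> U \<Longrightarrow> \<bar>V 0 y\<bar> \<le> M"
    and \<kappa>: "\<kappa> = sqrt ((12 + 2 * DIM('a) + \<mu>) * (1 + \<mu>) + 1)"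
    and r: "0 < r" "r \<le> 1" "cball y r \<subseteq> U"
  shows "\<bar>V n y\<bar> \<le> M * (\<kappa> * n / r) ^ n"
proof (cases "n = 0")
  case True
  have "y \<in> U" using r(1,3) by (meson centre_in_cball less_imp_le subsetD)
  then show ?thesis using bound[of y] True by simp
next
  case False
  define \<rho> where "\<rho> = r / n"
  have \<rho>: "0 < \<rho>" "\<rho> \<le> 1" using r False by (auto simp: \<rho>_def field_simps)
  have \<kappa>0: "\<kappa> > 0" unfolding \<kappa> using \<mu> by (simp add: add_pos_nonneg add_nonneg_pos)
  \<comment> \<open>The centre is generalised because the bound for \<open>V j\<close> is needed on
    the whole ball of radius \<rho> about \<open>y\<close>, each of whose points still has
    \<open>j\<close> layers around it.\<close>
  have "cball y (j * \<rho>) \<subseteq> U \<longrightarrow> \<bar>V j y\<bar> \<le> M * (\<kappa> / \<rho>) ^ j" for j y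
  proof (induction j arbitrary: y)
    case 0
    then show ?case using bound[of y] by auto
  next
    case (Suc j)
    show ?case
    proof
      assume sub: "cball y (Suc j * \<rho>) \<subseteq> U"
      define M' where "M' = M * (\<kappa> / \<rho>) ^ j"
      have M': "M' > 0" using M \<kappa>0 \<rho> by (simp add: M'_def)
      have sub': "cball y \<rho> \<subseteq> U"
        using sub \<rho> by (force simp: field_simps intro: order_trans)
      then have inU: "z \<in> U" if "z \<in> ball y \<rho>" for z using that by force
      have bd: "\<bar>V j z\<bar> \<le> M'" if "z \<in> cball y \<rho>" for z
      proof -
        have "cball z (j * \<rho>) \<subseteq> cball y (Suc j * \<rho>)"
          using that by (auto simp: algebra_simps subset_eq) (metis add_mono dist_triangle order_trans)
        then show ?thesis using Suc.IH[of z] sub by (auto simp: M'_def)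
      qed
      have "(V (Suc j) y)\<^sup>2 \<le> ((12 + 2 * DIM('a) + \<mu>) * (1 + \<mu>) + 1) * M'\<^sup>2 / \<rho>\<^sup>2"
        by (rule Helmholtz_derivative_bound[OF \<rho> \<mu> M' _ _ V1[OF inU, of _ _ j] V2[OF inU, of _ _ j]
              V1[OF inU, of _ _ "Suc j"] V2[OF inU, of _ _ "Suc j"] eqV[OF inU] eqV[OF inU] grad[OF inU] bd])
          (auto intro: continuous_on_subset[OF cont sub'])
      also have "\<dots> = (\<kappa> * M' / \<rho>)\<^sup>2"
        unfolding \<kappa> using \<mu> by (simp add: power_mult_distrib power_divide)
      finally have "\<bar>V (Suc j) y\<bar> \<le> \<kappa> * M' / \<rho>"
        using \<kappa>0 M' \<rho> by (subst (asm) abs_le_square_iff[symmetric]) auto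
      then show "\<bar>V (Suc j) y\<bar> \<le> M * (\<kappa> / \<rho>) ^ Suc j" by (simp add: M'_def field_simps)
    qed
  qed
  from this[of y n] show ?thesis using r False by (simp add: \<rho>_def)
qed

section \<open>Vanishing Taylor series\<close>

text \<open>One term of the series of exp n is at most the whole sum, and e <= 3.\<close>

lemma power_self_le_fact: "real n ^ n \<le> 3 ^ n * fact n"
proof -
  have "real n ^ n / fact n \<le> (\<Sum>k. real n ^ k / fact k)"
    using sum_le_suminf[of "\<lambda>k. real n ^ k / fact k" "{n}"] summable_exp[of "real n"]
    by (simp add: field_simps)
  also have "\<dots> = exp (real n)" by (simp add: exp_def field_simps scaleR_conv_of_real)
  also have "\<dots> = exp 1 ^ n" by (simp add: exp_of_nat_mult[symmetric])
  also have "\<dots> \<le> 3 ^ n" by (intro power_mono exp_le) simp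
  finally show ?thesis by (simp add: field_simps)
qed

text \<open>Since n^n <= 3^n n!, the Lagrange remainder of order n is at most M (3 q |s|)^n, which
  tends to 0.\<close>

lemma Taylor_vanishing:
  fixes D :: "nat \<Rightarrow> real \<Rightarrow> real" and s M q :: real
  assumes D: "\<And>k t. t \<in> closed_segment 0 s \<Longrightarrow> (D k has_real_derivative D (Suc k) t) (at t)"
    and D0: "\<And>k. D k 0 = 0"
    and b: "\<And>k t. t \<in> closed_segment 0 s \<Longrightarrow> \<bar>D k t\<bar> \<le> M * (q * k) ^ k"
    and q: "q \<ge> 0" "3 * q * \<bar>s\<bar> < 1"
  shows "D 0 s = 0"
proof (cases "s = 0")
  case False
  have M: "M \<ge> 0" using b[of 0 0] by auto
  have bnd: "\<bar>D 0 s\<bar> \<le> M * (3 * q * \<bar>s\<bar>) ^ n" if n: "n > 0" for n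
  proof -
    obtain t where t: "t \<in> closed_segment 0 s"
      "D 0 s = (\<Sum>m<n. D m 0 / fact m * (s - 0) ^ m) + D n t / fact n * (s - 0) ^ n"
    proof -
      have "\<exists>t. (if s < 0 then s < t \<and> t < 0 else 0 < t \<and> t < s) \<and>
          D 0 s = (\<Sum>m<n. D m 0 / fact m * (s - 0) ^ m) + D n t / fact n * (s - 0) ^ n"
        by (rule Taylor[of n D "D 0" "min 0 s" "max 0 s" 0 s])
          (use n False D in \<open>auto simp: closed_segment_eq_real_ivl min_def max_def split: if_splits\<close>)
      then obtain t where t: "if s < 0 then s < t \<and> t < 0 else 0 < t \<and> t < s"
          "D 0 s = (\<Sum>m<n. D m 0 / fact m * (s - 0) ^ m) + D n t / fact n * (s - 0) ^ n"
        by blast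
      show ?thesis
        by (rule that[of t, OF _ t(2)]) (use t(1) in \<open>auto simp: closed_segment_eq_real_ivl split: if_splits\<close>)
    qed
    then have "\<bar>D 0 s\<bar> = \<bar>D n t\<bar> / fact n * \<bar>s\<bar> ^ n" by (simp add: D0 abs_mult power_abs)
    also have "\<dots> \<le> (M * (q * n) ^ n) / fact n * \<bar>s\<bar> ^ n"
      using b[OF t(1), of n] by (intro mult_right_mono divide_right_mono) auto
    also have "\<dots> = (M * q ^ n * \<bar>s\<bar> ^ n) * (real n ^ n / fact n)" by (simp add: power_mult_distrib)
    also have "\<dots> \<le> (M * q ^ n * \<bar>s\<bar> ^ n) * 3 ^ n"
      using power_self_le_fact[of n] M q(1) by (intro mult_left_mono) (auto simp: field_simps)
    finally show ?thesis by (simp add: power_mult_distrib algebra_simps)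
  qed
  have "(\<lambda>n. M * (3 * q * \<bar>s\<bar>) ^ n) \<longlonglongrightarrow> M * 0"
    using q by (intro tendsto_intros LIMSEQ_realpow_zero) auto
  then have "\<bar>D 0 s\<bar> \<le> M * 0"
    by (rule LIMSEQ_le_const) (use bnd in \<open>auto intro!: exI[of _ 1]\<close>)
  then show ?thesis by simp
qed (use D0 in simp)


section \<open>Unique continuation\<close>

text \<open>As long as \<open>ball h \<delta>\<close> lies in \<Omega>, the translate is an
  admissible test function. This is the Helmholtz equation for the pairing as a function of
  \<open>h\<close>.\<close>

lemma pairing_laplacian_translate:
  assumes f: "integrable (lebesgue_on \<Omega>) f" "\<Omega> \<in> sets lebesgue"
    and eig: "laplacian_eigen_eq \<Omega> f (- \<mu>)" and \<psi>: "\<psi> \<in> test_functions (ball 0 \<delta>)" and h: "ball h \<delta> \<subseteq> \<Omega>"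
  shows "(\<Sum>b\<in>Basis. pairing \<Omega> f (\<lambda>x. partial_deriv b (partial_deriv b \<psi>) (x - h)))
    = - of_real \<mu> * pairing \<Omega> f (\<lambda>x. \<psi> (x - h))"
proof -
  have "(\<lambda>x. \<psi> (x - h)) \<in> test_functions (ball h \<delta>)"
    using test_translate[OF \<psi>, of h] by simp
  then have t: "(\<lambda>x. \<psi> (x - h)) \<in> test_functions \<Omega>" using test_functions_mono[OF h] by blast
  have "(\<Sum>b\<in>Basis. pairing \<Omega> f (\<lambda>x. partial_deriv b (partial_deriv b \<psi>) (x - h)))
      = pairing \<Omega> f (\<lambda>x. \<Sum>b\<in>Basis. partial_deriv b (partial_deriv b \<psi>) (x - h))"
    by (rule pairing_sum_right[symmetric, OF f])
      (auto intro: test_translate_UNIV test_partial_deriv \<psi>)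
  also have "\<dots> = pairing \<Omega> f (laplacian (\<lambda>x. \<psi> (x - h)))"
    by (simp add: laplacian_translate[OF \<psi>, abs_def] laplacian_def[symmetric])
  also have "\<dots> = - of_real \<mu> * pairing \<Omega> f (\<lambda>x. \<psi> (x - h))"
    using eig t by (simp add: laplacian_eigen_eq_def)
  finally show ?thesis .
qed

lemma pairing_partial_deriv_sum:
  assumes f: "integrable (lebesgue_on \<Omega>) f" "\<Omega> \<in> sets lebesgue" and \<psi>: "\<psi> \<in> test_functions W"
  shows "pairing \<Omega> f (\<lambda>x. partial_deriv e \<psi> (x - h))
    = (\<Sum>b\<in>Basis. of_real (e \<bullet> b) * pairing \<Omega> f (\<lambda>x. partial_deriv b \<psi> (x - h)))"
proof -
  have "pairing \<Omega> f (\<lambda>x. partial_deriv e \<psi> (x - h))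
      = pairing \<Omega> f (\<lambda>x. \<Sum>b\<in>Basis. of_real (e \<bullet> b) * partial_deriv b \<psi> (x - h))"
    by (simp add: partial_deriv_sum_Basis[OF test_differentiable[OF \<psi>], of e] scaleR_conv_of_real)
  also have "\<dots> = (\<Sum>b\<in>Basis. pairing \<Omega> f (\<lambda>x. of_real (e \<bullet> b) * partial_deriv b \<psi> (x - h)))"
  proof (rule pairing_sum_right[OF f])
    fix b :: 'a
    show "(\<lambda>x. of_real (e \<bullet> b) * partial_deriv b \<psi> (x - h)) \<in> test_functions UNIV"
      by (rule test_bounded_linear[OF bounded_linear_mult_right])
        (rule test_translate_UNIV[OF test_partial_deriv[OF \<psi>]])
  qed simp
  also have "\<dots> = (\<Sum>b\<in>Basis. of_real (e \<bullet> b) * pairing \<Omega> f (\<lambda>x. partial_deriv b \<psi> (x - h)))"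
    by (simp add: pairing_def mult.left_commute[of "f _"])
  finally show ?thesis .
qed

text \<open>As a function of \<open>h\<close>, the pairing vanishes near \<open>y\<close> together
  with all its derivatives, and on the segment to \<open>z\<close> these derivatives obey the
  analytic bound with ratio \<kappa> / r, so its Taylor series gives 0 at \<open>z\<close>. The
  reach r / (3 \<kappa>) involves neither \<delta> nor \<open>s\<close>, which lets the step be
  repeated with ever smaller supports. The radius 3 r leaves a ball of radius r about every point of
  the segment.\<close>

lemma translated_pairing_zero_spreads:
  fixes f :: "'a::euclidean_space \<Rightarrow> complex" and \<mu> r s \<delta> \<kappa> :: real
  assumes f: "integrable (lebesgue_on \<Omega>) f" "\<Omega> \<in> sets lebesgue"
    and \<mu>: "\<mu> \<ge> 0" and eig: "laplacian_eigen_eq \<Omega> f (- \<mu>)"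
    and \<phi>: "\<phi> \<in> test_functions (ball 0 \<delta>)" and r: "0 < r" "r \<le> 1" and sub: "ball x (3 * r + \<delta>) \<subseteq> \<Omega>"
    and \<kappa>: "\<kappa> = sqrt ((12 + 2 * DIM('a) + \<mu>) * (1 + \<mu>) + 1)"
    and yz: "y \<in> ball x r" "z \<in> ball x r" "3 * \<kappa> * norm (z - y) < r"
    and zero: "s > 0" "\<And>h. h \<in> ball y s \<Longrightarrow> pairing \<Omega> f (\<lambda>x. \<phi> (x - h)) = 0"
  shows "pairing \<Omega> f (\<lambda>x. \<phi> (x - z)) = 0"
proof (cases "z = y")
  case True
  then show ?thesis using zero by simp
next
  case False
  define d where "d = norm (z - y)"
  define e where "e = (z - y) /\<^sub>R d"
  have d: "d > 0" and e: "norm e = 1" "y + d *\<^sub>R e = z" using False by (auto simp: d_def e_def)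
  define F where "F \<psi> h = pairing \<Omega> f (\<lambda>x. \<psi> (x - h))" for \<psi> :: "'a \<Rightarrow> complex" and h
  define \<Phi> where "\<Phi> k = (partial_deriv e ^^ k) \<phi>" for k
  have \<Phi>: "\<Phi> k \<in> test_functions (ball 0 \<delta>)" for k
    by (induction k) (auto simp: \<Phi>_def \<phi> intro: test_partial_deriv)
  have \<Phi>Suc: "\<Phi> (Suc k) = partial_deriv e (\<Phi> k)" for k by (simp add: \<Phi>_def)
  have dF: "((\<lambda>t. F \<psi> (h + t *\<^sub>R v)) has_vector_derivative - F (partial_deriv v \<psi>) (h + t *\<^sub>R v)) (at t)"
    if "\<psi> \<in> test_functions (ball 0 \<delta>)" for \<psi> h v t
    unfolding F_def by (rule pairing_translate_deriv[OF f that])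
  have zeroF: "F (\<Phi> k) h = 0" if "h \<in> ball y s" for k h
    using that
  proof (induction k arbitrary: h)
    case 0
    then show ?case using zero(2) by (simp add: F_def \<Phi>_def)
  next
    case (Suc k)
    obtain \<epsilon> where \<epsilon>: "\<epsilon> > 0" "ball h \<epsilon> \<subseteq> ball y s" using Suc.prems open_contains_ball open_ball by blast
    have "((\<lambda>t. F (\<Phi> k) (h + t *\<^sub>R e)) has_vector_derivative 0) (at 0)"
    proof (rule has_vector_derivative_transform_within_open[of "\<lambda>_. 0" 0 0 "ball 0 \<epsilon>"])
      show "0 = F (\<Phi> k) (h + t *\<^sub>R e)" if "t \<in> ball 0 \<epsilon>" for t
      proof -
        have "h + t *\<^sub>R e \<in> ball h \<epsilon>" using that e(1) by (simp add: dist_norm)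
        then show ?thesis using Suc.IH \<epsilon>(2) by force
      qed
    qed (use \<epsilon> in auto)
    from vector_derivative_unique_at[OF this dF[OF \<Phi>, of k h e 0]]
    show ?case by (simp add: \<Phi>Suc)
  qed
  obtain C where C: "C > 0" "\<And>x. cmod (\<phi> x) \<le> C" using test_bounded[OF \<phi>] by metis
  \<comment> \<open>The added 1 gives the strict positivity that the gradient estimate asks
    for.\<close>
  define M where "M = C * (LINT x|lebesgue_on \<Omega>. cmod (f x)) + 1"
  have M: "M > 0" using C by (simp add: M_def add_nonneg_pos)
  have bF: "cmod (F \<phi> h) \<le> M" for h
    using integrable_mult_bounded_continuous(2)[OF f test_continuous[OF test_translate_UNIV[OF \<phi>]], of h C] C(2)
    by (fastforce simp: F_def M_def)
  \<comment> \<open>The maximum principle concerns real functions; the factors 1 and -\<i> recover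
    the real and the imaginary part.\<close>
  have Re0: "Re (c * F \<phi> z) = 0" if c: "cmod c = 1" for c
  proof -
    \<comment> \<open>Each derivative in \<open>h\<close> produces a minus sign;
      \<open>(-1) ^ k\<close> absorbs it, so that \<open>V (Suc k)\<close> is the derivative of
      \<open>V k\<close> along \<open>e\<close>.\<close>
    define V where "V k h = Re (c * (-1) ^ k * F (\<Phi> k) h)" for k h
    define V1 where "V1 k b h = Re (c * (-1) ^ k * - F (partial_deriv b (\<Phi> k)) h)" for k b h
    define V2 where "V2 k b h = Re (c * (-1) ^ k * F (partial_deriv b (partial_deriv b (\<Phi> k))) h)" for k b h
    have Re_of_real_mult: "Re (of_real a * w) = a * Re w" for a w by simp
    have bl: "bounded_linear (\<lambda>w. Re (a * w))" for a
      by (intro bounded_linear_compose[OF bounded_linear_Re bounded_linear_mult_right])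
    have dV: "((\<lambda>t. Re (a * F \<psi> (h + t *\<^sub>R v))) has_real_derivative Re (a * - F (partial_deriv v \<psi>) (h + t *\<^sub>R v))) (at t)"
      if "\<psi> \<in> test_functions (ball 0 \<delta>)" for \<psi> a h v t
      unfolding has_real_derivative_iff_has_vector_derivative
      by (rule bounded_linear.has_vector_derivative[OF bl dF[OF that]])
    have bnd: "\<bar>V n h\<bar> \<le> M * (\<kappa> * n / r) ^ n" if "cball h r \<subseteq> ball x (3 * r)" for n h
    proof (rule Helmholtz_iterated_derivative_bound[where V = V and ?V1.0 = V1 and ?V2.0 = V2 and U = "ball x (3 * r)", OF \<mu> M _ _ _ _ _ _ \<kappa> r that])
      show "continuous_on (ball x (3 * r)) (V k)" for k
      proof -
        obtain L where L: "L \<ge> 0" "\<And>h k'. cmod (F (\<Phi> k) h - F (\<Phi> k) k') \<le> L * norm (h - k')"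
          unfolding F_def using pairing_translate_Lipschitz[OF f \<Phi>[of k]] by metis
        have "continuous_on UNIV (F (\<Phi> k))"
          by (rule lipschitz_on_continuous_on[of L], rule lipschitz_onI) (use L in \<open>auto simp: dist_norm\<close>)
        then show ?thesis unfolding V_def
          by (intro continuous_intros) (auto intro: continuous_on_subset)
      qed
      show "((\<lambda>t. V k (h + t *\<^sub>R b)) has_real_derivative V1 k b h) (at 0)" for k h b
        unfolding V_def V1_def using dV[OF \<Phi>, of "c * (-1) ^ k" k h b 0] by simp
      show "((\<lambda>t. V1 k b (h + t *\<^sub>R b)) has_real_derivative V2 k b h) (at 0)" for k h b
        unfolding V1_def V2_def using dV[OF test_partial_deriv[OF \<Phi>], of "- (c * (-1) ^ k)" b k h b 0] by simp
      show "(\<Sum>b\<in>Basis. V2 k b h) = - \<mu> * V k h" if "h \<in> ball x (3 * r)" for k h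
      proof -
        have "ball h \<delta> \<subseteq> ball x (3 * r + \<delta>)"
          using that by (auto intro!: order_le_less_trans[OF dist_triangle[of x _ h] add_strict_mono])
        with sub have "ball h \<delta> \<subseteq> \<Omega>" by blast
        then have "(\<Sum>b\<in>Basis. F (partial_deriv b (partial_deriv b (\<Phi> k))) h) = - of_real \<mu> * F (\<Phi> k) h"
          unfolding F_def by (rule pairing_laplacian_translate[OF f eig \<Phi>])
        then have "Re (c * (-1) ^ k * (\<Sum>b\<in>Basis. F (partial_deriv b (partial_deriv b (\<Phi> k))) h))
            = Re (c * (-1) ^ k * (- of_real \<mu> * F (\<Phi> k) h))" by simp
        also have "c * (-1) ^ k * (- of_real \<mu> * F (\<Phi> k) h) = of_real (- \<mu>) * (c * (-1) ^ k * F (\<Phi> k) h)"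
          by (simp only: of_real_minus mult.assoc mult.left_commute)
        also have "Re \<dots> = - \<mu> * V k h" unfolding V_def by (rule Re_of_real_mult)
        also have "Re (c * (-1) ^ k * (\<Sum>b\<in>Basis. F (partial_deriv b (partial_deriv b (\<Phi> k))) h)) = (\<Sum>b\<in>Basis. V2 k b h)"
          by (simp only: V2_def sum_distrib_left Re_sum)
        finally show ?thesis .
      qed
      show "(V (Suc k) h)\<^sup>2 \<le> (\<Sum>b\<in>Basis. (V1 k b h)\<^sup>2)" for k h
      proof -
        have "V (Suc k) h = (\<Sum>b\<in>Basis. Re (c * (-1) ^ Suc k * (of_real (e \<bullet> b) * F (partial_deriv b (\<Phi> k)) h)))"
          unfolding V_def \<Phi>Suc F_def pairing_partial_deriv_sum[OF f \<Phi>, of e]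
          by (simp only: sum_distrib_left Re_sum)
        also have "\<dots> = (\<Sum>b\<in>Basis. (e \<bullet> b) * V1 k b h)"
        proof (rule sum.cong[OF refl])
          fix b :: 'a
          have "c * (-1) ^ Suc k * (of_real (e \<bullet> b) * F (partial_deriv b (\<Phi> k)) h)
              = of_real (e \<bullet> b) * (c * (-1) ^ k * - F (partial_deriv b (\<Phi> k)) h)" by simp
          then show "Re (c * (-1) ^ Suc k * (of_real (e \<bullet> b) * F (partial_deriv b (\<Phi> k)) h)) = (e \<bullet> b) * V1 k b h"
            by (simp only: V1_def Re_of_real_mult)
        qed
        finally have "(V (Suc k) h)\<^sup>2 \<le> (\<Sum>b\<in>Basis. (e \<bullet> b)\<^sup>2) * (\<Sum>b\<in>Basis. (V1 k b h)\<^sup>2)"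
          by (simp only: Cauchy_Schwarz_ineq_sum)
        also have "(\<Sum>b\<in>Basis. (e \<bullet> b)\<^sup>2) = 1"
          using e(1) euclidean_inner[of e e] by (simp add: power2_eq_square norm_eq_1)
        finally show ?thesis by simp
      qed
      show "\<bar>V 0 h\<bar> \<le> M" for h
        using order_trans[OF abs_Re_le_cmod, of "c * F \<phi> h" M] bF[of h] c by (simp add: V_def \<Phi>_def norm_mult)
    qed
    have \<kappa>0: "\<kappa> \<ge> 0" unfolding \<kappa> using \<mu> by (simp add: add_nonneg_nonneg)
    have "V 0 (y + d *\<^sub>R e) = 0"
    proof (rule Taylor_vanishing[where D = "\<lambda>k t. V k (y + t *\<^sub>R e)" and q = "\<kappa> / r" and M = M])
      fix k t assume t: "t \<in> closed_segment 0 d"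
      then have t': "0 \<le> t" "t \<le> d" using d by (auto simp: closed_segment_eq_real_ivl)
      have "y + t *\<^sub>R e = (1 - t / d) *\<^sub>R y + (t / d) *\<^sub>R z"
        using d by (simp add: e(2)[symmetric] algebra_simps)
      then have "y + t *\<^sub>R e \<in> ball x r"
        using convexD[OF convex_ball yz(1,2), of "1 - t / d" "t / d"] t' d by (simp add: field_simps)
      then have "cball (y + t *\<^sub>R e) r \<subseteq> ball x (3 * r)"
        using r by (auto simp: subset_eq) (smt (verit) dist_triangle)
      from bnd[OF this, of k] show "\<bar>V k (y + t *\<^sub>R e)\<bar> \<le> M * (\<kappa> / r * real k) ^ k" by simp
      show "((\<lambda>t. V k (y + t *\<^sub>R e)) has_real_derivative V (Suc k) (y + t *\<^sub>R e)) (at t)"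
        unfolding V_def \<Phi>Suc using dV[OF \<Phi>, of "c * (-1) ^ k" k y e t] by simp
    next
      show "V k (y + 0 *\<^sub>R e) = 0" for k using zeroF[of y k] zero(1) by (simp add: V_def)
      show "3 * (\<kappa> / r) * \<bar>d\<bar> < 1" using yz(3) r d by (simp add: d_def field_simps)
      show "0 \<le> \<kappa> / r" using \<kappa>0 r by simp
    qed
    then show ?thesis by (simp add: V_def \<Phi>_def e(2))
  qed
  have "Re (F \<phi> z) = 0" "Im (F \<phi> z) = 0" using Re0[of 1] Re0[of "- \<i>"] by auto
  then show ?thesis by (simp add: F_def complex_eq_iff)
qed

text \<open>Only the translates by \<open>h\<close> near \<open>x\<close> of test functions with small support are compared, so
  that the radius of vanishing may shrink along the way.\<close>

lemma locally_zero_unique_continuation: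
  fixes f :: "'a::euclidean_space \<Rightarrow> complex"
  assumes \<Omega>: "open \<Omega>" "connected \<Omega>" and f: "integrable (lebesgue_on \<Omega>) f"
    and \<mu>: "\<mu> \<ge> 0" and eig: "laplacian_eigen_eq \<Omega> f (- \<mu>)"
    and \<omega>: "open \<omega>" "\<omega> \<noteq> {}" "\<omega> \<subseteq> \<Omega>" and zero: "\<And>\<phi>. \<phi> \<in> test_functions \<omega> \<Longrightarrow> pairing \<Omega> f \<phi> = 0"
    and x: "x \<in> \<Omega>"
  shows "\<exists>\<rho>>0. \<forall>\<phi>\<in>test_functions (ball x \<rho>). pairing \<Omega> f \<phi> = 0"
proof -
  have m: "\<Omega> \<in> sets lebesgue" using \<Omega>(1) by (intro sets_completionI_sets) auto
  define A where "A = {x\<in>\<Omega>. \<exists>\<rho>>0. \<forall>\<phi>\<in>test_functions (ball x \<rho>). pairing \<Omega> f \<phi> = 0}"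
  define \<kappa> where "\<kappa> = sqrt ((12 + 2 * DIM('a) + \<mu>) * (1 + \<mu>) + 1)"
  have \<kappa>0: "\<kappa> > 0" unfolding \<kappa>_def using \<mu> by (simp add: add_pos_nonneg add_nonneg_pos)
  \<comment> \<open>Relative closedness of \<open>A\<close>. Here \<open>d\<close> is chosen before
    the point of \<open>A\<close>, so it must not depend on the radius of vanishing there.\<close>
  have closedA: "\<exists>d>0. ball x d \<inter> A \<noteq> {} \<longrightarrow> x \<in> A" if x: "x \<in> \<Omega>" for x
  proof -
    obtain R where R: "R > 0" "ball x R \<subseteq> \<Omega>" using \<Omega>(1) x open_contains_ball by blast
    define r where "r = min (R / 4) 1"
    have r: "0 < r" "r \<le> 1" "4 * r \<le> R" using R(1) by (auto simp: r_def)
    define d where "d = min r (r / (3 * \<kappa>))"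
    have d: "d > 0" using r \<kappa>0 by (simp add: d_def)
    have "x \<in> A" if "y \<in> ball x d" "y \<in> A" for y
    proof -
      obtain \<rho> where \<rho>: "\<rho> > 0" "\<And>\<phi>. \<phi> \<in> test_functions (ball y \<rho>) \<Longrightarrow> pairing \<Omega> f \<phi> = 0"
        using \<open>y \<in> A\<close> by (auto simp: A_def)
      \<comment> \<open>Half of \<rho> is for the support and half for the translation:
        \<open>ball h \<delta>\<close> stays in \<open>ball y \<rho>\<close> for every
        \<open>h\<close> in \<open>ball y (\<rho> / 2)\<close>. The bound by \<open>r\<close> keeps
        the ball of radius 3 r + \<delta> about \<open>x\<close> inside \<Omega>.\<close>
      define \<delta> where "\<delta> = min r (\<rho> / 2)"
      have \<delta>: "\<delta> > 0" "\<delta> \<le> r" "\<delta> \<le> \<rho> / 2" using r \<rho>(1) by (auto simp: \<delta>_def)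
      have "pairing \<Omega> f \<phi> = 0" if \<phi>: "\<phi> \<in> test_functions (ball x \<delta>)" for \<phi>
      proof -
        define \<psi> where "\<psi> z = \<phi> (z - - x)" for z
        have \<psi>: "\<psi> \<in> test_functions (ball 0 \<delta>)"
          using test_translate[OF \<phi>, of "- x"] unfolding \<psi>_def[abs_def] ball_translation[symmetric] by simp
        have "pairing \<Omega> f (\<lambda>z. \<psi> (z - x)) = 0"
        proof (rule translated_pairing_zero_spreads[OF f m \<mu> eig \<psi> r(1,2) _ \<kappa>_def, where y = y and s = "\<rho> / 2"])
          show "ball x (3 * r + \<delta>) \<subseteq> \<Omega>" using R(2) r \<delta> by (force intro: order_less_le_trans)
          show "y \<in> ball x r" "x \<in> ball x r" using that(1) r \<open>y \<in> ball x d\<close> by (auto simp: d_def)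
          have "norm (x - y) < r / (3 * \<kappa>)" using \<open>y \<in> ball x d\<close> by (simp add: d_def dist_norm)
          then show "3 * \<kappa> * norm (x - y) < r" using \<kappa>0 by (simp add: field_simps)
          show "\<rho> / 2 > 0" using \<rho>(1) by simp
          show "pairing \<Omega> f (\<lambda>z. \<psi> (z - h)) = 0" if "h \<in> ball y (\<rho> / 2)" for h
          proof (rule \<rho>(2))
            have "(\<lambda>z. \<psi> (z - h)) \<in> test_functions (ball h \<delta>)" using test_translate[OF \<psi>, of h] by simp
            moreover have "ball h \<delta> \<subseteq> ball y \<rho>" using that \<delta>(3)
              by (auto simp: subset_eq) (smt (verit) dist_triangle field_sum_of_halves)
            ultimately show "(\<lambda>z. \<psi> (z - h)) \<in> test_functions (ball y \<rho>)" by (rule test_functions_mono[rotated])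
          qed
        qed
        then show ?thesis by (simp add: \<psi>_def)
      qed
      then show ?thesis using \<delta>(1) x by (auto simp: A_def)
    qed
    then show ?thesis using d by blast
  qed
  have openA: "\<exists>d>0. ball x d \<subseteq> A" if xA: "x \<in> A" for x
  proof -
    obtain \<rho> where \<rho>: "\<rho> > 0" "\<And>\<phi>. \<phi> \<in> test_functions (ball x \<rho>) \<Longrightarrow> pairing \<Omega> f \<phi> = 0"
      using xA by (auto simp: A_def)
    obtain R where R: "R > 0" "ball x R \<subseteq> \<Omega>" using \<Omega>(1) xA open_contains_ball unfolding A_def by blast
    have "y \<in> A" if y: "y \<in> ball x (min \<rho> R)" for y
    proof -
      obtain s where s: "s > 0" "ball y s \<subseteq> ball x \<rho>"
        using y openE[OF open_ball, of y x \<rho>] by auto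
      have "\<forall>\<phi>\<in>test_functions (ball y s). pairing \<Omega> f \<phi> = 0" using test_functions_mono[OF s(2)] \<rho>(2) by blast
      moreover have "y \<in> \<Omega>" using y R(2) by auto
      ultimately show ?thesis using s(1) by (auto simp: A_def)
    qed
    then show ?thesis using \<rho>(1) R(1) by (intro exI[of _ "min \<rho> R"]) auto
  qed
  have "open A" unfolding open_contains_ball using openA by blast
  moreover have "open (\<Omega> - A)"
    unfolding open_contains_ball
  proof
    fix x assume x: "x \<in> \<Omega> - A"
    then obtain d where d: "d > 0" "ball x d \<inter> A = {}" using closedA[of x] by blast
    obtain R where R: "R > 0" "ball x R \<subseteq> \<Omega>" using \<Omega>(1) x open_contains_ball by blast
    show "\<exists>e>0. ball x e \<subseteq> \<Omega> - A"
      by (rule exI[of _ "min d R"]) (use d R in auto)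
  qed
  moreover have "A \<inter> \<Omega> \<noteq> {}"
  proof -
    obtain w where w: "w \<in> \<omega>" using \<omega> by blast
    then obtain \<rho> where "\<rho> > 0" "ball w \<rho> \<subseteq> \<omega>" using \<omega>(1) open_contains_ball by blast
    then have "w \<in> A" using w \<omega>(3) zero test_functions_mono unfolding A_def by blast
    then show ?thesis by (auto simp: A_def)
  qed
  ultimately have "(\<Omega> - A) \<inter> \<Omega> = {}"
    using connectedD[OF \<Omega>(2), of A "\<Omega> - A"] by blast
  then show ?thesis using x by (auto simp: A_def)
qed


section \<open>From local to global vanishing\<close>

text \<open>For \<open>n = 0\<close> this is the standard flat function; the others occur in its derivatives.\<close>

definition flat_fun :: "nat \<Rightarrow> real \<Rightarrow> real" where
  "flat_fun n t = (if t > 0 then exp (- inverse t) * inverse t ^ n else 0)"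

text \<open>The term of order n + 2 in the series of exp (1 / t) beats t^(-n) and leaves t^2 over,
  the quadratic error that gives derivative 0 at the origin.\<close>

lemma flat_fun_le:
  assumes t: "t > 0"
  shows "flat_fun n t \<le> fact (n + 2) * t\<^sup>2"
proof -
  define F :: real where "F = fact (n + 2)"
  have F: "F > 0" by (simp add: F_def)
  have "inverse t ^ (n + 2) / F \<le> (\<Sum>k. inverse t ^ k / fact k)"
    using sum_le_suminf[of "\<lambda>k. inverse t ^ k / fact k" "{n + 2}"] summable_exp[of "inverse t"] t
    by (simp add: divide_inverse mult.commute F_def del: fact_Suc)
  also have "\<dots> = exp (inverse t)" by (simp add: exp_def divide_inverse mult.commute)
  finally have "inverse t ^ n * (inverse t)\<^sup>2 \<le> exp (inverse t) * F"
    using F by (simp add: power_add power2_eq_square pos_divide_le_eq mult.commute mult.left_commute)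
  then have "inverse t ^ n * exp (- inverse t) \<le> F * t\<^sup>2"
    using t by (simp add: exp_minus field_simps)
  then show ?thesis using t by (simp add: flat_fun_def mult.commute F_def del: fact_Suc)
qed

text \<open>The linear span of the family is closed under differentiation, so smoothness of all
  members follows by one induction on the order.\<close>

lemma flat_fun_deriv:
  "(flat_fun n has_real_derivative (flat_fun (n + 2) t - n * flat_fun (n + 1) t)) (at t)"
proof -
  consider "t > 0" | "t < 0" | "t = 0" by linarith
  then show ?thesis
  proof cases
    case 1
    have "((\<lambda>t. exp (- inverse t) * inverse t ^ n) has_real_derivative (flat_fun (n + 2) t - n * flat_fun (n + 1) t)) (at t)"
    proof -
      have "((\<lambda>t. exp (- inverse t) * inverse t ^ n) has_real_derivative
          (exp (- inverse t) * (inverse t)\<^sup>2 * inverse t ^ n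
           - exp (- inverse t) * (n * inverse t ^ (n - 1) * (inverse t)\<^sup>2))) (at t)"
        using 1 by (auto intro!: derivative_eq_intros simp: power2_eq_square)
      moreover have "exp (- inverse t) * (inverse t)\<^sup>2 * inverse t ^ n
           - exp (- inverse t) * (n * inverse t ^ (n - 1) * (inverse t)\<^sup>2) = flat_fun (n + 2) t - n * flat_fun (n + 1) t"
        using 1 by (cases n) (simp_all add: flat_fun_def power2_eq_square)
      ultimately show ?thesis by simp
    qed
    then show ?thesis
      by (rule has_field_derivative_transform_within_open[of _ _ _ "{0<..}"]) (use 1 in \<open>auto simp: flat_fun_def\<close>)
  next
    case 2
    have "((\<lambda>t. 0) has_real_derivative (flat_fun (n + 2) t - n * flat_fun (n + 1) t)) (at t)"
      using 2 by (simp add: flat_fun_def)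
    then show ?thesis
      by (rule has_field_derivative_transform_within_open[of _ _ _ "{..<0}"]) (use 2 in \<open>auto simp: flat_fun_def\<close>)
  next
    case 3
    have "(flat_fun n has_vector_derivative 0) (at 0)"
    proof (rule has_vector_derivative_quadratic)
      show "norm (flat_fun n (0 + s) - flat_fun n 0 - s *\<^sub>R 0) \<le> fact (n + 2) * s\<^sup>2" for s
        using flat_fun_le[of s n] by (cases "s > 0") (auto simp: flat_fun_def)
    qed
    then show ?thesis using 3 by (simp add: flat_fun_def has_real_derivative_iff_has_vector_derivative)
  qed
qed

lemma Ck_on_flat_fun_comp:
  fixes q :: "'a::euclidean_space \<Rightarrow> real"
  assumes "open U" "\<And>k. Ck_on k U q"
  shows "Ck_on k U (\<lambda>x. flat_fun n (q x))"
proof (induction k arbitrary: n)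
  case 0
  have "continuous_on UNIV (flat_fun n)"
    using flat_fun_deriv DERIV_isCont by (intro continuous_at_imp_continuous_on) blast
  then show ?case using assms(2)[of 0] by (auto intro: continuous_on_compose2)
next
  case (Suc k)
  have q: "q differentiable (at x)" if "x \<in> U" for x using assms(2)[of "Suc 0"] that by simp
  have d: "((\<lambda>x. flat_fun n (q x)) has_derivative
      (\<lambda>b. (flat_fun (n + 2) (q x) - n * flat_fun (n + 1) (q x)) * partial_deriv b q x)) (at x)" if "x \<in> U" for x
    using has_derivative_compose[OF has_derivative_partial_deriv[OF q[OF that]] flat_fun_deriv[unfolded has_field_derivative_def]]
    by simp
  have "Ck_on k U (partial_deriv b (\<lambda>x. flat_fun n (q x)))" if b: "b \<in> Basis" for b
  proof (rule Ck_on_cong[OF assms(1)])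
    show "Ck_on k U (\<lambda>x. (flat_fun (n + 2) (q x) + (- real n) * flat_fun (n + 1) (q x)) * partial_deriv b q x)"
      using assms(2)[of "Suc k"] b by (intro Ck_on_mult Ck_on_add Suc.IH assms(1) Ck_on_const) auto
  qed (simp add: partial_deriv_eqI[OF d])
  then show ?case using d by (auto simp: differentiable_def)
qed

lemma smooth_bump:
  fixes c :: "'a::euclidean_space"
  obtains \<beta> :: "'a \<Rightarrow> real" where "smooth_on UNIV \<beta>" "\<And>x. \<beta> x \<ge> 0" "\<And>x. \<beta> x > 0 \<longleftrightarrow> x \<in> ball c \<rho>"
proof (cases "\<rho> > 0")
  case True
  \<comment> \<open>Positive exactly on the ball. It is written with sums and products only, so that
    the \<open>Ck_on\<close> rules apply directly.\<close>
  define q where "q x = \<rho>\<^sup>2 + (-1) * ((x + - c) \<bullet> (x + - c))" for x :: 'a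
  have "Ck_on k UNIV (\<lambda>x. x + - c)" for k
    by (intro Ck_on_add open_UNIV Ck_on_const Ck_on_bounded_linear bounded_linear_ident)
  then have "Ck_on k UNIV q" for k
    unfolding q_def by (intro Ck_on_bounded_linear bounded_linear_ident Ck_on_add Ck_on_mult open_UNIV Ck_on_const bounded_bilinear.Ck_on_prod[OF bounded_bilinear_inner])
  then have "smooth_on UNIV (\<lambda>x. flat_fun 0 (q x))" by (simp add: smooth_on_def Ck_on_flat_fun_comp)
  moreover have "flat_fun 0 (q x) > 0 \<longleftrightarrow> x \<in> ball c \<rho>" for x
  proof -
    have "q x = \<rho>\<^sup>2 - (dist c x)\<^sup>2" by (simp add: q_def dist_norm power2_norm_eq_inner[symmetric] norm_minus_commute)
    then have "q x > 0 \<longleftrightarrow> dist c x < \<rho>"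
      using True power_less_imp_less_base[of "dist c x" 2 \<rho>] power_strict_mono[of "dist c x" \<rho> 2] by auto
    then show ?thesis by (simp add: flat_fun_def)
  qed
  moreover have "flat_fun 0 (q x) \<ge> 0" for x by (simp add: flat_fun_def)
  ultimately show thesis using that by blast
next
  case False
  then have "\<not> dist c x < \<rho>" for x using zero_le_dist[of c x] by linarith
  then show thesis using that[of "\<lambda>x. 0"] by (simp add: smooth_on_def)
qed

text \<open>A smooth partition of unity on the support of \<psi> splits \<psi> into finitely many
  test functions, each supported in a ball where the pairing is known to vanish.\<close>

lemma pairing_zero_local_to_global:
  fixes f :: "'a::euclidean_space \<Rightarrow> complex"
  assumes f: "integrable (lebesgue_on \<Omega>) f" "\<Omega> \<in> sets lebesgue"
    and loc: "\<And>x. x \<in> \<Omega> \<Longrightarrow> \<exists>\<rho>>0. \<forall>\<phi>\<in>test_functions (ball x \<rho>). pairing \<Omega> f \<phi> = 0"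
    and \<psi>: "\<psi> \<in> test_functions \<Omega>"
  shows "pairing \<Omega> f \<psi> = 0"
proof -
  obtain K where K: "smooth_on UNIV \<psi>" "compact K" "K \<subseteq> \<Omega>" "\<And>x. x \<notin> K \<Longrightarrow> \<psi> x = 0"
    using test_functionsE[OF \<psi>] by blast
  obtain \<rho> where \<rho>: "\<And>x. x \<in> \<Omega> \<Longrightarrow> \<rho> x > 0"
      "\<And>x \<phi>. x \<in> \<Omega> \<Longrightarrow> \<phi> \<in> test_functions (ball x (\<rho> x)) \<Longrightarrow> pairing \<Omega> f \<phi> = 0"
    using bchoice[of \<Omega> "\<lambda>x \<rho>. \<rho> > 0 \<and> (\<forall>\<phi>\<in>test_functions (ball x \<rho>). pairing \<Omega> f \<phi> = 0)"] loc by blast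
  \<comment> \<open>Half radii, so that the closed balls carrying the supports lie in the open balls
    of radius \<open>\<rho> c\<close>.\<close>
  have "\<exists>\<beta> :: 'a \<Rightarrow> real. smooth_on UNIV \<beta> \<and> (\<forall>x. \<beta> x \<ge> 0) \<and> (\<forall>x. \<beta> x > 0 \<longleftrightarrow> x \<in> ball c (\<rho> c / 2))" for c
    by (rule smooth_bump[of c "\<rho> c / 2"]) blast
  then have "\<exists>\<beta>. \<forall>c. smooth_on UNIV (\<beta> c :: 'a \<Rightarrow> real) \<and> (\<forall>x. \<beta> c x \<ge> 0) \<and> (\<forall>x. \<beta> c x > 0 \<longleftrightarrow> x \<in> ball c (\<rho> c / 2))"
    by (intro choice allI)
  then obtain \<beta> where \<beta>: "\<And>c. smooth_on UNIV (\<beta> c :: 'a \<Rightarrow> real)" "\<And>c x. \<beta> c x \<ge> 0"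
      "\<And>c x. \<beta> c x > 0 \<longleftrightarrow> x \<in> ball c (\<rho> c / 2)"
    by blast
  have "K \<subseteq> (\<Union>c\<in>K. ball c (\<rho> c / 2))"
  proof
    fix x assume "x \<in> K"
    then show "x \<in> (\<Union>c\<in>K. ball c (\<rho> c / 2))" using \<rho>(1)[of x] K(3) by (intro UN_I[of x]) auto
  qed
  then obtain X where X: "X \<subseteq> K" "finite X" "K \<subseteq> (\<Union>c\<in>X. ball c (\<rho> c / 2))"
    using compactE_image[OF K(2), of K "\<lambda>c. ball c (\<rho> c / 2)"] by blast
  define \<sigma> where "\<sigma> x = (\<Sum>c\<in>X. \<beta> c x)" for x
  have \<sigma>sm: "Ck_on k UNIV \<sigma>" for k
    unfolding \<sigma>_def[abs_def] using \<beta>(1) by (intro Ck_on_sum) (auto simp: smooth_on_def)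
  have \<sigma>pos: "\<sigma> x > 0" if x: "x \<in> K" for x
  proof -
    obtain c where "c \<in> X" "x \<in> ball c (\<rho> c / 2)" using X(3) x by blast
    then show ?thesis unfolding \<sigma>_def using \<beta>(2,3) X(2) by (intro sum_pos2[of X c]) auto
  qed
  \<comment> \<open>Smooth on the whole space: \<sigma> is positive on the open set
    \<open>{x. \<sigma> x > 0}\<close>, which contains \<open>K\<close>, and on the open complement
    of \<open>K\<close> the factor \<open>\<psi> x\<close> is 0 whatever
    \<open>inverse (\<sigma> x)\<close> is.\<close>
  define \<psi>' where "\<psi>' c x = (\<beta> c x * inverse (\<sigma> x)) *\<^sub>R \<psi> x" for c x
  have oU: "open {x. \<sigma> x > 0}"
    using \<sigma>sm[of 0] by (intro open_Collect_less) auto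
  have oK: "open (- K)" using K(2) compact_imp_closed by auto
  have t: "\<psi>' c \<in> test_functions (ball c (\<rho> c))" if c: "c \<in> X" for c
  proof (rule test_functionsI[of _ "K \<inter> cball c (\<rho> c / 2)"])
    show "smooth_on UNIV (\<psi>' c)"
      unfolding smooth_on_def
    proof
      fix k
      have "Ck_on k {x. \<sigma> x > 0} (\<psi>' c)"
        unfolding \<psi>'_def[abs_def]
        using \<beta>(1)[of c] K(1) \<sigma>sm
        by (intro Ck_on_scaleR Ck_on_mult Ck_on_inverse oU) (auto simp: smooth_on_def intro: Ck_on_subset)
      moreover have "Ck_on k (- K) (\<psi>' c)"
        by (rule Ck_on_cong[OF oK _ Ck_on_const[of k "- K" 0]]) (simp add: \<psi>'_def K(4))
      ultimately have "Ck_on k ({x. \<sigma> x > 0} \<union> - K) (\<psi>' c)" by (rule Ck_on_Un[OF oU oK])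
      moreover have "{x. \<sigma> x > 0} \<union> - K = UNIV" using \<sigma>pos by auto
      ultimately show "Ck_on k UNIV (\<psi>' c)" by simp
    qed
    show "compact (K \<inter> cball c (\<rho> c / 2))" by (intro compact_Int K compact_cball)
    have "\<rho> c > 0" using \<rho>(1) c X(1) K(3) by blast
    then show "K \<inter> cball c (\<rho> c / 2) \<subseteq> ball c (\<rho> c)" by auto
    show "\<psi>' c x = 0" if "x \<notin> K \<inter> cball c (\<rho> c / 2)" for x
    proof (cases "x \<in> K")
      case True
      then have "\<not> \<beta> c x > 0" using that \<beta>(3) by auto
      then show ?thesis using \<beta>(2)[of c x] by (simp add: \<psi>'_def)
    qed (simp add: \<psi>'_def K(4))
  qed
  have "\<psi> x = (\<Sum>c\<in>X. \<psi>' c x)" for x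
  proof (cases "x \<in> K")
    case True
    then show ?thesis using \<sigma>pos[OF True]
      by (simp add: \<psi>'_def scaleR_sum_left[symmetric] sum_distrib_right[symmetric] \<sigma>_def)
  qed (simp add: \<psi>'_def K(4))
  then have "pairing \<Omega> f \<psi> = pairing \<Omega> f (\<lambda>x. \<Sum>c\<in>X. \<psi>' c x)" by presburger
  also have "\<dots> = (\<Sum>c\<in>X. pairing \<Omega> f (\<psi>' c))"
    by (rule pairing_sum_right[OF f X(2) test_functions_mono[OF subset_UNIV t]])
  also have "\<dots> = 0" using t \<rho>(2) X(1) K(3) by (intro sum.neutral) blast
  finally show ?thesis .
qed


section \<open>Hilbert space estimates\<close>

definition L2_norm_sq :: "'a::euclidean_space set \<Rightarrow> ('a \<Rightarrow> complex) \<Rightarrow> real" where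
  "L2_norm_sq \<Omega> f = (LINT x|lebesgue_on \<Omega>. (cmod (f x))\<^sup>2)"

lemma L2_norm_sq_nonneg: "L2_norm_sq \<Omega> f \<ge> 0"
  by (simp add: L2_norm_sq_def)

lemma L2_norm_sq_eq: "L2_norm_sq \<Omega> f = (L2_norm \<Omega> f)\<^sup>2"
  by (simp add: L2_norm_sq_def L2_norm_def)

lemma L2_inner_self: "L2_inner \<Omega> f f = of_real (L2_norm_sq \<Omega> f)"
  unfolding L2_norm_sq_def L2_inner_def complex_norm_square[symmetric] by (rule integral_complex_of_real)

lemma L2_space_integrable_mult:
  assumes "f \<in> L2_space \<Omega>" "g \<in> L2_space \<Omega>"
  shows "integrable (lebesgue_on \<Omega>) (\<lambda>x. f x * cnj (g x))"
proof (rule Bochner_Integration.integrable_bound)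
  show "integrable (lebesgue_on \<Omega>) (\<lambda>x. (cmod (f x))\<^sup>2 + (cmod (g x))\<^sup>2)"
    using assms by (intro Bochner_Integration.integrable_add) (auto simp: L2_space_def)
  have "f \<in> borel_measurable (lebesgue_on \<Omega>)" "g \<in> borel_measurable (lebesgue_on \<Omega>)"
    using assms by (auto simp: L2_space_def)
  then show "(\<lambda>x. f x * cnj (g x)) \<in> borel_measurable (lebesgue_on \<Omega>)"
    by (intro borel_measurable_times measurable_compose[OF _ borel_measurable_continuous_onI[of cnj]])
      (auto intro: continuous_intros)
  have "a * b \<le> a\<^sup>2 + b\<^sup>2" if "a \<ge> 0" "b \<ge> 0" for a b :: real
    using zero_le_power2[of "a - b"] mult_nonneg_nonneg[OF that] by (simp add: power2_eq_square algebra_simps)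
  then show "AE x in lebesgue_on \<Omega>. norm (f x * cnj (g x)) \<le> norm ((cmod (f x))\<^sup>2 + (cmod (g x))\<^sup>2)"
    by (simp add: norm_mult)
qed

lemma L2_space_diff_scale:
  assumes f: "f \<in> L2_space \<Omega>" and g: "g \<in> L2_space \<Omega>"
  shows "(\<lambda>x. f x - c * g x) \<in> L2_space \<Omega>"
    and "L2_norm_sq \<Omega> (\<lambda>x. f x - c * g x)
      = L2_norm_sq \<Omega> f - 2 * Re (cnj c * L2_inner \<Omega> f g) + (cmod c)\<^sup>2 * L2_norm_sq \<Omega> g"
proof -
  have m: "f \<in> borel_measurable (lebesgue_on \<Omega>)" "g \<in> borel_measurable (lebesgue_on \<Omega>)"
    and i: "integrable (lebesgue_on \<Omega>) (\<lambda>x. (cmod (f x))\<^sup>2)" "integrable (lebesgue_on \<Omega>) (\<lambda>x. (cmod (g x))\<^sup>2)"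
    using f g by (auto simp: L2_space_def)
  define R where "R x = Re (cnj c * (f x * cnj (g x)))" for x
  have e: "(cmod (f x - c * g x))\<^sup>2 = (cmod (f x))\<^sup>2 - 2 * R x + (cmod c)\<^sup>2 * (cmod (g x))\<^sup>2" for x
    unfolding R_def by (simp only: cmod_power2) (simp add: power2_eq_square algebra_simps)
  have ir: "integrable (lebesgue_on \<Omega>) R"
    unfolding R_def[abs_def] by (intro integrable_Re integrable_mult_right L2_space_integrable_mult f g)
  show "(\<lambda>x. f x - c * g x) \<in> L2_space \<Omega>"
    unfolding L2_space_def mem_Collect_eq e using m i ir by auto
  have "L2_norm_sq \<Omega> (\<lambda>x. f x - c * g x) = L2_norm_sq \<Omega> f
      - 2 * (LINT x|lebesgue_on \<Omega>. R x) + (cmod c)\<^sup>2 * L2_norm_sq \<Omega> g"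
    unfolding L2_norm_sq_def e using i ir by simp
  also have "(LINT x|lebesgue_on \<Omega>. R x) = Re (cnj c * L2_inner \<Omega> f g)"
  proof -
    have "(LINT x|lebesgue_on \<Omega>. R x) = Re (LINT x|lebesgue_on \<Omega>. cnj c * (f x * cnj (g x)))"
      unfolding R_def by (intro integral_Re integrable_mult_right L2_space_integrable_mult f g)
    then show ?thesis by (simp add: L2_inner_def)
  qed
  finally show "L2_norm_sq \<Omega> (\<lambda>x. f x - c * g x)
      = L2_norm_sq \<Omega> f - 2 * Re (cnj c * L2_inner \<Omega> f g) + (cmod c)\<^sup>2 * L2_norm_sq \<Omega> g" .
qed

lemma L2_space_diff: "f \<in> L2_space \<Omega> \<Longrightarrow> g \<in> L2_space \<Omega> \<Longrightarrow> (\<lambda>x. f x - g x) \<in> L2_space \<Omega>"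
  using L2_space_diff_scale(1)[of f \<Omega> g 1] by simp

lemma L2_norm_sq_diff:
  assumes "f \<in> L2_space \<Omega>" "g \<in> L2_space \<Omega>"
  shows "L2_norm_sq \<Omega> (\<lambda>x. f x - g x) = L2_norm_sq \<Omega> f - 2 * Re (L2_inner \<Omega> f g) + L2_norm_sq \<Omega> g"
  using L2_space_diff_scale(2)[OF assms, of 1] by simp

text \<open>A positive upper bound \<open>A\<close> takes the place of the squared norm of
  \<open>g\<close>, so that dividing by it is legitimate even for a null function. The inequality
  says that f - (z / A) g has nonnegative squared norm, z being the inner product.\<close>

lemma L2_Cauchy_Schwarz:
  assumes f: "f \<in> L2_space \<Omega>" and g: "g \<in> L2_space \<Omega>" and A: "L2_norm_sq \<Omega> g \<le> A" "A > 0"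
  shows "(cmod (L2_inner \<Omega> f g))\<^sup>2 \<le> A * L2_norm_sq \<Omega> f"
proof -
  define z where "z = L2_inner \<Omega> f g"
  have "0 \<le> L2_norm_sq \<Omega> f - 2 * Re (cnj (z / A) * z) + (cmod (z / A))\<^sup>2 * L2_norm_sq \<Omega> g"
    using L2_space_diff_scale(2)[OF f g, of "z / A"] L2_norm_sq_nonneg[of \<Omega> "\<lambda>x. f x - (z / A) * g x"] by (simp add: z_def)
  also have "\<dots> \<le> L2_norm_sq \<Omega> f - 2 * Re (cnj (z / A) * z) + (cmod (z / A))\<^sup>2 * A"
    using A by (intro add_left_mono mult_left_mono) auto
  also have "Re (cnj (z / A) * z) = (cmod z)\<^sup>2 / A"
    by (simp add: cmod_power2 add_divide_distrib power2_eq_square[of "Re z"] power2_eq_square[of "Im z"])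
  also have "(cmod (z / A))\<^sup>2 * A = (cmod z)\<^sup>2 / A" using A(2) by (simp add: norm_divide power_divide power2_eq_square)
  finally show ?thesis using A(2) by (simp add: z_def field_simps)
qed

text \<open>The difference of the two sides is the squared norm of f - 2 g.\<close>

lemma L2_norm_sq_le_double:
  assumes f: "f \<in> L2_space \<Omega>" and g: "g \<in> L2_space \<Omega>"
  shows "L2_norm_sq \<Omega> f \<le> 2 * L2_norm_sq \<Omega> (\<lambda>x. f x - g x) + 2 * L2_norm_sq \<Omega> g"
proof -
  have "0 \<le> L2_norm_sq \<Omega> (\<lambda>x. f x - 2 * g x)" by (rule L2_norm_sq_nonneg)
  also have "\<dots> = L2_norm_sq \<Omega> f - 4 * Re (L2_inner \<Omega> f g) + 4 * L2_norm_sq \<Omega> g"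
    using L2_space_diff_scale(2)[OF f g, of 2] by simp
  finally show ?thesis using L2_norm_sq_diff[OF f g] by simp
qed

lemma L2_inner_diff_scale_left:
  assumes "f \<in> L2_space \<Omega>" "g \<in> L2_space \<Omega>" "h \<in> L2_space \<Omega>"
  shows "L2_inner \<Omega> (\<lambda>x. f x - c * g x) h = L2_inner \<Omega> f h - c * L2_inner \<Omega> g h"
proof -
  have "L2_inner \<Omega> (\<lambda>x. f x - c * g x) h = (LINT x|lebesgue_on \<Omega>. f x * cnj (h x) - c * (g x * cnj (h x)))"
    unfolding L2_inner_def by (simp add: algebra_simps)
  also have "\<dots> = L2_inner \<Omega> f h - c * L2_inner \<Omega> g h"
    unfolding L2_inner_def
    by (simp add: L2_space_integrable_mult assms)
  finally show ?thesis .
qed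

lemma L2_Bessel:
  fixes S :: "nat \<Rightarrow> 'a::euclidean_space \<Rightarrow> complex"
  assumes S: "\<And>n. S n \<in> L2_space \<Omega>" "\<And>m n. L2_inner \<Omega> (S m) (S n) = (if m = n then 1 else 0)"
    and f: "f \<in> L2_space \<Omega>"
  shows "(\<Sum>n<k. (cmod (L2_inner \<Omega> f (S n)))\<^sup>2) \<le> L2_norm_sq \<Omega> f"
proof -
  define c where "c n = L2_inner \<Omega> f (S n)" for n
  define r where "r k x = f x - (\<Sum>n<k. c n * S n x)" for k :: nat and x
  have rSuc: "r (Suc k) = (\<lambda>x. r k x - c k * S k x)" for k by (simp add: r_def fun_eq_iff)
  have S1: "L2_norm_sq \<Omega> (S n) = 1" for n
    using S(2)[of n n] by (simp add: L2_inner_self)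
  \<comment> \<open>The remainder keeps the coefficients of index at least \<open>k\<close>;
    subtracting the next term lowers its squared norm by exactly |c k|^2.\<close>
  have "r k \<in> L2_space \<Omega> \<and> (\<forall>m\<ge>k. L2_inner \<Omega> (r k) (S m) = c m) \<and> L2_norm_sq \<Omega> (r k) = L2_norm_sq \<Omega> f - (\<Sum>n<k. (cmod (c n))\<^sup>2)" for k
  proof (induction k)
    case 0
    then show ?case using f by (simp add: r_def c_def)
  next
    case (Suc k)
    then have rk: "r k \<in> L2_space \<Omega>" and ck: "\<And>m. m \<ge> k \<Longrightarrow> L2_inner \<Omega> (r k) (S m) = c m"
      and nk: "L2_norm_sq \<Omega> (r k) = L2_norm_sq \<Omega> f - (\<Sum>n<k. (cmod (c n))\<^sup>2)" by auto
    have "Re (cnj (c k) * c k) = (cmod (c k))\<^sup>2"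
      by (simp add: cmod_power2 power2_eq_square[of "Re (c k)"] power2_eq_square[of "Im (c k)"])
    then show ?case
      using L2_space_diff_scale[OF rk S(1)[of k], of "c k"] L2_inner_diff_scale_left[OF rk S(1)[of k] S(1)] ck S(2) S1 nk
      by (simp add: rSuc)
  qed
  then have "L2_norm_sq \<Omega> (r k) = L2_norm_sq \<Omega> f - (\<Sum>n<k. (cmod (c n))\<^sup>2)" by blast
  then show ?thesis using L2_norm_sq_nonneg[of \<Omega> "r k"] by (simp add: c_def)
qed

lemma test_in_L2_space:
  assumes "\<phi> \<in> test_functions U" "\<Omega> \<in> lmeasurable"
  shows "\<phi> \<in> L2_space \<Omega>"
proof -
  interpret finite_measure "lebesgue_on \<Omega>" using assms(2) by (rule finite_measure_lebesgue_on)
  have m: "\<phi> \<in> borel_measurable (lebesgue_on \<Omega>)"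
    using assms by (intro continuous_imp_measurable_on_sets_lebesgue) (auto intro: continuous_on_subset test_continuous simp: fmeasurableD)
  obtain C where C: "\<And>x. cmod (\<phi> x) \<le> C" using test_bounded[OF assms(1)] by metis
  have "integrable (lebesgue_on \<Omega>) (\<lambda>x. (cmod (\<phi> x))\<^sup>2)"
    by (rule integrable_const_bound[of _ "C\<^sup>2"]) (use m C in \<open>auto intro!: power_mono\<close>)
  with m show ?thesis by (simp add: L2_space_def)
qed

text \<open>Testing the eigenvalue equation with the conjugate of \<open>\<phi> k\<close> relates
  the inner products of the gradients of \<open>f\<close> and \<open>\<phi> k\<close> to l^2 times
  that of the functions. Polarisation turns both into squared norms, which bounds the gradient of
  \<open>\<phi> k\<close> without computing that of \<open>f\<close>.\<close>

lemma eigenfunction_test_approx: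
  fixes f :: "'a::euclidean_space \<Rightarrow> complex" and l \<eta> :: real
  assumes \<Omega>: "\<Omega> \<in> lmeasurable" and H: "f \<in> H1_0 \<Omega>" and eig: "laplacian_eigen_eq \<Omega> f (- l\<^sup>2)"
    and f1: "L2_norm_sq \<Omega> f = 1" and \<eta>: "\<eta> > 0"
  obtains \<psi> where "\<psi> \<in> test_functions \<Omega>" "L2_norm_sq \<Omega> (\<lambda>x. \<psi> x - f x) \<le> \<eta>"
    "(\<Sum>b\<in>Basis. L2_norm_sq \<Omega> (partial_deriv b \<psi>)) \<le> 4 * l\<^sup>2 + 1"
proof -
  have m: "\<Omega> \<in> sets lebesgue" using \<Omega> by auto
  obtain D \<phi> where f: "f \<in> L2_space \<Omega>" and D: "\<And>b. b \<in> Basis \<Longrightarrow> D b \<in> L2_space \<Omega>"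
      "\<And>b. b \<in> Basis \<Longrightarrow> has_weak_partial_deriv \<Omega> b f (D b)"
    and \<phi>: "\<And>k::nat. \<phi> k \<in> test_functions \<Omega>" and lim: "(\<lambda>k. L2_norm \<Omega> (\<lambda>x. \<phi> k x - f x)) \<longlonglongrightarrow> 0"
      "\<And>b. b \<in> Basis \<Longrightarrow> (\<lambda>k. L2_norm \<Omega> (\<lambda>x. partial_deriv b (\<phi> k) x - D b x)) \<longlonglongrightarrow> 0"
    using H unfolding H1_0_def by blast
  have small: "eventually (\<lambda>k. L2_norm_sq \<Omega> (g k) \<le> \<epsilon>) sequentially"
    if "(\<lambda>k. L2_norm \<Omega> (g k)) \<longlonglongrightarrow> 0" "\<epsilon> > 0" for g \<epsilon>
  proof -
    have "(\<lambda>k. (L2_norm \<Omega> (g k))\<^sup>2) \<longlonglongrightarrow> 0\<^sup>2" by (intro tendsto_intros that)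
    then have "eventually (\<lambda>k. (L2_norm \<Omega> (g k))\<^sup>2 < \<epsilon>) sequentially"
      using that(2) by (intro order_tendstoD(2)) auto
    then show ?thesis by (rule eventually_mono) (simp add: L2_norm_sq_eq)
  qed
  \<comment> \<open>The bound 1/2 yields squared norm at most 3 for \<open>\<phi> k\<close>, hence
    the factor 4 of l^2; the gradient errors of 1 / N per direction, N the dimension, add up to the
    1.\<close>
  define \<epsilon> where "\<epsilon> = min \<eta> (1/2)"
  have "eventually (\<lambda>k. L2_norm_sq \<Omega> (\<lambda>x. \<phi> k x - f x) \<le> \<epsilon>) sequentially"
    by (rule small[OF lim(1)]) (use \<eta> in \<open>simp add: \<epsilon>_def\<close>)
  moreover have "eventually (\<lambda>k. \<forall>b\<in>Basis. L2_norm_sq \<Omega> (\<lambda>x. partial_deriv b (\<phi> k) x - D b x) \<le> 1 / DIM('a)) sequentially"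
    by (intro eventually_ball_finite ballI small lim(2)) auto
  ultimately have "eventually (\<lambda>k. L2_norm_sq \<Omega> (\<lambda>x. \<phi> k x - f x) \<le> \<epsilon> \<and>
      (\<forall>b\<in>Basis. L2_norm_sq \<Omega> (\<lambda>x. partial_deriv b (\<phi> k) x - D b x) \<le> 1 / DIM('a))) sequentially"
    by eventually_elim auto
  then obtain k where k: "L2_norm_sq \<Omega> (\<lambda>x. \<phi> k x - f x) \<le> \<epsilon>"
      "\<And>b. b \<in> Basis \<Longrightarrow> L2_norm_sq \<Omega> (\<lambda>x. partial_deriv b (\<phi> k) x - D b x) \<le> 1 / DIM('a)"
    by (auto simp: eventually_sequentially)
  have L2: "\<phi> k \<in> L2_space \<Omega>" "partial_deriv b (\<phi> k) \<in> L2_space \<Omega>" for b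
    by (rule test_in_L2_space[OF \<phi> \<Omega>], rule test_in_L2_space[OF test_partial_deriv[OF \<phi>] \<Omega>])
  \<comment> \<open>\<open>pairing\<close> is bilinear and \<open>L2_inner\<close> sesquilinear, so
    the test function must be conjugated.\<close>
  have c: "(\<lambda>x. cnj (\<phi> k x)) \<in> test_functions \<Omega>"
    by (rule test_bounded_linear[OF bounded_linear_cnj \<phi>])
  have pc: "partial_deriv b (\<lambda>x. cnj (\<phi> k x)) = (\<lambda>x. cnj (partial_deriv b (\<phi> k) x))" for b
    by (rule ext, rule partial_deriv_eqI, rule bounded_linear.has_derivative[OF bounded_linear_cnj])
      (rule has_derivative_partial_deriv[OF test_differentiable[OF \<phi>]])
  have weak: "(\<Sum>b\<in>Basis. L2_inner \<Omega> (D b) (partial_deriv b (\<phi> k))) = of_real (l\<^sup>2) * L2_inner \<Omega> f (\<phi> k)"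
  proof -
    have "pairing \<Omega> f (laplacian (\<lambda>x. cnj (\<phi> k x))) =
        (\<Sum>b\<in>Basis. pairing \<Omega> f (partial_deriv b (partial_deriv b (\<lambda>x. cnj (\<phi> k x)))))"
      unfolding laplacian_def[abs_def]
      by (rule pairing_sum_right[OF L2_space_integrable[OF f \<Omega>] m]) (auto intro: test_partial_deriv c)
    also have "\<dots> = (\<Sum>b\<in>Basis. - pairing \<Omega> (D b) (partial_deriv b (\<lambda>x. cnj (\<phi> k x))))"
      using D(2) test_partial_deriv[OF c] by (intro sum.cong) (auto simp: has_weak_partial_deriv_def)
    also have "\<dots> = - (\<Sum>b\<in>Basis. L2_inner \<Omega> (D b) (partial_deriv b (\<phi> k)))"
      by (simp add: pc pairing_def L2_inner_def sum_negf)
    also have "pairing \<Omega> f (laplacian (\<lambda>x. cnj (\<phi> k x))) = of_real (- l\<^sup>2) * L2_inner \<Omega> f (\<phi> k)"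
      using eig c by (simp add: laplacian_eigen_eq_def pairing_def L2_inner_def)
    finally show ?thesis by simp
  qed
  have "2 * (\<Sum>b\<in>Basis. Re (L2_inner \<Omega> (D b) (partial_deriv b (\<phi> k)))) = 2 * (l\<^sup>2 * Re (L2_inner \<Omega> f (\<phi> k)))"
    using arg_cong[OF weak, of Re] by simp
  moreover have "2 * Re (L2_inner \<Omega> (D b) (partial_deriv b (\<phi> k))) =
      L2_norm_sq \<Omega> (D b) + L2_norm_sq \<Omega> (partial_deriv b (\<phi> k)) - L2_norm_sq \<Omega> (\<lambda>x. partial_deriv b (\<phi> k) x - D b x)"
    if "b \<in> Basis" for b
    using L2_norm_sq_diff[OF D(1)[OF that] L2(2)[of b]] by (simp add: L2_norm_sq_def norm_minus_commute)
  moreover have "2 * Re (L2_inner \<Omega> f (\<phi> k)) = 1 + L2_norm_sq \<Omega> (\<phi> k) - L2_norm_sq \<Omega> (\<lambda>x. \<phi> k x - f x)"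
    using L2_norm_sq_diff[OF f L2(1)] f1 by (simp add: L2_norm_sq_def norm_minus_commute)
  ultimately have eq: "(\<Sum>b\<in>Basis. L2_norm_sq \<Omega> (D b) + L2_norm_sq \<Omega> (partial_deriv b (\<phi> k)) - L2_norm_sq \<Omega> (\<lambda>x. partial_deriv b (\<phi> k) x - D b x))
      = l\<^sup>2 * (1 + L2_norm_sq \<Omega> (\<phi> k) - L2_norm_sq \<Omega> (\<lambda>x. \<phi> k x - f x))"
    by (simp add: sum_distrib_left mult.left_commute[of 2])
  have "L2_norm_sq \<Omega> (\<phi> k) \<le> 3"
    using L2_norm_sq_le_double[OF L2(1) f] k(1) f1 by (simp add: \<epsilon>_def)
  then have "l\<^sup>2 * (1 + L2_norm_sq \<Omega> (\<phi> k) - L2_norm_sq \<Omega> (\<lambda>x. \<phi> k x - f x)) \<le> l\<^sup>2 * 4"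
    using L2_norm_sq_nonneg[of \<Omega> "\<lambda>x. \<phi> k x - f x"] by (intro mult_left_mono) auto
  moreover have "(\<Sum>b\<in>Basis. L2_norm_sq \<Omega> (\<lambda>x. partial_deriv b (\<phi> k) x - D b x)) \<le> (\<Sum>b\<in>(Basis::'a set). 1 / DIM('a))"
    by (intro sum_mono k(2))
  moreover have "(\<Sum>b\<in>Basis. L2_norm_sq \<Omega> (D b)) \<ge> 0" by (intro sum_nonneg L2_norm_sq_nonneg)
  ultimately have "(\<Sum>b\<in>Basis. L2_norm_sq \<Omega> (partial_deriv b (\<phi> k))) \<le> 4 * l\<^sup>2 + 1"
    using eq by (simp add: sum.distrib sum_subtractf)
  then show thesis using that[OF \<phi>[of k]] k(1) by (simp add: \<epsilon>_def)
qed


section \<open>Averages over balls\<close>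

lemma nn_integral_lborel_translate:
  fixes g :: "'a::euclidean_space \<Rightarrow> ennreal"
  assumes [measurable]: "g \<in> borel_measurable borel"
  shows "(\<integral>\<^sup>+x. g (x + v) \<partial>lborel) = (\<integral>\<^sup>+x. g x \<partial>lborel)"
proof -
  have "(\<integral>\<^sup>+x. g x \<partial>lborel) = (\<integral>\<^sup>+x. g x \<partial>distr lborel borel ((+) v))"
    by (simp add: lborel_distr_plus)
  also have "\<dots> = (\<integral>\<^sup>+x. g (v + x) \<partial>lborel)" by (rule nn_integral_distr) auto
  finally show ?thesis by (simp add: add.commute)
qed

text \<open>Cauchy-Schwarz against the indicator of \<open>B\<close>. Without integrability the
  Bochner integral is 0 by convention.\<close>

lemma norm_integral_sq_le:
  fixes g :: "'a::euclidean_space \<Rightarrow> complex"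
  assumes [measurable]: "B \<in> sets borel" "g \<in> borel_measurable borel"
  shows "(ennreal (cmod (LINT h|lborel. indicator B h *\<^sub>R g h)))\<^sup>2
    \<le> emeasure lborel B * (\<integral>\<^sup>+h. indicator B h * ennreal ((cmod (g h))\<^sup>2) \<partial>lborel)"
proof (cases "integrable lborel (\<lambda>h. indicator B h *\<^sub>R g h)")
  case True
  have "ennreal (cmod (LINT h|lborel. indicator B h *\<^sub>R g h)) \<le> (\<integral>\<^sup>+h. ennreal (cmod (indicator B h *\<^sub>R g h)) \<partial>lborel)"
    by (rule integral_norm_bound_ennreal[OF True])
  also have "\<dots> = (\<integral>\<^sup>+h. indicator B h * (indicator B h * ennreal (cmod (g h))) \<partial>lborel)"
    by (intro nn_integral_cong) (auto simp: indicator_def)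
  finally have "(ennreal (cmod (LINT h|lborel. indicator B h *\<^sub>R g h)))\<^sup>2
      \<le> (\<integral>\<^sup>+h. indicator B h * (indicator B h * ennreal (cmod (g h))) \<partial>lborel)\<^sup>2"
    by (rule power_mono) simp
  also have "\<dots> \<le> (\<integral>\<^sup>+h. (indicator B h)\<^sup>2 \<partial>lborel) * (\<integral>\<^sup>+h. (indicator B h * ennreal (cmod (g h)))\<^sup>2 \<partial>lborel)"
    by (rule Cauchy_Schwarz_nn_integral) auto
  also have "(\<integral>\<^sup>+h. (indicator B h :: ennreal)\<^sup>2 \<partial>lborel) = emeasure lborel B"
  proof -
    have "(indicator B h :: ennreal)\<^sup>2 = indicator B h" for h by (simp add: indicator_def)
    then show ?thesis by simp
  qed
  also have "(\<integral>\<^sup>+h. (indicator B h * ennreal (cmod (g h)))\<^sup>2 \<partial>lborel) = (\<integral>\<^sup>+h. indicator B h * ennreal ((cmod (g h))\<^sup>2) \<partial>lborel)"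
    by (intro nn_integral_cong) (auto simp: indicator_def ennreal_power)
  finally show ?thesis .
qed (simp add: not_integrable_integral_eq)

definition grad_sq :: "('a::euclidean_space \<Rightarrow> complex) \<Rightarrow> 'a \<Rightarrow> real" where
  "grad_sq \<psi> x = (\<Sum>b\<in>Basis. (cmod (partial_deriv b \<psi> x))\<^sup>2)"

lemma test_borel_measurable: "\<psi> \<in> test_functions U \<Longrightarrow> \<psi> \<in> borel_measurable borel"
  by (intro borel_measurable_continuous_onI test_continuous)

lemma grad_sq_measurable:
  assumes "\<psi> \<in> test_functions U"
  shows "grad_sq \<psi> \<in> borel_measurable borel"
proof -
  have [measurable]: "partial_deriv b \<psi> \<in> borel_measurable borel" for b
    by (rule test_borel_measurable[OF test_partial_deriv[OF assms]])
  show ?thesis unfolding grad_sq_def[abs_def] by measurable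
qed

lemma directional_deriv_sq_le:
  assumes "\<psi> \<in> test_functions U"
  shows "(cmod (partial_deriv v \<psi> x))\<^sup>2 \<le> (norm v)\<^sup>2 * grad_sq \<psi> x"
proof -
  have "cmod (partial_deriv v \<psi> x) \<le> (\<Sum>b\<in>Basis. \<bar>v \<bullet> b\<bar> * cmod (partial_deriv b \<psi> x))"
    unfolding partial_deriv_sum_Basis[OF test_differentiable[OF assms], of v] by (rule sum_norm_le) simp
  then have "(cmod (partial_deriv v \<psi> x))\<^sup>2 \<le> (\<Sum>b\<in>Basis. \<bar>v \<bullet> b\<bar> * cmod (partial_deriv b \<psi> x))\<^sup>2"
    by (intro power_mono) auto
  also have "\<dots> \<le> (\<Sum>b\<in>Basis. \<bar>v \<bullet> b\<bar>\<^sup>2) * (\<Sum>b\<in>Basis. (cmod (partial_deriv b \<psi> x))\<^sup>2)"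
    by (rule Cauchy_Schwarz_ineq_sum)
  also have "(\<Sum>b\<in>Basis. \<bar>v \<bullet> b\<bar>\<^sup>2) = (norm v)\<^sup>2"
    unfolding power2_norm_eq_inner by (subst euclidean_inner) (simp add: power2_eq_square)
  finally show ?thesis by (simp add: grad_sq_def)
qed

text \<open>The increment is the integral of the directional derivative over the segment, to which
  Cauchy-Schwarz on [0, 1] applies.\<close>

lemma test_increment_sq_le:
  assumes \<psi>: "\<psi> \<in> test_functions U"
  shows "ennreal ((cmod (\<psi> (x + h) - \<psi> x))\<^sup>2)
    \<le> ennreal ((norm h)\<^sup>2) * (\<integral>\<^sup>+s. indicator {0..1} s * ennreal (grad_sq \<psi> (x + s *\<^sub>R h)) \<partial>lborel)"
proof -
  have [measurable]: "partial_deriv h \<psi> \<in> borel_measurable borel" "grad_sq \<psi> \<in> borel_measurable borel"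
    by (rule test_borel_measurable[OF test_partial_deriv[OF \<psi>]], rule grad_sq_measurable[OF \<psi>])
  have "(LINT s|lborel. indicator {0..1} s *\<^sub>R partial_deriv h \<psi> (x + s *\<^sub>R h)) = \<psi> (x + 1 *\<^sub>R h) - \<psi> (x + 0 *\<^sub>R h)"
  proof (rule integral_FTC_atLeastAtMost[OF zero_le_one])
    show "continuous_on {0..1} (\<lambda>s. partial_deriv h \<psi> (x + s *\<^sub>R h))"
      by (rule continuous_on_compose2[OF test_continuous[OF test_partial_deriv[OF \<psi>]]]) (auto intro!: continuous_intros)
  qed (rule has_vector_derivative_along[OF \<psi>])
  then have "ennreal ((cmod (\<psi> (x + h) - \<psi> x))\<^sup>2)
      = (ennreal (cmod (LINT s|lborel. indicator {0..1} s *\<^sub>R partial_deriv h \<psi> (x + s *\<^sub>R h))))\<^sup>2"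
    by (simp add: ennreal_power)
  also have "\<dots> \<le> emeasure lborel {0..1::real} * (\<integral>\<^sup>+s. indicator {0..1} s * ennreal ((cmod (partial_deriv h \<psi> (x + s *\<^sub>R h)))\<^sup>2) \<partial>lborel)"
    by (rule norm_integral_sq_le) auto
  also have "\<dots> \<le> (\<integral>\<^sup>+s. ennreal ((norm h)\<^sup>2) * (indicator {0..1} s * ennreal (grad_sq \<psi> (x + s *\<^sub>R h))) \<partial>lborel)"
    using directional_deriv_sq_le[OF \<psi>]
    by (auto intro!: nn_integral_mono simp: indicator_def ennreal_mult[symmetric] grad_sq_def sum_nonneg)
  also have "\<dots> = ennreal ((norm h)\<^sup>2) * (\<integral>\<^sup>+s. indicator {0..1} s * ennreal (grad_sq \<psi> (x + s *\<^sub>R h)) \<partial>lborel)"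
    by (rule nn_integral_cmult) measurable
  finally show ?thesis .
qed

text \<open>The difference is minus the integral of \<psi> (x + h) - \<psi> x over the ball. Each
  increment is controlled by the gradient along a segment, and after Fubini translation invariance
  removes \<open>h\<close> and \<open>s\<close>. One factor \<open>V\<close> comes from
  Cauchy-Schwarz, the other from integrating over \<open>h\<close>. The average is left unnormalised
  so that it is also an inner product with an indicator.\<close>

lemma ball_average_Poincare:
  fixes \<psi> :: "'a::euclidean_space \<Rightarrow> complex"
  assumes \<psi>: "\<psi> \<in> test_functions U" and \<epsilon>: "\<epsilon> > 0"
  defines "V \<equiv> measure lborel (ball (0::'a) \<epsilon>)"
  shows "(\<integral>\<^sup>+x. ennreal ((cmod (V *\<^sub>R \<psi> x - (LINT h|lborel. indicator (ball 0 \<epsilon>) h *\<^sub>R \<psi> (x + h))))\<^sup>2) \<partial>lborel)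
    \<le> ennreal (V\<^sup>2 * \<epsilon>\<^sup>2) * (\<integral>\<^sup>+x. ennreal (grad_sq \<psi> x) \<partial>lborel)"
proof -
  define B where "B = ball (0::'a) \<epsilon>"
  have [measurable]: "B \<in> sets borel" by (simp add: B_def)
  have V: "emeasure lborel B = ennreal V" "V \<ge> 0"
    unfolding V_def B_def using emeasure_lborel_ball_finite[of "0::'a" \<epsilon>]
    by (simp_all add: emeasure_eq_ennreal_measure)
  have [measurable]: "\<psi> \<in> borel_measurable borel" "grad_sq \<psi> \<in> borel_measurable borel"
    by (rule test_borel_measurable[OF \<psi>], rule grad_sq_measurable[OF \<psi>])
  obtain C where C: "\<And>x. cmod (\<psi> x) \<le> C" using test_bounded[OF \<psi>] by metis
  define k where "k x h = (\<integral>\<^sup>+s. indicator {0..1} s * ennreal (grad_sq \<psi> (x + s *\<^sub>R h)) \<partial>lborel)" for x h :: 'a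
  have k[measurable]: "case_prod k \<in> borel_measurable (borel \<Otimes>\<^sub>M borel)"
    unfolding k_def by measurable
  have pt: "ennreal ((cmod (V *\<^sub>R \<psi> x - (LINT h|lborel. indicator B h *\<^sub>R \<psi> (x + h))))\<^sup>2)
      \<le> ennreal (V * \<epsilon>\<^sup>2) * (\<integral>\<^sup>+h. indicator B h * k x h \<partial>lborel)" for x
  proof -
    have iB: "integrable lborel (\<lambda>h. indicator B h *\<^sub>R c)" for c :: complex
      using V(1) by (intro integrable_scaleR_left) (simp add: integrable_indicator_iff)
    have i: "integrable lborel (\<lambda>h. indicator B h *\<^sub>R \<psi> (x + h))"
      by (rule Bochner_Integration.integrable_bound[OF iB[of "of_real C"]])
        (auto intro!: AE_I2 mult_left_mono order_trans[OF C] simp: indicator_def)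
    have "V *\<^sub>R \<psi> x = (LINT h|lborel. indicator B h *\<^sub>R \<psi> x)"
      using V(1) by (simp add: integral_scaleR_left integrable_indicator_iff measure_def V(2))
    then have "V *\<^sub>R \<psi> x - (LINT h|lborel. indicator B h *\<^sub>R \<psi> (x + h)) = - (LINT h|lborel. indicator B h *\<^sub>R (\<psi> (x + h) - \<psi> x))"
      using i iB by (simp add: scaleR_diff_right)
    then have "ennreal ((cmod (V *\<^sub>R \<psi> x - (LINT h|lborel. indicator B h *\<^sub>R \<psi> (x + h))))\<^sup>2)
        = (ennreal (cmod (LINT h|lborel. indicator B h *\<^sub>R (\<psi> (x + h) - \<psi> x))))\<^sup>2"
      by (simp add: ennreal_power)
    also have "\<dots> \<le> emeasure lborel B * (\<integral>\<^sup>+h. indicator B h * ennreal ((cmod (\<psi> (x + h) - \<psi> x))\<^sup>2) \<partial>lborel)"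
      by (rule norm_integral_sq_le) auto
    also have "(\<integral>\<^sup>+h. indicator B h * ennreal ((cmod (\<psi> (x + h) - \<psi> x))\<^sup>2) \<partial>lborel) \<le> (\<integral>\<^sup>+h. ennreal (\<epsilon>\<^sup>2) * (indicator B h * k x h) \<partial>lborel)"
    proof (rule nn_integral_mono)
      fix h
      show "indicator B h * ennreal ((cmod (\<psi> (x + h) - \<psi> x))\<^sup>2) \<le> ennreal (\<epsilon>\<^sup>2) * (indicator B h * k x h)"
      proof (cases "h \<in> B")
        case True
        then have "ennreal ((norm h)\<^sup>2) \<le> ennreal (\<epsilon>\<^sup>2)" by (intro ennreal_leI power_mono) (auto simp: B_def)
        then show ?thesis using True order_trans[OF test_increment_sq_le[OF \<psi>, of x h] mult_right_mono] by (simp add: k_def)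
      qed simp
    qed
    also have "\<dots> = ennreal (\<epsilon>\<^sup>2) * (\<integral>\<^sup>+h. indicator B h * k x h \<partial>lborel)"
      by (rule nn_integral_cmult) measurable
    finally show ?thesis using V by (simp add: ennreal_mult mult.assoc mult_left_mono)
  qed
  have "(\<integral>\<^sup>+x. ennreal ((cmod (V *\<^sub>R \<psi> x - (LINT h|lborel. indicator B h *\<^sub>R \<psi> (x + h))))\<^sup>2) \<partial>lborel)
      \<le> (\<integral>\<^sup>+x. ennreal (V * \<epsilon>\<^sup>2) * (\<integral>\<^sup>+h. indicator B h * k x h \<partial>lborel) \<partial>lborel)"
    by (rule nn_integral_mono) (rule pt)
  also have "\<dots> = ennreal (V * \<epsilon>\<^sup>2) * (\<integral>\<^sup>+x. (\<integral>\<^sup>+h. indicator B h * k x h \<partial>lborel) \<partial>lborel)"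
    by (rule nn_integral_cmult) measurable
  also have "(\<integral>\<^sup>+x. (\<integral>\<^sup>+h. indicator B h * k x h \<partial>lborel) \<partial>lborel) = (\<integral>\<^sup>+h. (\<integral>\<^sup>+x. indicator B h * k x h \<partial>lborel) \<partial>lborel)"
    by (rule lborel_pair.Fubini'[symmetric]) measurable
  also have "\<dots> = (\<integral>\<^sup>+h. indicator B h * (\<integral>\<^sup>+x. ennreal (grad_sq \<psi> x) \<partial>lborel) \<partial>lborel)"
  proof (rule nn_integral_cong)
    fix h :: 'a
    have "(\<integral>\<^sup>+x. k x h \<partial>lborel) = (\<integral>\<^sup>+s. (\<integral>\<^sup>+x. indicator {0..1} s * ennreal (grad_sq \<psi> (x + s *\<^sub>R h)) \<partial>lborel) \<partial>lborel)"
      unfolding k_def by (rule lborel_pair.Fubini'[symmetric]) measurable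
    also have "\<dots> = (\<integral>\<^sup>+s. indicator {0..1::real} s * (\<integral>\<^sup>+x. ennreal (grad_sq \<psi> x) \<partial>lborel) \<partial>lborel)"
      by (intro nn_integral_cong) (simp add: nn_integral_cmult nn_integral_lborel_translate[of "\<lambda>x. ennreal (grad_sq \<psi> x)"])
    also have "\<dots> = (\<integral>\<^sup>+x. ennreal (grad_sq \<psi> x) \<partial>lborel)"
      by (simp add: nn_integral_multc)
    finally show "(\<integral>\<^sup>+x. indicator B h * k x h \<partial>lborel) = indicator B h * (\<integral>\<^sup>+x. ennreal (grad_sq \<psi> x) \<partial>lborel)"
      by (simp add: nn_integral_cmult)
  qed
  also have "\<dots> = ennreal V * (\<integral>\<^sup>+x. ennreal (grad_sq \<psi> x) \<partial>lborel)"
    by (simp add: nn_integral_multc V(1))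
  also have "ennreal (V * \<epsilon>\<^sup>2) * (ennreal V * (\<integral>\<^sup>+x. ennreal (grad_sq \<psi> x) \<partial>lborel))
      = ennreal (V\<^sup>2 * \<epsilon>\<^sup>2) * (\<integral>\<^sup>+x. ennreal (grad_sq \<psi> x) \<partial>lborel)"
  proof -
    have "V\<^sup>2 * \<epsilon>\<^sup>2 = (V * \<epsilon>\<^sup>2) * V" by (simp add: power2_eq_square)
    then show ?thesis using V(2) by (simp only: ennreal_mult mult.assoc zero_le_power2 mult_nonneg_nonneg)
  qed
  finally show ?thesis unfolding B_def .
qed


section \<open>Growth of the eigenvalues\<close>

lemma integral_lebesgue_on_supported:
  fixes g :: "'a::euclidean_space \<Rightarrow> 'b::{banach, second_countable_topology}"
  assumes "\<Omega> \<in> sets borel" "g \<in> borel_measurable borel" "\<And>x. x \<notin> \<Omega> \<Longrightarrow> g x = 0"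
  shows "(LINT x|lebesgue_on \<Omega>. g x) = (LINT x|lborel. g x)"
proof -
  have "(LINT x|lebesgue_on \<Omega>. g x) = (LINT x|lebesgue. indicator \<Omega> x *\<^sub>R g x)"
    using assms(1) by (intro integral_restrict_space) auto
  also have "(\<lambda>x. indicator \<Omega> x *\<^sub>R g x) = g" using assms(3) by (auto simp: indicator_def)
  also have "(LINT x|lebesgue. g x) = (LINT x|lborel. g x)"
    using assms(2) by (intro integral_completion) auto
  finally show ?thesis .
qed

lemma test_zero_outside: "\<phi> \<in> test_functions \<Omega> \<Longrightarrow> x \<notin> \<Omega> \<Longrightarrow> \<phi> x = 0"
  by (elim test_functionsE) blast

lemma nn_integral_test_sq:
  assumes "open \<Omega>" "\<phi> \<in> test_functions \<Omega>"
  shows "(\<integral>\<^sup>+x. ennreal ((cmod (\<phi> x))\<^sup>2) \<partial>lborel) = ennreal (L2_norm_sq \<Omega> \<phi>)"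
proof -
  obtain K where "smooth_on UNIV \<phi>" and K: "compact K" "K \<subseteq> \<Omega>" "\<And>x. x \<notin> K \<Longrightarrow> \<phi> x = 0"
    using test_functionsE[OF assms(2)] by blast
  have "continuous_on K \<phi>" by (rule continuous_on_subset[OF test_continuous[OF assms(2)]]) simp
  then have c: "continuous_on K (\<lambda>x. (cmod (\<phi> x))\<^sup>2)" by (intro continuous_intros)
  have "indicator K x *\<^sub>R (cmod (\<phi> x))\<^sup>2 = (cmod (\<phi> x))\<^sup>2" for x
    using K(3)[of x] by (cases "x \<in> K") auto
  then have "integrable lborel (\<lambda>x. (cmod (\<phi> x))\<^sup>2)"
    using borel_integrable_compact[OF K(1) c] by (simp only:)
  then have "(\<integral>\<^sup>+x. ennreal ((cmod (\<phi> x))\<^sup>2) \<partial>lborel) = ennreal (LINT x|lborel. (cmod (\<phi> x))\<^sup>2)"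
    by (intro nn_integral_eq_integral) auto
  also have "(LINT x|lborel. (cmod (\<phi> x))\<^sup>2) = L2_norm_sq \<Omega> \<phi>"
    unfolding L2_norm_sq_def
  proof (rule integral_lebesgue_on_supported[symmetric])
    show "\<Omega> \<in> sets borel" using assms(1) by simp
    show "(\<lambda>x. (cmod (\<phi> x))\<^sup>2) \<in> borel_measurable borel"
      using test_borel_measurable[OF assms(2)] by measurable
    show "(cmod (\<phi> x))\<^sup>2 = 0" if "x \<notin> \<Omega>" for x using test_zero_outside[OF assms(2) that] by simp
  qed
  finally show ?thesis .
qed

lemma nn_integral_grad_sq:
  assumes "open \<Omega>" "\<phi> \<in> test_functions \<Omega>"
  shows "(\<integral>\<^sup>+x. ennreal (grad_sq \<phi> x) \<partial>lborel) = ennreal (\<Sum>b\<in>Basis. L2_norm_sq \<Omega> (partial_deriv b \<phi>))"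
proof -
  have [measurable]: "partial_deriv b \<phi> \<in> borel_measurable borel" for b
    by (rule test_borel_measurable[OF test_partial_deriv[OF assms(2)]])
  have "(\<integral>\<^sup>+x. ennreal (grad_sq \<phi> x) \<partial>lborel) = (\<integral>\<^sup>+x. (\<Sum>b\<in>Basis. ennreal ((cmod (partial_deriv b \<phi> x))\<^sup>2)) \<partial>lborel)"
    by (simp add: grad_sq_def)
  also have "\<dots> = (\<Sum>b\<in>Basis. \<integral>\<^sup>+x. ennreal ((cmod (partial_deriv b \<phi> x))\<^sup>2) \<partial>lborel)"
    by (rule nn_integral_sum) measurable
  also have "\<dots> = (\<Sum>b\<in>Basis. ennreal (L2_norm_sq \<Omega> (partial_deriv b \<phi>)))"
    by (intro sum.cong refl nn_integral_test_sq assms test_partial_deriv)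
  finally show ?thesis by (simp add: L2_norm_sq_nonneg)
qed

lemma L2_norm_sq_indicator_ball:
  assumes "open \<Omega>"
  shows "(indicator (ball x \<epsilon>) :: 'a::euclidean_space \<Rightarrow> complex) \<in> L2_space \<Omega>"
    and "L2_norm_sq \<Omega> (indicator (ball x \<epsilon>)) \<le> measure lborel (ball x \<epsilon>)"
proof -
  have b: "integrable lebesgue (indicator (ball x \<epsilon>) :: 'a \<Rightarrow> real)"
    using emeasure_lborel_ball_finite[of x \<epsilon>] by (simp add: integrable_indicator_iff)
  have o: "\<Omega> \<in> sets lebesgue" using assms by (intro sets_completionI_sets) auto
  have "integrable lebesgue (\<lambda>y. indicator \<Omega> y *\<^sub>R (indicator (ball x \<epsilon>) y :: real))"
    using integrable_mult_indicator[OF o b] by simp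
  then have i: "integrable (lebesgue_on \<Omega>) (indicator (ball x \<epsilon>) :: 'a \<Rightarrow> real)"
    using o by (subst integrable_restrict_space) auto
  have sq: "(\<lambda>y. (cmod (indicator (ball x \<epsilon>) y))\<^sup>2) = (indicator (ball x \<epsilon>) :: 'a \<Rightarrow> real)"
    by (auto simp: indicator_def)
  have "(indicator (ball x \<epsilon>) :: 'a \<Rightarrow> complex) = (\<lambda>y. of_real (indicator (ball x \<epsilon>) y))"
    by (auto simp: indicator_def)
  then show "(indicator (ball x \<epsilon>) :: 'a \<Rightarrow> complex) \<in> L2_space \<Omega>"
    using i borel_measurable_integrable[OF i] unfolding L2_space_def mem_Collect_eq sq
    by (simp add: borel_measurable_of_real)
  have "L2_norm_sq \<Omega> (indicator (ball x \<epsilon>)) = (LINT y|lebesgue. indicator \<Omega> y *\<^sub>R (indicator (ball x \<epsilon>) y :: real))"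
    unfolding L2_norm_sq_def sq using o by (intro integral_restrict_space) auto
  also have "\<dots> \<le> (LINT y|lebesgue. indicator (ball x \<epsilon>) y)"
  proof (rule integral_mono[OF _ b])
    show "integrable lebesgue (\<lambda>y. indicator \<Omega> y *\<^sub>R (indicator (ball x \<epsilon>) y :: real))"
      by (rule integrable_mult_indicator[OF o b])
  qed (simp add: indicator_def)
  also have "\<dots> = measure lborel (ball x \<epsilon>)" by simp
  finally show "L2_norm_sq \<Omega> (indicator (ball x \<epsilon>)) \<le> measure lborel (ball x \<epsilon>)" .
qed

lemma L2_inner_commute: "L2_inner \<Omega> f g = cnj (L2_inner \<Omega> g f)"
proof -
  have "L2_inner \<Omega> f g = (LINT x|lebesgue_on \<Omega>. cnj (g x * cnj (f x)))"
    by (simp add: L2_inner_def mult.commute)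
  then show ?thesis
    using Bochner_Integration.integral_cnj[of "lebesgue_on \<Omega>" "\<lambda>x. g x * cnj (f x)"] by (simp only: L2_inner_def)
qed

lemma power2_norm_add_le: "(norm (a + b))\<^sup>2 \<le> 2 * (norm a)\<^sup>2 + 2 * (norm b)\<^sup>2"
  for a b :: "'a::real_normed_vector"
proof -
  have "(norm (a + b))\<^sup>2 \<le> (norm a + norm b)\<^sup>2" by (intro power_mono norm_triangle_ineq) auto
  also have "\<dots> \<le> 2 * (norm a)\<^sup>2 + 2 * (norm b)\<^sup>2"
    using zero_le_power2[of "norm a - norm b"] by (simp add: power2_eq_square algebra_simps)
  finally show ?thesis .
qed

text \<open>Bessel's inequality for the indicators of balls of radius \<open>\<epsilon>\<close> bounds the averages of the
  eigenfunctions over such balls, and \<open>\<epsilon> = 1 / (8 (1 + \<lambda>\<^sub>n))\<close> is so small that the averages of the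
  first \<open>n + 1\<close> eigenfunctions still carry a fixed part of their \<open>L\<^sup>2\<close> norms.\<close>

lemma Dirichlet_eigenvalue_growth:
  fixes \<Omega> :: "'a::euclidean_space set" and S :: "nat \<Rightarrow> 'a \<Rightarrow> complex" and lam :: "nat \<Rightarrow> real"
  assumes \<Omega>: "open \<Omega>" "bounded \<Omega>"
    and S: "\<And>n. S n \<in> L2_space \<Omega>" "\<And>m n. L2_inner \<Omega> (S m) (S n) = (if m = n then 1 else 0)"
    and H: "\<And>n. S n \<in> H1_0 \<Omega>" and eig: "\<And>n. laplacian_eigen_eq \<Omega> (S n) (- (lam n)\<^sup>2)"
    and lam: "\<And>n. lam n \<ge> 0" "incseq lam"
  shows "\<exists>C>0. \<forall>n. real (Suc n) \<le> C * (1 + lam n) ^ DIM('a)"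
proof -
  have lm: "\<Omega> \<in> lmeasurable" using \<Omega> by (simp add: lmeasurable_open)
  obtain R where R: "R > 0" "\<Omega> \<subseteq> ball 0 R" using \<Omega>(2) bounded_subset_ballD by blast
  define W where "W = measure lborel (ball (0::'a) (R + 1))"
  define V1 where "V1 = measure lborel (ball (0::'a) 1)"
  have V1: "V1 > 0" unfolding V1_def by (rule content_ball_pos) simp
  have W: "W > 0" unfolding W_def using R by (intro content_ball_pos) simp
  have S1: "L2_norm_sq \<Omega> (S n) = 1" for n
    using S(2)[of n n] by (simp add: L2_inner_self)
  have "real (Suc m) \<le> (32 * W / V1 * 8 ^ DIM('a)) * (1 + lam m) ^ DIM('a)" for m
  proof -
    define k where "k = Suc m"
    define \<epsilon> where "\<epsilon> = 1 / (8 * (1 + lam m))"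
    have \<epsilon>: "0 < \<epsilon>" "\<epsilon> \<le> 1" using lam(1)[of m] by (auto simp: \<epsilon>_def field_simps)
    define V where "V = measure lborel (ball (0::'a) \<epsilon>)"
    have Vx: "measure lborel (ball x \<epsilon>) = V" for x :: 'a
      using content_ball_conv_unit_ball[of \<epsilon> x] content_ball_conv_unit_ball[of \<epsilon> "0::'a"] \<epsilon> by (simp add: V_def)
    have V: "V = \<epsilon> ^ DIM('a) * V1"
      using content_ball_conv_unit_ball[of \<epsilon> "0::'a"] \<epsilon> by (simp add: V_def V1_def)
    have V0: "V > 0" using V V1 \<epsilon> by simp
    \<comment> \<open>1 / 8 preserves enough mass of each eigenfunction; 1 / k keeps the total error
      of the k approximations in Bessel's inequality bounded.\<close>
    define \<eta> where "\<eta> = min (1 / 8) (1 / real k)"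
    have \<eta>: "\<eta> > 0" "\<eta> \<le> 1 / 8" "k * \<eta> \<le> 1" by (auto simp: \<eta>_def k_def min_def field_simps)
    have "\<exists>\<psi>. \<psi> \<in> test_functions \<Omega> \<and> L2_norm_sq \<Omega> (\<lambda>x. \<psi> x - S n x) \<le> \<eta> \<and>
        (\<Sum>b\<in>Basis. L2_norm_sq \<Omega> (partial_deriv b \<psi>)) \<le> 4 * (lam n)\<^sup>2 + 1" for n
      by (rule eigenfunction_test_approx[OF lm H eig S1 \<eta>(1)]) blast
    then have "\<exists>\<psi>. \<forall>n. \<psi> n \<in> test_functions \<Omega> \<and> L2_norm_sq \<Omega> (\<lambda>x. \<psi> n x - S n x) \<le> \<eta> \<and>
        (\<Sum>b\<in>Basis. L2_norm_sq \<Omega> (partial_deriv b (\<psi> n))) \<le> 4 * (lam n)\<^sup>2 + 1"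
      by (intro choice allI)
    then obtain \<psi> where \<psi>: "\<And>n. \<psi> n \<in> test_functions \<Omega>" "\<And>n. L2_norm_sq \<Omega> (\<lambda>x. \<psi> n x - S n x) \<le> \<eta>"
        "\<And>n. (\<Sum>b\<in>Basis. L2_norm_sq \<Omega> (partial_deriv b (\<psi> n))) \<le> 4 * (lam n)\<^sup>2 + 1" by blast
    have [measurable]: "\<psi> n \<in> borel_measurable borel" for n by (rule test_borel_measurable[OF \<psi>(1)])
    have \<psi>L: "\<psi> n \<in> L2_space \<Omega>" for n by (rule test_in_L2_space[OF \<psi>(1) lm])
    \<comment> \<open>Seen as an integral over shifts, \<open>J\<close> fits the Poincare estimate;
      seen as an inner product with a ball indicator, it fits Bessel's inequality.\<close>
    define J where "J n x = (LINT h|lborel. indicator (ball 0 \<epsilon>) h *\<^sub>R \<psi> n (x + h))" for n x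
    have [measurable]: "J n \<in> borel_measurable borel" for n
    proof -
      define B where "B = ball (0::'a) \<epsilon>"
      have [measurable]: "B \<in> sets borel" by (simp add: B_def)
      have "(\<lambda>(x, h). indicator B h *\<^sub>R \<psi> n (x + h)) \<in> borel_measurable (borel \<Otimes>\<^sub>M borel)" by measurable
      also have "borel_measurable (borel \<Otimes>\<^sub>M borel) = borel_measurable (borel \<Otimes>\<^sub>M (lborel :: 'a measure))"
        by (intro measurable_cong_sets sets_pair_measure_cong) auto
      finally show ?thesis
        unfolding J_def B_def[symmetric] by (rule lborel.borel_measurable_lebesgue_integral)
    qed
    have J_inner: "J n x = L2_inner \<Omega> (\<psi> n) (indicator (ball x \<epsilon>))" for n x
    proof -
      have mb: "(\<lambda>y. indicator (ball x \<epsilon>) y *\<^sub>R \<psi> n y) \<in> borel_measurable borel"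
        by (intro borel_measurable_scaleR borel_measurable_indicator) auto
      have "L2_inner \<Omega> (\<psi> n) (indicator (ball x \<epsilon>)) = (LINT y|lebesgue_on \<Omega>. indicator (ball x \<epsilon>) y *\<^sub>R \<psi> n y)"
        unfolding L2_inner_def by (intro Bochner_Integration.integral_cong) (auto simp: indicator_def)
      also have "\<dots> = (LINT y|lborel. indicator (ball x \<epsilon>) y *\<^sub>R \<psi> n y)"
        using \<Omega>(1) by (intro integral_lebesgue_on_supported mb) (auto simp: test_zero_outside[OF \<psi>(1)])
      also have "\<dots> = (LINT y|distr lborel borel ((+) x). indicator (ball x \<epsilon>) y *\<^sub>R \<psi> n y)"
        by (simp add: lborel_distr_plus)
      also have "\<dots> = (LINT h|lborel. indicator (ball x \<epsilon>) (x + h) *\<^sub>R \<psi> n (x + h))"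
        by (rule integral_distr[OF _ mb]) simp
      also have "\<dots> = J n x"
        unfolding J_def by (intro Bochner_Integration.integral_cong) (auto simp: indicator_def dist_norm)
      finally show ?thesis by simp
    qed
    have J_sum: "(\<Sum>n<k. (cmod (J n x))\<^sup>2) \<le> 4 * V" for x
    proof -
      note ind = L2_norm_sq_indicator_ball[OF \<Omega>(1), of x \<epsilon>, unfolded Vx]
      have "(cmod (J n x))\<^sup>2 \<le> 2 * (cmod (L2_inner \<Omega> (indicator (ball x \<epsilon>)) (S n)))\<^sup>2 + 2 * (V * \<eta>)" for n
      proof -
        have "J n x = L2_inner \<Omega> (S n) (indicator (ball x \<epsilon>)) + L2_inner \<Omega> (\<lambda>y. \<psi> n y - S n y) (indicator (ball x \<epsilon>))"
          using L2_inner_diff_scale_left[OF \<psi>L[of n] S(1)[of n] ind(1), of 1] by (simp add: J_inner)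
        then have "(cmod (J n x))\<^sup>2 \<le> 2 * (cmod (L2_inner \<Omega> (S n) (indicator (ball x \<epsilon>))))\<^sup>2
            + 2 * (cmod (L2_inner \<Omega> (\<lambda>y. \<psi> n y - S n y) (indicator (ball x \<epsilon>))))\<^sup>2"
          by (simp only: power2_norm_add_le)
        moreover have "(cmod (L2_inner \<Omega> (\<lambda>y. \<psi> n y - S n y) (indicator (ball x \<epsilon>))))\<^sup>2 \<le> V * L2_norm_sq \<Omega> (\<lambda>y. \<psi> n y - S n y)"
          by (rule L2_Cauchy_Schwarz[OF L2_space_diff[OF \<psi>L S(1)] ind V0])
        moreover have "\<dots> \<le> V * \<eta>" using \<psi>(2)[of n] V0 by simp
        moreover have "cmod (L2_inner \<Omega> (S n) (indicator (ball x \<epsilon>))) = cmod (L2_inner \<Omega> (indicator (ball x \<epsilon>)) (S n))"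
          by (subst L2_inner_commute) simp
        ultimately show ?thesis by simp
      qed
      then have "(\<Sum>n<k. (cmod (J n x))\<^sup>2) \<le> (\<Sum>n<k. 2 * (cmod (L2_inner \<Omega> (indicator (ball x \<epsilon>)) (S n)))\<^sup>2 + 2 * (V * \<eta>))"
        by (intro sum_mono)
      also have "\<dots> = 2 * (\<Sum>n<k. (cmod (L2_inner \<Omega> (indicator (ball x \<epsilon>)) (S n)))\<^sup>2) + 2 * V * (k * \<eta>)"
        by (simp add: sum.distrib sum_distrib_left algebra_simps)
      also have "\<dots> \<le> 2 * V + 2 * V * 1"
        using L2_Bessel[OF S ind(1), of k] ind(2) \<eta>(3) V0 by (intro add_mono mult_left_mono) auto
      finally show ?thesis by simp
    qed
    \<comment> \<open>As \<epsilon> <= 1, averaging spreads the support by at most 1, hence the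
      radius R + 1 in \<open>W\<close>.\<close>
    have J_zero: "J n x = 0" if "x \<notin> ball 0 (R + 1)" for n x
    proof -
      have "indicator (ball 0 \<epsilon>) h *\<^sub>R \<psi> n (x + h) = 0" for h
      proof (cases "h \<in> ball 0 \<epsilon>")
        case True
        have "norm x \<le> norm (x + h) + norm h" using norm_triangle_ineq4[of "x + h" h] by simp
        then have "x + h \<notin> ball 0 R" using that True \<epsilon> by auto
        then have "x + h \<notin> \<Omega>" using R(2) by blast
        then show ?thesis by (simp add: test_zero_outside[OF \<psi>(1)])
      qed simp
      then show ?thesis unfolding J_def by (simp only: Bochner_Integration.integral_zero)
    qed
    define I where "I n = (\<integral>\<^sup>+x. ennreal ((cmod (J n x))\<^sup>2) \<partial>lborel)" for n
    have I_sum: "(\<Sum>n<k. I n) \<le> ennreal (4 * V * W)"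
    proof -
      have "(\<Sum>n<k. I n) = (\<integral>\<^sup>+x. (\<Sum>n<k. ennreal ((cmod (J n x))\<^sup>2)) \<partial>lborel)"
        unfolding I_def by (rule nn_integral_sum[symmetric]) measurable
      also have "\<dots> \<le> (\<integral>\<^sup>+x. ennreal (4 * V) * indicator (ball (0::'a) (R + 1)) x \<partial>lborel)"
      proof (rule nn_integral_mono)
        fix x :: 'a
        show "(\<Sum>n<k. ennreal ((cmod (J n x))\<^sup>2)) \<le> ennreal (4 * V) * indicator (ball 0 (R + 1)) x"
        proof (cases "x \<in> ball 0 (R + 1)")
          case True
          then show ?thesis using ennreal_leI[OF J_sum[of x]] by simp
        qed (simp add: J_zero)
      qed
      also have "\<dots> = ennreal (4 * V) * emeasure lborel (ball (0::'a) (R + 1))"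
        by (rule nn_integral_cmult_indicator) simp
      also have "\<dots> = ennreal (4 * V * W)"
        using emeasure_lborel_ball_finite[of "0::'a" "R + 1"] V0 W
        by (simp add: W_def emeasure_eq_ennreal_measure ennreal_mult)
      finally show ?thesis .
    qed
    have I_lower: "I n \<ge> ennreal (V\<^sup>2 / 8)" if n: "n < k" for n
    proof (cases "I n = top")
      case False
      then obtain i where i: "I n = ennreal i" "i \<ge> 0" by (cases "I n") auto
      define E where "E = (\<Sum>b\<in>Basis. L2_norm_sq \<Omega> (partial_deriv b (\<psi> n)))"
      have E0: "E \<ge> 0" unfolding E_def by (intro sum_nonneg L2_norm_sq_nonneg)
      have "lam n \<le> lam m" using n lam(2) by (auto simp: k_def incseq_def)
      then have "E \<le> 4 * (1 + lam m)\<^sup>2"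
        using \<psi>(3)[of n] lam(1)[of n] power_mono[of "lam n" "lam m" 2] by (simp add: E_def power2_eq_square algebra_simps)
      then have "\<epsilon>\<^sup>2 * E \<le> \<epsilon>\<^sup>2 * (4 * (1 + lam m)\<^sup>2)" by (rule mult_left_mono) simp
      also have "\<dots> = 4 * (\<epsilon> * (1 + lam m))\<^sup>2" by (simp add: power_mult_distrib)
      also have "\<epsilon> * (1 + lam m) = 1 / 8" using lam(1)[of m] by (simp add: \<epsilon>_def)
      also have "4 * (1 / 8 :: real)\<^sup>2 = 1 / 16" by (simp add: power2_eq_square)
      finally have E: "V\<^sup>2 * \<epsilon>\<^sup>2 * E \<le> V\<^sup>2 / 16" using mult_left_mono[of "\<epsilon>\<^sup>2 * E" "1 / 16" "V\<^sup>2"] by simp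
      have "ennreal (V\<^sup>2 * L2_norm_sq \<Omega> (\<psi> n)) = ennreal (V\<^sup>2) * (\<integral>\<^sup>+x. ennreal ((cmod (\<psi> n x))\<^sup>2) \<partial>lborel)"
        by (simp add: nn_integral_test_sq[OF \<Omega>(1) \<psi>(1)] ennreal_mult' L2_norm_sq_nonneg)
      also have "\<dots> = (\<integral>\<^sup>+x. ennreal ((cmod (V *\<^sub>R \<psi> n x))\<^sup>2) \<partial>lborel)"
        by (subst nn_integral_cmult[symmetric]) (auto simp: ennreal_mult[symmetric] power_mult_distrib)
      also have "\<dots> \<le> (\<integral>\<^sup>+x. 2 * ennreal ((cmod (V *\<^sub>R \<psi> n x - J n x))\<^sup>2) + 2 * ennreal ((cmod (J n x))\<^sup>2) \<partial>lborel)"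
      proof (rule nn_integral_mono)
        fix x
        have "(cmod (V *\<^sub>R \<psi> n x))\<^sup>2 \<le> 2 * (cmod (V *\<^sub>R \<psi> n x - J n x))\<^sup>2 + 2 * (cmod (J n x))\<^sup>2"
          using power2_norm_add_le[of "V *\<^sub>R \<psi> n x - J n x" "J n x"] by simp
        from ennreal_leI[OF this]
        show "ennreal ((cmod (V *\<^sub>R \<psi> n x))\<^sup>2) \<le> 2 * ennreal ((cmod (V *\<^sub>R \<psi> n x - J n x))\<^sup>2) + 2 * ennreal ((cmod (J n x))\<^sup>2)"
          by (simp add: ennreal_plus ennreal_mult')
      qed
      also have "\<dots> = 2 * (\<integral>\<^sup>+x. ennreal ((cmod (V *\<^sub>R \<psi> n x - J n x))\<^sup>2) \<partial>lborel) + 2 * I n"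
        unfolding I_def by (simp add: nn_integral_add nn_integral_cmult)
      also have "\<dots> \<le> 2 * (ennreal (V\<^sup>2 * \<epsilon>\<^sup>2) * ennreal E) + 2 * I n"
        using ball_average_Poincare[OF \<psi>(1)[of n] \<epsilon>(1)] unfolding J_def V_def E_def nn_integral_grad_sq[OF \<Omega>(1) \<psi>(1)]
        by (intro add_right_mono mult_left_mono) auto
      also have "\<dots> = ennreal (2 * (V\<^sup>2 * \<epsilon>\<^sup>2 * E) + 2 * i)"
        using i E0 by (simp add: ennreal_plus ennreal_mult')
      finally have "V\<^sup>2 * L2_norm_sq \<Omega> (\<psi> n) \<le> 2 * (V\<^sup>2 * \<epsilon>\<^sup>2 * E) + 2 * i"
        using i E0 by (subst (asm) ennreal_le_iff) auto
      \<comment> \<open>From 1 <= 2 \<eta> + 2 |\<psi> n|^2, in L^2 norm, with \<eta> <= 1 / 8. The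
        gradient error costs twice V^2 / 16, so 3/8 V^2 <= 1/8 V^2 + 2 i leaves i >= V^2 /
        8.\<close>
      moreover have "L2_norm_sq \<Omega> (\<psi> n) \<ge> 3 / 8"
      proof -
        have "L2_norm_sq \<Omega> (\<lambda>x. S n x - \<psi> n x) = L2_norm_sq \<Omega> (\<lambda>x. \<psi> n x - S n x)"
          by (simp add: L2_norm_sq_def norm_minus_commute)
        then show ?thesis using L2_norm_sq_le_double[OF S(1)[of n] \<psi>L[of n]] S1[of n] \<psi>(2)[of n] \<eta>(2) by simp
      qed
      then have "V\<^sup>2 * (3 / 8) \<le> V\<^sup>2 * L2_norm_sq \<Omega> (\<psi> n)" by (intro mult_left_mono) auto
      ultimately have "V\<^sup>2 / 8 \<le> i" using E by simp
      then show ?thesis using i by (simp add: ennreal_leI)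
    qed simp
    \<comment> \<open>Double counting: \<open>k\<close> averages, each of mass at least V^2 / 8,
      share the total 4 V W. So k <= 32 W / V, and \<open>V\<close> scales like \<epsilon> to the
      dimension.\<close>
    have "ennreal (k * (V\<^sup>2 / 8)) = (\<Sum>n<k. ennreal (V\<^sup>2 / 8))"
      by (subst ennreal_mult) (auto simp: ennreal_of_nat_eq_real_of_nat)
    also have "\<dots> \<le> (\<Sum>n<k. I n)" by (intro sum_mono I_lower) simp
    finally have "ennreal (k * (V\<^sup>2 / 8)) \<le> ennreal (4 * V * W)" using I_sum by simp
    then have "k * (V\<^sup>2 / 8) \<le> 4 * V * W" using V0 W by (subst (asm) ennreal_le_iff) auto
    then have "k \<le> 32 * W / V" using V0 by (simp add: power2_eq_square field_simps)
    also have "32 * W / V = (32 * W / V1 * 8 ^ DIM('a)) * (1 + lam m) ^ DIM('a)"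
    proof -
      have "\<epsilon> ^ DIM('a) = 1 / (8 ^ DIM('a) * (1 + lam m) ^ DIM('a))"
        by (simp only: \<epsilon>_def power_divide power_mult_distrib power_one)
      then show ?thesis by (simp add: V)
    qed
    finally show ?thesis by (simp add: k_def)
  qed
  moreover have "32 * W / V1 * 8 ^ DIM('a) > 0" using W V1 by simp
  ultimately show ?thesis by blast
qed


section \<open>One-sided Fourier series\<close>

lemma norm_exp_ii_le:
  assumes "0 \<le> Im z" "l \<ge> 0"
  shows "cmod (exp (\<i> * of_real l * z)) \<le> 1"
  using assms by (simp add: mult_nonneg_nonneg)

text \<open>For Im z >= 0 the exponentials are bounded by 1, so the series converges uniformly on
  the closed half-plane. Its zero boundary values on ]-T, T[ allow an extension by 0 below the
  interval, and the identity theorem on the strip |Re z| < T spreads this 0 upward to the imaginary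
  axis.\<close>

lemma one_sided_series_zero:
  fixes c :: "nat \<Rightarrow> complex" and lam :: "nat \<Rightarrow> real"
  assumes c: "summable (\<lambda>n. cmod (c n))" and lam: "\<And>n. lam n \<ge> 0" and T: "T > 0"
    and zero: "\<And>t. \<bar>t\<bar> < T \<Longrightarrow> (\<Sum>n. c n * exp (\<i> * of_real (lam n * t))) = 0"
    and y: "y > 0"
  shows "(\<Sum>n. c n * exp (- of_real (lam n * y))) = 0"
proof -
  define H where "H z = (\<Sum>n. c n * exp (\<i> * of_real (lam n) * z))" for z
  define U where "U = {z::complex. 0 \<le> Im z}"
  have bound: "cmod (c n * exp (\<i> * of_real (lam n) * z)) \<le> cmod (c n)" if "z \<in> U" for n z
    using norm_exp_ii_le[of z "lam n"] that lam[of n] mult_left_mono[of "cmod (exp (\<i> * of_real (lam n) * z))" 1 "cmod (c n)"]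
    by (simp add: U_def norm_mult del: norm_exp_eq_Re)
  have unif: "uniform_limit U (\<lambda>k z. \<Sum>n<k. c n * exp (\<i> * of_real (lam n) * z)) H sequentially"
    unfolding H_def[abs_def] by (rule Weierstrass_m_test[OF _ c]) (use bound in auto)
  have contH: "continuous_on U H"
    by (rule uniform_limit_theorem[OF _ unif]) (auto intro!: always_eventually continuous_intros)
  have holH: "H holomorphic_on {z. 0 < Im z}"
  proof (rule holomorphic_uniform_sequence[OF open_halfspace_Im_gt])
    show "(\<lambda>z. \<Sum>n<k. c n * exp (\<i> * of_real (lam n) * z)) holomorphic_on {z. 0 < Im z}" for k
      by (intro holomorphic_intros)
    fix x :: complex assume "x \<in> {z. 0 < Im z}"
    then obtain d where d: "d > 0" "cball x d \<subseteq> {z. 0 < Im z}"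
      using open_contains_cball[of "{z. 0 < Im z}"] open_halfspace_Im_gt by blast
    then show "\<exists>d>0. cball x d \<subseteq> {z. 0 < Im z} \<and>
        uniform_limit (cball x d) (\<lambda>k z. \<Sum>n<k. c n * exp (\<i> * of_real (lam n) * z)) H sequentially"
      using uniform_limit_on_subset[OF unif, of "cball x d"] by (force simp: U_def)
  qed
  have H0: "H z = 0" if "Im z = 0" "\<bar>Re z\<bar> < T" for z
  proof -
    have "z = of_real (Re z)" using that by (simp add: complex_eq_iff)
    then have "H z = (\<Sum>n. c n * exp (\<i> * of_real (lam n * Re z)))"
      unfolding H_def by (metis (no_types, lifting) mult.assoc of_real_mult)
    then show ?thesis using zero that by simp
  qed
  define S where "S = {z. \<bar>Re z\<bar> < T} "
  define G where "G z = (if 0 \<le> Im z then H z else 0)" for z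
  have S: "open S" "connected S"
  proof -
    have "S = {z. Re z < T} \<inter> {z. - T < Re z}" by (auto simp: S_def)
    then show "open S" "connected S"
      by (auto intro!: open_Int open_halfspace_Re_lt open_halfspace_Re_gt convex_connected convex_Int convex_halfspace_Re_lt convex_halfspace_Re_gt)
  qed
  have "G holomorphic_on S"
  \<comment> \<open>The inner product of -\<i> with z is -Im z, so the side where it is negative is
    the upper half-plane.\<close>
  proof (rule holomorphic_on_paste_across_line[OF S(1), of "- \<i>" _ 0])
    show "G holomorphic_on S \<inter> {z. (- \<i>) \<bullet> z < 0}"
      by (rule holomorphic_transform[of H]) (auto simp: G_def intro: holomorphic_on_subset[OF holH])
    show "G holomorphic_on S \<inter> {z. 0 < (- \<i>) \<bullet> z}"
      by (rule holomorphic_transform[of "\<lambda>_. 0"]) (auto simp: G_def)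
    show "continuous_on S G"
    proof -
      have "S = (S \<inter> {z. 0 \<le> Im z}) \<union> (S \<inter> {z. Im z \<le> 0})" by auto
      moreover have "continuous_on ((S \<inter> {z. 0 \<le> Im z}) \<union> (S \<inter> {z. Im z \<le> 0})) G"
        unfolding G_def
      proof (rule continuous_on_cases_local)
        show "closedin (top_of_set ((S \<inter> {z. 0 \<le> Im z}) \<union> (S \<inter> {z. Im z \<le> 0}))) (S \<inter> {z. 0 \<le> Im z})"
          using closed_halfspace_Im_ge[of 0] by (auto simp: closedin_closed)
        show "closedin (top_of_set ((S \<inter> {z. 0 \<le> Im z}) \<union> (S \<inter> {z. Im z \<le> 0}))) (S \<inter> {z. Im z \<le> 0})"
          using closed_halfspace_Im_le[of 0] by (auto simp: closedin_closed)
        show "continuous_on (S \<inter> {z. 0 \<le> Im z}) H" by (rule continuous_on_subset[OF contH]) (auto simp: U_def)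
        show "H x = 0" if "x \<in> S \<inter> {z. 0 \<le> Im z} \<and> \<not> 0 \<le> Im x \<or> x \<in> S \<inter> {z. Im z \<le> 0} \<and> 0 \<le> Im x" for x
          using that H0 by (auto simp: S_def)
      qed auto
      ultimately show ?thesis by simp
    qed
  qed auto
  moreover have "\<i> * of_real y \<in> S" "- \<i> \<in> S" using T by (auto simp: S_def)
  moreover have "S \<inter> {z. Im z < 0} \<noteq> {}" "open (S \<inter> {z. Im z < 0})"
    using \<open>- \<i> \<in> S\<close> S by (force intro!: open_Int open_halfspace_Im_lt)+
  ultimately have "G (\<i> * of_real y) = 0"
    using analytic_continuation_open[of "S \<inter> {z. Im z < 0}" S G "\<lambda>_. 0" "\<i> * of_real y"] S
    by (auto simp: G_def)
  then have "H (\<i> * of_real y) = 0" using y by (simp add: G_def)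
  moreover have "\<i> * of_real (lam n) * (\<i> * of_real y) = - complex_of_real (lam n * y)" for n
    by (simp add: mult.assoc mult.left_commute)
  ultimately show ?thesis by (simp add: H_def)
qed

text \<open>After multiplication by e^(l y), the terms below \<open>l\<close> cancel by the
  induction hypothesis, those at \<open>l\<close> are constant and those above tend to 0, all
  dominated by |c n|. So the limit y -> \<infinity> is the sum over the group at
  \<open>l\<close>.\<close>

lemma Dirichlet_series_coeff_zero:
  fixes c :: "nat \<Rightarrow> complex" and lam :: "nat \<Rightarrow> real"
  assumes c: "summable (\<lambda>n. cmod (c n))" and inc: "incseq lam" and lim: "filterlim lam at_top sequentially"
    and zero: "\<And>y. y > 0 \<Longrightarrow> (\<Sum>n. c n * exp (- of_real (lam n * y))) = 0"
  shows "(\<Sum>m | lam m = l. c m) = 0"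
proof -
  have fin: "finite {m. lam m \<le> l}" for l
  proof -
    obtain K where "\<And>n. n \<ge> K \<Longrightarrow> lam n > l"
      using lim unfolding filterlim_at_top_dense eventually_sequentially by blast
    then have "{m. lam m \<le> l} \<subseteq> {..<K}" by (auto simp: not_le[symmetric])
    then show ?thesis by (rule finite_subset) auto
  qed
  have main: "(\<Sum>m | lam m = l. c m) = 0" if IH: "\<And>m. lam m < l \<Longrightarrow> (\<Sum>k | lam k = lam m. c k) = 0" for l
  proof -
    define A where "A = {m. lam m < l}"
    have finA: "finite A" "finite {m. lam m = l}"
      using fin[of l] by (auto simp: A_def intro: finite_subset[rotated])
    have lowzero: "(\<Sum>m\<in>A. c m * exp (of_real ((l - lam m) * y))) = 0" for y :: real
    proof -
      have "(\<Sum>m\<in>A. c m * exp (of_real ((l - lam m) * y))) =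
          (\<Sum>v\<in>lam ` A. \<Sum>m | m \<in> A \<and> lam m = v. c m * exp (of_real ((l - lam m) * y)))"
        by (rule sum.image_gen[OF finA(1)])
      also have "\<dots> = 0"
      proof (rule sum.neutral, rule ballI)
        fix v assume "v \<in> lam ` A"
        then obtain k where k: "v = lam k" "lam k < l" by (auto simp: A_def)
        have "(\<Sum>m | m \<in> A \<and> lam m = v. c m * exp (of_real ((l - lam m) * y)))
            = (\<Sum>m | lam m = lam k. c m * exp (of_real ((l - lam k) * y)))"
          using k by (intro sum.cong) (auto simp: A_def)
        also have "\<dots> = 0" using IH[OF k(2)] by (simp add: sum_distrib_right[symmetric])
        finally show "(\<Sum>m | m \<in> A \<and> lam m = v. c m * exp (of_real ((l - lam m) * y))) = 0" .
      qed
      finally show ?thesis .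
    qed
    \<comment> \<open>The terms with frequency below \<open>l\<close> would grow exponentially,
      spoiling the domination. By \<open>lowzero\<close> their sum is 0, so they may be left
      out.\<close>
    define w where "w y n = (if n \<in> A then 0 else c n * exp (of_real ((l - lam n) * y)))" for y :: real and n
    have wb: "cmod (w y n) \<le> cmod (c n)" if "y \<ge> 0" for y n
    proof (cases "n \<in> A")
      case False
      then have "(l - lam n) * y \<le> 0" using that by (intro mult_nonpos_nonneg) (auto simp: A_def)
      then have "cmod (exp (of_real ((l - lam n) * y))) \<le> 1" by simp
      then show ?thesis using mult_left_mono[of _ 1 "cmod (c n)"] unfolding w_def norm_mult by (simp add: norm_mult False)
    qed (simp add: w_def)
    have wsum: "(\<Sum>n. w y n) = 0" if "y > 0" for y
    proof -
      have sw: "summable (w y)"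
        using that by (intro summable_norm_cancel[OF summable_comparison_test[OF _ c]]) (simp add: wb)
      have "(\<lambda>n. w y n) sums (\<Sum>n. w y n)" using sw by (rule summable_sums)
      moreover have "(\<lambda>n. if n \<in> A then c n * exp (of_real ((l - lam n) * y)) else 0) sums 0"
        using sums_If_finite_set[OF finA(1), of "\<lambda>n. c n * exp (of_real ((l - lam n) * y))"] lowzero by simp
      ultimately have "(\<lambda>n. w y n + (if n \<in> A then c n * exp (of_real ((l - lam n) * y)) else 0)) sums ((\<Sum>n. w y n) + 0)"
        by (rule sums_add)
      also have "(\<lambda>n. w y n + (if n \<in> A then c n * exp (of_real ((l - lam n) * y)) else 0))
          = (\<lambda>n. exp (of_real (l * y)) * (c n * exp (- of_real (lam n * y))))"
        by (rule ext) (simp add: w_def algebra_simps exp_diff exp_minus field_simps)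
      finally have s: "(\<lambda>n. exp (of_real (l * y)) * (c n * exp (- of_real (lam n * y)))) sums (\<Sum>n. w y n)" by simp
      have "(\<lambda>n. c n * exp (- of_real (lam n * y))) sums (exp (- of_real (l * y)) * (\<Sum>n. w y n))"
        using sums_mult[OF s, of "exp (- of_real (l * y))"] by (simp add: mult.assoc[symmetric] exp_add[symmetric])
      then have "exp (- of_real (l * y)) * (\<Sum>n. w y n) = 0" using zero[OF that] sums_unique by metis
      then show ?thesis by simp
    qed
    have "((\<lambda>y. \<Sum>n. w y n) \<longlongrightarrow> (\<Sum>n. if lam n = l then c n else 0)) at_top"
    proof -
      have pt:  "((\<lambda>y. w y n) \<longlongrightarrow> (if lam n = l then c n else 0)) at_top" for n
      proof (cases "lam n \<le> l")
        case True
        then show ?thesis by (cases "lam n = l") (auto simp: w_def A_def)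
      next
        case False
        have "((\<lambda>y. exp ((l - lam n) * y)) \<longlongrightarrow> 0) at_top"
          using False by (intro filterlim_compose[OF exp_at_bot] filterlim_tendsto_neg_mult_at_bot[OF tendsto_const]) (auto simp: filterlim_ident)
        then have "((\<lambda>y. c n * of_real (exp ((l - lam n) * y))) \<longlongrightarrow> c n * of_real 0) at_top"
          by (intro tendsto_intros)
        then have "((\<lambda>y. c n * exp (of_real ((l - lam n) * y))) \<longlongrightarrow> 0) at_top"
          by (simp only: exp_of_real mult_zero_right of_real_0)
        then show ?thesis using False by (auto simp: w_def A_def)
      qed
      \<comment> \<open>The series is read as an integral over counting measure, which makes
        dominated convergence available.\<close>
      have ic: "integrable (count_space UNIV) (\<lambda>n. cmod (c n))"
        using c by (simp add: integrable_count_space_nat_iff)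
      have lim: "((\<lambda>y. LINT n|count_space UNIV. w y n) \<longlongrightarrow> (LINT n|count_space UNIV. (if lam n = l then c n else 0))) at_top"
      proof (rule integral_dominated_convergence_at_top[OF _ _ ic])
        show "\<forall>\<^sub>F y in at_top. AE n in count_space UNIV. norm (w y n) \<le> cmod (c n)"
          using eventually_ge_at_top[of 0] by eventually_elim (use wb in auto)
      qed (use pt in auto)
      have "(LINT n|count_space UNIV. w y n) = (\<Sum>n. w y n)" if "y \<ge> 0" for y
        by (intro integral_count_space_nat Bochner_Integration.integrable_bound[OF ic]) (use wb that in auto)
      then have "\<forall>\<^sub>F y in at_top. (LINT n|count_space UNIV. w y n) = (\<Sum>n. w y n)"
        by (intro eventually_mono[OF eventually_ge_at_top[of "0::real"]])
      moreover have "(LINT n|count_space UNIV. (if lam n = l then c n else 0)) = (\<Sum>n. if lam n = l then c n else 0)"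
        by (intro integral_count_space_nat Bochner_Integration.integrable_bound[OF ic]) auto
      ultimately show ?thesis using lim by (simp add: tendsto_cong)
    qed
    moreover have "((\<lambda>y. \<Sum>n. w y n) \<longlongrightarrow> 0) at_top"
      by (intro tendsto_eventually eventually_mono[OF eventually_gt_at_top[of "0::real"]] wsum)
    ultimately have "(\<Sum>n. if lam n = l then c n else 0) = 0"
      by (rule tendsto_unique[OF trivial_limit_at_top_linorder])
    moreover have "(\<lambda>n. if lam n = l then c n else 0) sums (\<Sum>m | lam m = l. c m)"
      using sums_If_finite[OF finA(2), of c] by simp
    ultimately show ?thesis using sums_unique by metis
  qed
  \<comment> \<open>The induction runs over indices, since real frequencies are not well-ordered;
    monotonicity sends smaller frequencies to smaller indices.\<close>
  have "(\<Sum>m | lam m = lam n. c m) = 0" for n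
  proof (induction n rule: less_induct)
    case (less n)
    show ?case
    proof (rule main)
      fix m assume "lam m < lam n"
      then have "m < n" using inc by (metis incseqD not_le)
      then show "(\<Sum>k | lam k = lam m. c k) = 0" by (rule less)
    qed
  qed
  then show ?thesis by (cases "{m. lam m = l} = {}") auto
qed


section \<open>Separation of the frequencies\<close>

text \<open>The empty list of times contributes the empty sum 0 to the supremum defining a
  length.\<close>

lemma T_max_nonneg:
  assumes "x \<in> \<Omega>"
  shows "0 \<le> T_max \<Omega> \<omega>"
proof -
  have "0 \<le> path_length \<gamma>" for \<gamma> :: "real \<Rightarrow> 'a"
    unfolding path_length_def by (rule SUP_upper2[of "[]"]) (auto simp: zero_ereal_def)
  then have "0 \<le> geodesic_setdist \<Omega> x \<omega>"
    unfolding geodesic_setdist_def geodesic_dist_def by (intro INF_greatest)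
  also have "\<dots> \<le> T_max \<Omega> \<omega>" unfolding T_max_def by (rule SUP_upper[OF assms])
  finally show ?thesis .
qed

section \<open>Absolute convergence of the series\<close>

text \<open>For an orthonormal family of eigenfunctions the left side of the second claim is bounded
  for each fixed \<open>j\<close>, so the pairings with \<phi> decay faster than any power of the
  frequency.\<close>

lemma pairing_laplacian_power:
  assumes "laplacian_eigen_eq \<Omega> f (- l\<^sup>2)" "\<phi> \<in> test_functions \<Omega>"
  shows "(laplacian ^^ j) \<phi> \<in> test_functions \<Omega>"
    and "cmod (pairing \<Omega> f ((laplacian ^^ j) \<phi>)) = l ^ (2 * j) * cmod (pairing \<Omega> f \<phi>)"
proof -
  have t: "(laplacian ^^ j) \<phi> \<in> test_functions \<Omega>" for j
    by (induction j) (simp_all add: assms(2) test_laplacian)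
  then show "(laplacian ^^ j) \<phi> \<in> test_functions \<Omega>" .
  show "cmod (pairing \<Omega> f ((laplacian ^^ j) \<phi>)) = l ^ (2 * j) * cmod (pairing \<Omega> f \<phi>)"
  proof (induction j)
    case (Suc j)
    have "pairing \<Omega> f ((laplacian ^^ Suc j) \<phi>) = of_real (- l\<^sup>2) * pairing \<Omega> f ((laplacian ^^ j) \<phi>)"
      using assms(1) t[of j] by (simp add: laplacian_eigen_eq_def)
    then have "cmod (pairing \<Omega> f ((laplacian ^^ Suc j) \<phi>)) = l\<^sup>2 * cmod (pairing \<Omega> f ((laplacian ^^ j) \<phi>))"
      by (simp only: norm_mult norm_of_real abs_minus_cancel abs_power2)
    then show ?case by (simp add: Suc power2_eq_square)
  qed simp
qed

lemma orthonormal_pairing_bounded: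
  assumes \<Omega>: "\<Omega> \<in> lmeasurable"
    and S: "\<And>n. S n \<in> L2_space \<Omega>" "\<And>m n. L2_inner \<Omega> (S m) (S n) = (if m = n then 1 else 0)"
    and \<phi>: "\<phi> \<in> test_functions \<Omega>"
  obtains B where "\<And>n. cmod (pairing \<Omega> (S n) \<phi>) \<le> B"
proof -
  have c: "(\<lambda>x. cnj (\<phi> x)) \<in> L2_space \<Omega>"
    by (rule test_in_L2_space[OF test_bounded_linear[OF bounded_linear_cnj \<phi>] \<Omega>])
  define A where "A = L2_norm_sq \<Omega> (\<lambda>x. cnj (\<phi> x)) + 1"
  have A: "L2_norm_sq \<Omega> (\<lambda>x. cnj (\<phi> x)) \<le> A" "A > 0"
    using L2_norm_sq_nonneg[of \<Omega> "\<lambda>x. cnj (\<phi> x)"] by (auto simp: A_def)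
  have "cmod (pairing \<Omega> (S n) \<phi>) \<le> sqrt A" for n
  proof -
    have "L2_norm_sq \<Omega> (S n) = 1" using S(2)[of n n] by (simp add: L2_inner_self)
    moreover have "pairing \<Omega> (S n) \<phi> = L2_inner \<Omega> (S n) (\<lambda>x. cnj (\<phi> x))"
      by (simp add: pairing_def L2_inner_def)
    ultimately have "(cmod (pairing \<Omega> (S n) \<phi>))\<^sup>2 \<le> A"
      using L2_Cauchy_Schwarz[OF S(1)[of n] c A] by simp
    then show ?thesis by (rule real_le_rsqrt)
  qed
  then show thesis by (rule that)
qed

lemma summable_coefficients:
  fixes \<Omega> :: "'a::euclidean_space set" and S :: "nat \<Rightarrow> 'a \<Rightarrow> complex" and lam :: "nat \<Rightarrow> real"
  assumes \<Omega>: "\<Omega> \<in> lmeasurable"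
    and S: "\<And>n. S n \<in> L2_space \<Omega>" "\<And>m n. L2_inner \<Omega> (S m) (S n) = (if m = n then 1 else 0)"
    and eig: "\<And>n. laplacian_eigen_eq \<Omega> (S n) (- (lam n)\<^sup>2)"
    and lam: "\<And>n. lam n > 0" "incseq lam"
    and growth: "C > 0" "\<And>n. real (Suc n) \<le> C * (1 + lam n) ^ DIM('a)"
    and a: "slowly_growing a" and \<phi>: "\<phi> \<in> test_functions \<Omega>"
  shows "summable (\<lambda>n. cmod (a n * pairing \<Omega> (S n) \<phi>))"
proof -
  obtain q :: nat where q: "summable (\<lambda>n. cmod (a n / (1 + of_nat n) ^ q))"
    using a by (auto simp: slowly_growing_def)
  \<comment> \<open>The growth bound gives (1 + n)^q <= C^q (1 + lam n)^j for this \<open>j\<close>;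
    the factor \<open>lam n ^ (2 * j)\<close> from \<open>j\<close> Laplacians pays for it.\<close>
  define j where "j = DIM('a) * q"
  obtain B where B: "\<And>n. cmod (pairing \<Omega> (S n) ((laplacian ^^ j) \<phi>)) \<le> B"
    using orthonormal_pairing_bounded[OF \<Omega> S pairing_laplacian_power(1)[OF eig \<phi>]] by metis
  \<comment> \<open>Converts 1 + lam n into a multiple of \<open>lam n\<close>, because
    \<open>lam 0\<close> is positive and the smallest frequency.\<close>
  define d where "d = 1 + 1 / lam 0"
  have d: "d > 0" using lam(1)[of 0] by (simp add: d_def add_pos_pos)
  have "cmod (a n * pairing \<Omega> (S n) \<phi>) \<le> (C ^ q * d ^ (2 * j) * B) * cmod (a n / (1 + of_nat n) ^ q)" for n
  proof -
    have "lam 0 \<le> lam n" using lam(2) by (simp add: incseq_def)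
    then have "1 + lam n \<le> d * lam n" using lam(1)[of 0] by (simp add: d_def field_simps)
    have "real (Suc n) ^ q \<le> (C * (1 + lam n) ^ DIM('a)) ^ q" by (intro power_mono growth) simp
    also have "\<dots> = C ^ q * (1 + lam n) ^ j" by (simp add: j_def power_mult_distrib power_mult[symmetric])
    also have "\<dots> \<le> C ^ q * (1 + lam n) ^ (2 * j)"
      using growth(1) lam(1)[of n] by (intro mult_left_mono power_increasing) auto
    also have "\<dots> \<le> C ^ q * (d * lam n) ^ (2 * j)"
      using growth(1) lam(1)[of n] \<open>1 + lam n \<le> d * lam n\<close> by (intro mult_left_mono power_mono) auto
    also have "\<dots> = C ^ q * d ^ (2 * j) * lam n ^ (2 * j)" by (simp add: power_mult_distrib)
    finally have "real (Suc n) ^ q * cmod (pairing \<Omega> (S n) \<phi>) \<le> C ^ q * d ^ (2 * j) * lam n ^ (2 * j) * cmod (pairing \<Omega> (S n) \<phi>)"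
      by (rule mult_right_mono) simp
    also have "\<dots> = C ^ q * d ^ (2 * j) * cmod (pairing \<Omega> (S n) ((laplacian ^^ j) \<phi>))"
      by (simp add: pairing_laplacian_power(2)[OF eig \<phi>])
    also have "\<dots> \<le> C ^ q * d ^ (2 * j) * B" using B growth(1) d by (intro mult_left_mono) auto
    finally have "cmod (pairing \<Omega> (S n) \<phi>) \<le> (C ^ q * d ^ (2 * j) * B) / real (Suc n) ^ q"
      by (simp add: field_simps)
    then have "cmod (a n * pairing \<Omega> (S n) \<phi>) \<le> cmod (a n) * ((C ^ q * d ^ (2 * j) * B) / real (Suc n) ^ q)"
      unfolding norm_mult by (rule mult_left_mono) simp
    also have "cmod ((1 + of_nat n) ^ q :: complex) = real (Suc n) ^ q"
      by (simp only: norm_power of_nat_Suc[symmetric] norm_of_nat)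
    then have "cmod (a n) * ((C ^ q * d ^ (2 * j) * B) / real (Suc n) ^ q) = (C ^ q * d ^ (2 * j) * B) * cmod (a n / (1 + of_nat n) ^ q)"
      by (simp only: norm_divide) (simp only: divide_inverse mult_ac)
    finally show ?thesis .
  qed
  then show ?thesis
    by (intro summable_comparison_test[OF _ summable_mult[OF q]]) auto
qed

lemma filterlim_at_top_growth:
  fixes lam :: "nat \<Rightarrow> real"
  assumes "C > 0" "\<And>n. real (Suc n) \<le> C * (1 + lam n) ^ N" "\<And>n. lam n > 0"
  shows "filterlim lam at_top sequentially"
  unfolding filterlim_at_top_dense
proof
  fix Z :: real
  obtain K :: nat where K: "C * (1 + \<bar>Z\<bar>) ^ N < real K" using reals_Archimedean2 by blast
  have "Z < lam n" if "n \<ge> K" for n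
  proof (rule ccontr)
    assume "\<not> Z < lam n"
    then have "C * (1 + lam n) ^ N \<le> C * (1 + \<bar>Z\<bar>) ^ N"
      using assms(1) assms(3)[of n] by (intro mult_left_mono power_mono) auto
    then show False using assms(2)[of n] K that by auto
  qed
  then show "eventually (\<lambda>n. Z < lam n) sequentially" by (auto simp: eventually_sequentially)
qed

text \<open>Partial sums that stop at the end of a frequency group vanish, and such stops occur
  arbitrarily late, so a convergent series cannot have a nonzero limit.\<close>

lemma suminf_zero_if_groups_zero:
  fixes d :: "nat \<Rightarrow> complex" and lam :: "nat \<Rightarrow> real"
  assumes d: "summable d" and inc: "incseq lam" and lim: "filterlim lam at_top sequentially"
    and zero: "\<And>l. (\<Sum>m | lam m = l. d m) = 0"
  shows "suminf d = 0"
proof (rule ccontr)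
  assume "suminf d \<noteq> 0"
  moreover have "(\<lambda>n. \<Sum>i\<le>n. d i) \<longlonglongrightarrow> suminf d" by (rule summable_LIMSEQ'[OF d])
  ultimately have "eventually (\<lambda>n. (\<Sum>i\<le>n. d i) \<noteq> 0) sequentially"
    by (intro tendsto_imp_eventually_ne)
  then obtain K where K: "\<And>n. n \<ge> K \<Longrightarrow> (\<Sum>i\<le>n. d i) \<noteq> 0" by (auto simp: eventually_sequentially)
  \<comment> \<open>Everything up to the end of the group of \<open>K\<close>: an initial segment,
    by monotonicity, that is a union of complete groups.\<close>
  define A where "A = {n. lam n \<le> lam K}"
  obtain L where L: "\<And>n. n \<ge> L \<Longrightarrow> lam n > lam K"
    using lim unfolding filterlim_at_top_dense eventually_sequentially by blast
  have "A \<subseteq> {..<L}" using L by (auto simp: A_def not_le[symmetric])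
  then have fin: "finite A" by (rule finite_subset) simp
  have KA: "K \<in> A" by (simp add: A_def)
  define k where "k = Max A"
  have kA: "k \<in> A" unfolding k_def using fin KA by (intro Max_in) auto
  have "A = {..k}"
  proof
    show "A \<subseteq> {..k}" using fin by (auto simp: k_def)
    show "{..k} \<subseteq> A" using kA inc by (auto simp: A_def incseq_def intro: order_trans)
  qed
  moreover have "(\<Sum>i\<in>A. d i) = (\<Sum>l\<in>lam ` A. \<Sum>i | i \<in> A \<and> lam i = l. d i)"
    by (rule sum.image_gen[OF fin])
  moreover have "(\<Sum>i | i \<in> A \<and> lam i = l. d i) = 0" if "l \<in> lam ` A" for l
  proof -
    have "{i. i \<in> A \<and> lam i = l} = {i. lam i = l}" using that by (auto simp: A_def)
    then show ?thesis using zero by simp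
  qed
  ultimately have "(\<Sum>i\<le>k. d i) = 0" by simp
  moreover have "k \<ge> K" unfolding k_def using fin KA by simp
  ultimately show False using K by blast
qed

theorem theorem2p4:
  fixes \<Omega> \<omega> :: "'a::euclidean_space set"
    and S :: "nat \<Rightarrow> 'a \<Rightarrow> complex"
    and lam :: "nat \<Rightarrow> real"
    and a :: "nat \<Rightarrow> complex"
    and T :: real
  assumes "open \<Omega>" and "bounded \<Omega>" and "connected \<Omega>"
    and "continuous_boundary \<Omega>" and "piecewise_smooth_boundary \<Omega>"
    and "L2_orthonormal_basis \<Omega> S"
    and "\<And>n. S n \<in> H1_0 \<Omega>"
    and "\<And>n. laplacian_eigen_eq \<Omega> (S n) (- (lam n)\<^sup>2)"
    and "\<And>n. lam n > 0"
    and "incseq (\<lambda>n. (lam n)\<^sup>2)"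
    and "slowly_growing a"
    and "open \<omega>" and "\<omega> \<noteq> {}" and "\<omega> \<subseteq> \<Omega>"
    and "T_max \<Omega> \<omega> < ereal T"
    and "\<forall>t\<in>{-T<..<T}. \<forall>\<phi>\<in>test_functions \<omega>. u_pairing \<Omega> S lam a t \<phi> = 0"
  shows "\<forall>t. \<forall>\<phi>\<in>test_functions \<Omega>. u_pairing \<Omega> S lam a t \<phi> = 0"
proof -
  \<comment> \<open>Provides the interval around 0 on which the boundary values vanish.\<close>
  have T: "T > 0"
  proof -
    obtain x where "x \<in> \<Omega>" using \<open>\<omega> \<noteq> {}\<close> \<open>\<omega> \<subseteq> \<Omega>\<close> by blast
    then have "0 < ereal T" using le_less_trans[OF T_max_nonneg assms(15)] by blast
    then show ?thesis by (simp add: zero_ereal_def)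
  qed
  have lm: "\<Omega> \<in> lmeasurable" using assms(1,2) by (simp add: lmeasurable_open)
  then have sets: "\<Omega> \<in> sets lebesgue" by auto
  have S: "\<And>n. S n \<in> L2_space \<Omega>" "\<And>m n. L2_inner \<Omega> (S m) (S n) = (if m = n then 1 else 0)"
    using assms(6) by (auto simp: L2_orthonormal_basis_def)
  have Si: "integrable (lebesgue_on \<Omega>) (S n)" for n by (rule L2_space_integrable[OF S(1) lm])
  have inc: "incseq lam"
  proof (rule incseq_SucI)
    fix n
    have "(lam n)\<^sup>2 \<le> (lam (Suc n))\<^sup>2" using assms(10) by (simp add: incseq_Suc_iff)
    then show "lam n \<le> lam (Suc n)" using less_imp_le[OF assms(9)] by (rule power2_le_imp_le)
  qed
  obtain C where C: "C > 0" "\<And>n. real (Suc n) \<le> C * (1 + lam n) ^ DIM('a)"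
    using Dirichlet_eigenvalue_growth[OF assms(1,2) S assms(7,8) less_imp_le[OF assms(9)] inc] by blast
  have lim: "filterlim lam at_top sequentially" by (rule filterlim_at_top_growth[OF C assms(9)])
  have sum: "summable (\<lambda>n. cmod (a n * pairing \<Omega> (S n) \<phi>))" if "\<phi> \<in> test_functions \<Omega>" for \<phi>
    by (rule summable_coefficients[OF lm S assms(8,9) inc C assms(11) that])
  \<comment> \<open>The part of \<open>u\<close> at frequency \<open>l\<close>, for every real
    \<open>l\<close>; it is an empty sum if \<open>l\<close> does not occur.\<close>
  define f where "f l x = (\<Sum>m | lam m = l. a m * S m x)" for l x
  have f_pairing: "pairing \<Omega> (f l) \<phi> = (\<Sum>m | lam m = l. a m * pairing \<Omega> (S m) \<phi>)" if "\<phi> \<in> test_functions \<Omega>" for l \<phi>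
  proof -
    have "pairing \<Omega> (f l) \<phi> = (LINT x|lebesgue_on \<Omega>. (\<Sum>m | lam m = l. a m * (S m x * \<phi> x)))"
      unfolding pairing_def f_def by (simp add: sum_distrib_right mult.assoc)
    also have "\<dots> = (\<Sum>m | lam m = l. (LINT x|lebesgue_on \<Omega>. a m * (S m x * \<phi> x)))"
      by (rule Bochner_Integration.integral_sum)
        (rule integrable_mult_right[OF integrable_mult_test[OF Si sets that]])
    finally show ?thesis by (simp add: pairing_def)
  qed
  have group_zero: "pairing \<Omega> (f l) \<phi> = 0" if \<phi>: "\<phi> \<in> test_functions \<Omega>" for l \<phi>
  proof (rule pairing_zero_local_to_global[OF _ sets _ \<phi>])
    show fi: "integrable (lebesgue_on \<Omega>) (f l)"
      unfolding f_def by (intro Bochner_Integration.integrable_sum integrable_mult_right Si)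
    fix x assume x: "x \<in> \<Omega>"
    show "\<exists>\<rho>>0. \<forall>\<phi>\<in>test_functions (ball x \<rho>). pairing \<Omega> (f l) \<phi> = 0"
    proof (rule locally_zero_unique_continuation[OF assms(1,3) fi _ _ assms(12,13,14) _ x])
      show "laplacian_eigen_eq \<Omega> (f l) (- l\<^sup>2)"
        unfolding laplacian_eigen_eq_def
      proof
        fix \<theta> assume \<theta>: "\<theta> \<in> test_functions \<Omega>"
        have "pairing \<Omega> (S m) (laplacian \<theta>) = of_real (- l\<^sup>2) * pairing \<Omega> (S m) \<theta>" if "lam m = l" for m
          using assms(8)[of m] \<theta> that by (auto simp: laplacian_eigen_eq_def)
        then have "(\<Sum>m | lam m = l. a m * pairing \<Omega> (S m) (laplacian \<theta>))
            = (\<Sum>m | lam m = l. of_real (- l\<^sup>2) * (a m * pairing \<Omega> (S m) \<theta>))"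
          by (intro sum.cong) auto
        then show "pairing \<Omega> (f l) (laplacian \<theta>) = of_real (- l\<^sup>2) * pairing \<Omega> (f l) \<theta>"
          unfolding f_pairing[OF \<theta>] f_pairing[OF test_laplacian[OF \<theta>]] by (simp only: sum_distrib_left)
      qed
    next
      fix \<theta> assume \<theta>: "\<theta> \<in> test_functions \<omega>"
      then have \<theta>': "\<theta> \<in> test_functions \<Omega>" using test_functions_mono[OF assms(14)] by blast
      \<comment> \<open>The two results on one-sided series combined: the data on ]-T, T[ give zeros
        at the points \<i> y, and these give zero for each group.\<close>
      have "(\<Sum>m | lam m = l. a m * pairing \<Omega> (S m) \<theta>) = 0"
      proof (rule Dirichlet_series_coeff_zero[OF sum[OF \<theta>'] inc lim])
        show "(\<Sum>n. a n * pairing \<Omega> (S n) \<theta> * exp (- of_real (lam n * y))) = 0" if "y > 0" for y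
        proof (rule one_sided_series_zero[OF sum[OF \<theta>'] less_imp_le[OF assms(9)] T _ that])
          show "(\<Sum>n. a n * pairing \<Omega> (S n) \<theta> * exp (\<i> * of_real (lam n * t))) = 0" if "\<bar>t\<bar> < T" for t
          proof -
            have "t \<in> {-T<..<T}" using that by auto
            then show ?thesis using assms(16) \<theta> unfolding u_pairing_def by blast
          qed
        qed
      qed
      then show "pairing \<Omega> (f l) \<theta> = 0" by (simp add: f_pairing[OF \<theta>'])
    qed simp
  qed
  show ?thesis
  proof (intro allI ballI)
    fix t \<phi> assume \<phi>: "\<phi> \<in> test_functions \<Omega>"
    show "u_pairing \<Omega> S lam a t \<phi> = 0"
      unfolding u_pairing_def
    proof (rule suminf_zero_if_groups_zero[OF _ inc lim])
      show "summable (\<lambda>n. a n * pairing \<Omega> (S n) \<phi> * exp (\<i> * of_real (lam n * t)))"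
        by (rule summable_norm_cancel) (use sum[OF \<phi>] in \<open>simp add: norm_mult\<close>)
      fix l
      \<comment> \<open>Within a group the time factor is the constant e^(\<i> l t), so group sums
        vanish at all times.\<close>
      have "(\<Sum>m | lam m = l. a m * pairing \<Omega> (S m) \<phi> * exp (\<i> * of_real (lam m * t)))
          = (\<Sum>m | lam m = l. a m * pairing \<Omega> (S m) \<phi>) * exp (\<i> * of_real (l * t))"
        unfolding sum_distrib_right by (rule sum.cong) auto
      also have "\<dots> = 0" using group_zero[OF \<phi>, of l] by (simp add: f_pairing[OF \<phi>])
      finally show "(\<Sum>m | lam m = l. a m * pairing \<Omega> (S m) \<phi> * exp (\<i> * of_real (lam m * t))) = 0" .
    qed
  qed
qed

end
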